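(* Let $k$ be a perfect field of characteristic $p>0$, let $G$ be a finite group with a local action $\rho\colon G\to\operatorname{Aut}_k k[[t]]$, and let $N$ be a normal subgroup of $G$. Let $\mathrm{ind}_{k[\varepsilon]}\colon \mathrm{H}^1(G,\Theta)\to\mathrm{H}^1(G/N,\Theta^\sharp)$ be the map on tangent spaces induced by the induction morphism $\mathrm{ind}\colon D_G\to D_{G/N}$. Then the diagram consisting of - the map $\iota_*\colon\mathrm{H}^1(G/N,\Theta^N)\to\mathrm{H}^1(G/N,\Theta^\sharp)$ induced by $\Theta^N\hookrightarrow\Theta^\sharp$, - the map $j_*\colon\mathrm{H}^1(G,\Theta)\to\mathrm{H}^1(G,\Theta_1)$ induced by $\Theta\hookrightarrow\Theta_1$, - the (injective) inflation maps $\inf\colon\mathrm{H}^1(G/N,\Theta^N)\hookrightarrow\mathrm{H}^1(G,\Theta)$ and $\inf\colon\mathrm{H}^1(G/N,\Theta^\sharp)=\mathrm{H}^1(G/N,\Theta_1^N)\hookrightarrow\mathrm{H}^1(G,\Theta_1)$, - the diagonal map $\mathrm{ind}_{k[\varepsilon]}\colon\mathrm{H}^1(G,\Theta)\to\mathrm{H}^1(G/N,\Theta^\sharp)$ is commutative; that is, $\mathrm{ind}_{k[\varepsilon]}\circ\inf=\iota_*$, $\ \inf\circ\,\mathrm{ind}_{k[\varepsilon]}=j_*$ and $\inf\circ\,\iota_*=j_*\circ\inf$.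
   Context: **Deformation functors.** $\mathcal C$ is the category of local artinian $W(k)$-algebras with residue field $k$, with local $W(k)$-algebra homomorphisms. Write $\Gamma_A=\operatorname{Aut}_A A[[t]]$. A local $G$-action is an injective homomorphism $\rho\colon G\to\Gamma_k$. A lift of $\rho$ to $A\in\mathcal C$ is a homomorphism $\rho_A\colon G\to\Gamma_A$ reducing to $\rho$ modulo $\mathfrak m_A$; two lifts are equivalent if conjugate by an element of $\ker(\Gamma_A\to\Gamma_k)$. $D_G(A)$ is the set of equivalence classes of lifts of $\rho$ to $A$. **Induction.** $k[[t]]^N=k[[y_N]]$ with $y_N=\prod_{s\in N}\rho(s)(t)$, and $\rho$ induces a local $G/N$-action $\rho^\sharp\colon G/N\to\operatorname{Aut}_k k[[y_N]]$; $D_{G/N}$ is its deformation functor. For a lift $\rho_A$ of $\rho$, $A[[t]]^N=A[[y_A]]$ with $y_A=\prod_{s\in N}\rho_A(s)(t)$, and restricting the $\rho_A(g)$ to $A[[t]]^N\cong A[[y]]$ ($y\mapsto y_A$) gives a lift $\rho_A^\sharp$ of $\rho^\sharp$; $\mathrm{ind}\colon D_G\to D_{G/N}$ sends $[\rho_A]$ to $[\rho_A^\sharp]$. **Modules.** $\Theta=\operatorname{Der}_k k[[t]]$ with $G$-action $d^g=\rho(g)\,d\,\rho(g)^{-1}$; $\Theta^\sharp=\operatorname{Der}_k(k[[t]]^N)$ with $G/N$-action $d^{\bar g}=\rho^\sharp(\bar g)\,d\,\rho^\sharp(\bar g)^{-1}$. Restricting derivations gives an embedding $\Theta^N\hookrightarrow\Theta^\sharp$.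 Put $y_G=\prod_{g\in G}\rho(g)(t)$, so $k[[t]]^G=k[[y_G]]$. Write $\mathcal D_{S/R}$ for the different of an extension $S/R$. The maps $d\mapsto d(y_G)$ identify $\Theta$ with the ideal $\mathcal D_{k[[t]]/k[[t]]^G}$ of $k[[t]]$ and $\Theta^\sharp$ with the ideal $\mathcal D_{k[[t]]^N/k[[t]]^G}$ of $k[[t]]^N$, compatibly with the group actions and with $\Theta^N\hookrightarrow\Theta^\sharp$. Let $\Theta_1=\mathcal D_{k[[t]]^N/k[[t]]^G}\cdot k[[t]]$, an ideal of $k[[t]]$ regarded as a $G$-module via $\rho$. Then $\Theta\subseteq\Theta_1$ and $\Theta_1^N=\Theta_1\cap k[[t]]^N=\Theta^\sharp$ under these identifications. **Tangent spaces.** $k[\varepsilon]=k[w]/w^2$. The set $D_G(k[\varepsilon])$ is identified with $\mathrm{H}^1(G,\Theta)$: the class of a 1-cocycle $(d_g)$, $d_g\in\Theta$, corresponds to the class of the lift $\rho_A(g)(x)=\rho(g)(x)+\varepsilon\, d_g(\rho(g)(x))$ for $x\in k[[t]]$. Similarly $D_{G/N}(k[\varepsilon])=\mathrm{H}^1(G/N,\Theta^\sharp)$. *)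

theory Defs
  imports
    "HOL-Computational_Algebra.Formal_Laurent_Series"
    "HOL-Algebra.Bij"
    "HOL-Algebra.Coset"
begin

section \<open>The dual numbers $k[\varepsilon]$\<close>

text \<open>\<open>Dual a b\<close> is $a + b\varepsilon$ with $\varepsilon^2 = 0$.\<close>

datatype 'a dual_number = Dual (std_part: 'a) (eps_part: 'a)

instantiation dual_number :: (comm_ring_1) comm_ring_1
begin

definition "0 = Dual 0 0"
definition "1 = Dual 1 0"
definition "x + y = Dual (std_part x + std_part y) (eps_part x + eps_part y)"
definition "- x = Dual (- std_part x) (- eps_part x)"
definition "x - y = Dual (std_part x - std_part y) (eps_part x - eps_part y)"
definition "x * y = Dual (std_part x * std_part y)
                         (std_part x * eps_part y + eps_part x * std_part y)"

instance
  by standard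
     (simp_all add: zero_dual_number_def one_dual_number_def plus_dual_number_def
        uminus_dual_number_def minus_dual_number_def times_dual_number_def algebra_simps)

end


section \<open>First group cohomology\<close>

text \<open>A module over a group \<open>G\<close> is given by an abelian group \<open>M\<close>, stored (although it is thought of
  additively) in the multiplicative fields of a \<open>monoid\<close> record, and the action \<open>act g m\<close>.\<close>

definition Z1 :: "('g, 'b) monoid_scheme \<Rightarrow> ('m, 'c) monoid_scheme \<Rightarrow> ('g \<Rightarrow> 'm \<Rightarrow> 'm)
    \<Rightarrow> ('g \<Rightarrow> 'm) monoid" where
  "Z1 G M act =
     \<lparr>carrier = {c \<in> carrier G \<rightarrow>\<^sub>E carrier M.
        \<forall>g\<in>carrier G. \<forall>h\<in>carrier G. c (g \<otimes>\<^bsub>G\<^esub> h) = c g \<otimes>\<^bsub>M\<^esub> act g (c h)},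
      mult = (\<lambda>c c'. \<lambda>g\<in>carrier G. c g \<otimes>\<^bsub>M\<^esub> c' g),
      one = (\<lambda>g\<in>carrier G. \<one>\<^bsub>M\<^esub>)\<rparr>"

definition B1 :: "('g, 'b) monoid_scheme \<Rightarrow> ('m, 'c) monoid_scheme \<Rightarrow> ('g \<Rightarrow> 'm \<Rightarrow> 'm)
    \<Rightarrow> ('g \<Rightarrow> 'm) set" where
  "B1 G M act = {\<lambda>g\<in>carrier G. act g m \<otimes>\<^bsub>M\<^esub> inv\<^bsub>M\<^esub> m | m. m \<in> carrier M}"

definition H1 :: "('g, 'b) monoid_scheme \<Rightarrow> ('m, 'c) monoid_scheme \<Rightarrow> ('g \<Rightarrow> 'm \<Rightarrow> 'm)
    \<Rightarrow> ('g \<Rightarrow> 'm) set monoid" where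
  "H1 G M act = Z1 G M act Mod B1 G M act"

definition H1_class :: "('g, 'b) monoid_scheme \<Rightarrow> ('m, 'c) monoid_scheme \<Rightarrow> ('g \<Rightarrow> 'm \<Rightarrow> 'm)
    \<Rightarrow> ('g \<Rightarrow> 'm) \<Rightarrow> ('g \<Rightarrow> 'm) set" where
  "H1_class G M act c = B1 G M act #>\<^bsub>Z1 G M act\<^esub> c"

text \<open>The map into \<open>H1 G M act\<close> given on cocycles by \<open>F\<close>; the image of a class is the common class
  of the \<open>F c\<close>, where \<open>c\<close> runs over all its representatives.\<close>

definition H1_map :: "('g, 'b) monoid_scheme \<Rightarrow> ('m, 'c) monoid_scheme \<Rightarrow> ('g \<Rightarrow> 'm \<Rightarrow> 'm)
    \<Rightarrow> ('z \<Rightarrow> 'g \<Rightarrow> 'm) \<Rightarrow> 'z set \<Rightarrow> ('g \<Rightarrow> 'm) set" where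
  "H1_map G M act F X = the_elem ((\<lambda>c. H1_class G M act (F c)) ` X)"

definition invariants :: "('m, 'c) monoid_scheme \<Rightarrow> ('g \<Rightarrow> 'm \<Rightarrow> 'm) \<Rightarrow> 'g set
    \<Rightarrow> ('m, 'c) monoid_scheme" where
  "invariants M act N = M\<lparr>carrier := {m \<in> carrier M. \<forall>s\<in>N. act s m = m}\<rparr>"

text \<open>The action of a coset of \<open>N\<close> on \<open>N\<close>-invariant elements.\<close>

definition coset_act :: "('g \<Rightarrow> 'm \<Rightarrow> 'm) \<Rightarrow> 'g set \<Rightarrow> 'm \<Rightarrow> 'm" where
  "coset_act act C m = the_elem ((\<lambda>g. act g m) ` C)"

text \<open>Inflation from \<open>H1 (G Mod N) (invariants M act N) (coset_act act)\<close> to \<open>H1 G M act\<close>.\<close>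

definition inflation :: "('g, 'b) monoid_scheme \<Rightarrow> 'g set \<Rightarrow> ('m, 'c) monoid_scheme
    \<Rightarrow> ('g \<Rightarrow> 'm \<Rightarrow> 'm) \<Rightarrow> ('g set \<Rightarrow> 'm) set \<Rightarrow> ('g \<Rightarrow> 'm) set" where
  "inflation G N M act = H1_map G M act (\<lambda>c. \<lambda>g\<in>carrier G. c (N #>\<^bsub>G\<^esub> g))"


section \<open>Automorphisms of power series rings and local actions\<close>

text \<open>The group of \<open>A\<close>-algebra automorphisms of an \<open>A\<close>-subalgebra \<open>R\<close> of $A[[t]]$. Preservation of
  the unit is contained in the last clause. No continuity is required: for \<open>A\<close> local artinian,
  every \<open>A\<close>-algebra automorphism of $A[[t]]$ preserves the maximal ideal.\<close>

definition alg_Aut :: "'a::comm_ring_1 fps set \<Rightarrow> ('a fps \<Rightarrow> 'a fps) monoid" where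
  "alg_Aut R = BijGroup R
     \<lparr>carrier := {\<sigma> \<in> Bij R.
        (\<forall>x\<in>R. \<forall>y\<in>R. \<sigma> (x + y) = \<sigma> x + \<sigma> y \<and> \<sigma> (x * y) = \<sigma> x * \<sigma> y) \<and>
        (\<forall>a. \<sigma> (fps_const a) = fps_const a)}\<rparr>"

definition Gam :: "('a::comm_ring_1 fps \<Rightarrow> 'a fps) monoid" where
  "Gam = alg_Aut UNIV"

definition local_action :: "('g, 'b) monoid_scheme \<Rightarrow> ('g \<Rightarrow> 'k::field fps \<Rightarrow> 'k fps) \<Rightarrow> bool" where
  "local_action G \<rho> \<longleftrightarrow> \<rho> \<in> hom G Gam \<and> inj_on \<rho> (carrier G)"

definition fixed_ring :: "('g \<Rightarrow> 'a::comm_ring_1 fps \<Rightarrow> 'a fps) \<Rightarrow> 'g set \<Rightarrow> 'a fps set" where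
  "fixed_ring \<rho> S = {f. \<forall>s\<in>S. \<rho> s f = f}"

definition norm_param :: "('g \<Rightarrow> 'a::comm_ring_1 fps \<Rightarrow> 'a fps) \<Rightarrow> 'g set \<Rightarrow> 'a fps" where
  "norm_param \<rho> S = (\<Prod>s\<in>S. \<rho> s fps_X)"

text \<open>The induced action $\rho^\sharp$ of \<open>G Mod N\<close> on $k[[t]]^N$.\<close>

definition sharp_action :: "'g set \<Rightarrow> ('g \<Rightarrow> 'k::field fps \<Rightarrow> 'k fps)
    \<Rightarrow> 'g set \<Rightarrow> 'k fps \<Rightarrow> 'k fps" where
  "sharp_action N \<rho> C = (\<lambda>x\<in>fixed_ring \<rho> N. the_elem ((\<lambda>g. \<rho> g x) ` C))"


section \<open>Deformation functors\<close>

text \<open>An object \<open>A\<close> of the category of coefficient rings is given by a type \<open>'a\<close> together with its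
  residue map \<open>res\<close> to \<open>'k\<close>; only the case of the dual numbers, with \<open>res = std_part\<close>, is used
  below.

  The deformation functor is needed both for \<open>G\<close> acting on $k[[t]]$ and for \<open>G Mod N\<close> acting on
  $k[[t]]^N = k[[y_N]]$. To treat them uniformly we consider a group \<open>H\<close> acting by \<open>\<rho>\<close> on a subring
  $k[[\pi]]$ of $k[[t]]$, where \<open>\<pi>\<close> has vanishing constant term (\<open>\<pi> = fps_X\<close> in the first case and
  $\pi = y_N$ in the second). A lift to \<open>A\<close> acts on the power series ring $A[[y]]$, and the
  reduction map is $A[[y]] \to k[[y]] \cong k[[\pi]]$, where $y$ corresponds to \<open>\<pi>\<close>.\<close>

definition fps_reduce :: "('a::zero \<Rightarrow> 'b::zero) \<Rightarrow> 'a fps \<Rightarrow> 'b fps" where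
  "fps_reduce h f = Abs_fps (\<lambda>n. h (f $ n))"

definition lifts :: "('a::comm_ring_1 \<Rightarrow> 'k::field) \<Rightarrow> ('h, 'b) monoid_scheme \<Rightarrow> 'k fps
    \<Rightarrow> ('h \<Rightarrow> 'k fps \<Rightarrow> 'k fps) \<Rightarrow> ('h \<Rightarrow> 'a fps \<Rightarrow> 'a fps) set" where
  "lifts res H \<pi> \<rho> = {\<rho>A \<in> hom H Gam. \<forall>h\<in>carrier H. \<forall>f.
     fps_compose (fps_reduce res (\<rho>A h f)) \<pi> = \<rho> h (fps_compose (fps_reduce res f) \<pi>)}"

definition Gam_kernel :: "('a::comm_ring_1 \<Rightarrow> 'k::field) \<Rightarrow> ('a fps \<Rightarrow> 'a fps) set" where
  "Gam_kernel res = {\<gamma> \<in> carrier Gam. \<forall>f. fps_reduce res (\<gamma> f) = fps_reduce res f}"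

definition lift_equiv :: "('a::comm_ring_1 \<Rightarrow> 'k::field) \<Rightarrow> ('h, 'b) monoid_scheme \<Rightarrow> 'k fps
    \<Rightarrow> ('h \<Rightarrow> 'k fps \<Rightarrow> 'k fps) \<Rightarrow> ('h \<Rightarrow> 'a fps \<Rightarrow> 'a fps) rel" where
  "lift_equiv res H \<pi> \<rho> = {(\<rho>1, \<rho>2). \<rho>1 \<in> lifts res H \<pi> \<rho> \<and> \<rho>2 \<in> lifts res H \<pi> \<rho> \<and>
     (\<exists>\<gamma>\<in>Gam_kernel res. \<forall>h\<in>carrier H.
        \<rho>2 h = \<gamma> \<otimes>\<^bsub>Gam\<^esub> \<rho>1 h \<otimes>\<^bsub>Gam\<^esub> inv\<^bsub>Gam\<^esub> \<gamma>)}"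

definition Def_functor :: "('a::comm_ring_1 \<Rightarrow> 'k::field) \<Rightarrow> ('h, 'b) monoid_scheme \<Rightarrow> 'k fps
    \<Rightarrow> ('h \<Rightarrow> 'k fps \<Rightarrow> 'k fps) \<Rightarrow> ('h \<Rightarrow> 'a fps \<Rightarrow> 'a fps) set set" where
  "Def_functor res H \<pi> \<rho> = lifts res H \<pi> \<rho> // lift_equiv res H \<pi> \<rho>"


section \<open>Induction\<close>

text \<open>Substitution $f(g)$ for \<open>g\<close> with nilpotent constant term (over an artinian ring $y_A$ need not
  have vanishing constant term, so \<open>fps_compose\<close> is not appropriate). Each coefficient
  of $f(g) = \sum_i f_i g^i$ is a finite sum.\<close>

definition fps_subst :: "'a::comm_ring_1 fps \<Rightarrow> 'a fps \<Rightarrow> 'a fps" where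
  "fps_subst f g = Abs_fps (\<lambda>n. \<Sum>i | (g ^ i) $ n \<noteq> 0. f $ i * (g ^ i) $ n)"

text \<open>The lift $\rho_A^\sharp$: the restriction of $\rho_A(g)$ to $A[[t]]^N$, transported to $A[[y]]$
  along the isomorphism \<open>\<phi>\<close> sending $y$ to $y_A$.\<close>

definition sharp_lift :: "'g set \<Rightarrow> ('g \<Rightarrow> 'a::comm_ring_1 fps \<Rightarrow> 'a fps)
    \<Rightarrow> 'g set \<Rightarrow> 'a fps \<Rightarrow> 'a fps" where
  "sharp_lift N \<rho>A C =
     (let \<phi> = (\<lambda>f. fps_subst f (norm_param \<rho>A N))
      in the_elem ((\<lambda>g. inv_into UNIV \<phi> \<circ> \<rho>A g \<circ> \<phi>) ` C))"

definition ind :: "('a::comm_ring_1 \<Rightarrow> 'k::field) \<Rightarrow> ('g, 'b) monoid_scheme \<Rightarrow> 'g set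
    \<Rightarrow> ('g \<Rightarrow> 'k fps \<Rightarrow> 'k fps) \<Rightarrow> ('g \<Rightarrow> 'a fps \<Rightarrow> 'a fps) set
    \<Rightarrow> ('g set \<Rightarrow> 'a fps \<Rightarrow> 'a fps) set" where
  "ind res G N \<rho> X = the_elem
     ((\<lambda>\<rho>A. lift_equiv res (G Mod N) (norm_param \<rho> N) (sharp_action N \<rho>) `` {sharp_lift N \<rho>A}) ` X)"


section \<open>Modules of derivations\<close>

definition Der :: "'k::field fps set \<Rightarrow> ('k fps \<Rightarrow> 'k fps) monoid" where
  "Der R =
     \<lparr>carrier = {d \<in> R \<rightarrow>\<^sub>E R.
        (\<forall>x\<in>R. \<forall>y\<in>R. d (x + y) = d x + d y \<and> d (x * y) = d x * y + x * d y) \<and>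
        (\<forall>a. \<forall>x\<in>R. d (fps_const a * x) = fps_const a * d x)},
      mult = (\<lambda>d e. \<lambda>x\<in>R. d x + e x),
      one = (\<lambda>x\<in>R. 0)\<rparr>"

definition Der_act :: "'k::field fps set \<Rightarrow> ('h \<Rightarrow> 'k fps \<Rightarrow> 'k fps)
    \<Rightarrow> 'h \<Rightarrow> ('k fps \<Rightarrow> 'k fps) \<Rightarrow> 'k fps \<Rightarrow> 'k fps" where
  "Der_act R \<rho> h d = (\<lambda>x\<in>R. \<rho> h (d (inv_into R (\<rho> h) x)))"

definition H1_Theta where
  "H1_Theta G \<rho> = H1 G (Der UNIV) (Der_act UNIV \<rho>)"

definition H1_Theta_N where
  "H1_Theta_N G N \<rho> =
     H1 (G Mod N) (invariants (Der UNIV) (Der_act UNIV \<rho>) N) (coset_act (Der_act UNIV \<rho>))"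

definition H1_Theta_sharp where
  "H1_Theta_sharp G N \<rho> =
     H1 (G Mod N) (Der (fixed_ring \<rho> N)) (Der_act (fixed_ring \<rho> N) (sharp_action N \<rho>))"


section \<open>The different\<close>

text \<open>Here \<open>R \<subseteq> S\<close> are subrings of a field with fraction fields \<open>K \<subseteq> L\<close>.\<close>

definition frac_field :: "'f::field set \<Rightarrow> 'f set" where
  "frac_field R = {a / b | a b. a \<in> R \<and> b \<in> R \<and> b \<noteq> 0}"

definition rel_basis :: "'f::field set \<Rightarrow> 'f set \<Rightarrow> 'f set \<Rightarrow> bool" where
  "rel_basis K L B \<longleftrightarrow> finite B \<and> B \<subseteq> L \<and>
     (\<forall>x\<in>L. \<exists>!c. c \<in> B \<rightarrow>\<^sub>E K \<and> x = (\<Sum>b\<in>B. c b * b))"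

definition rel_coord :: "'f::field set \<Rightarrow> 'f set \<Rightarrow> 'f \<Rightarrow> 'f \<Rightarrow> 'f" where
  "rel_coord K B x = (THE c. c \<in> B \<rightarrow>\<^sub>E K \<and> x = (\<Sum>b\<in>B. c b * b))"

text \<open>The trace of the \<open>K\<close>-linear endomorphism of \<open>L\<close> given by multiplication with \<open>x\<close>, computed in
  some \<open>K\<close>-basis of \<open>L\<close>.\<close>

definition field_trace :: "'f::field set \<Rightarrow> 'f set \<Rightarrow> 'f \<Rightarrow> 'f" where
  "field_trace K L x = (let B = (SOME B. rel_basis K L B) in \<Sum>b\<in>B. rel_coord K B (x * b) b)"

definition codifferent :: "'f::field set \<Rightarrow> 'f set \<Rightarrow> 'f set" where
  "codifferent R S =
     {x \<in> frac_field S. \<forall>s\<in>S. field_trace (frac_field R) (frac_field S) (x * s) \<in> R}"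

definition different :: "'f::field set \<Rightarrow> 'f set \<Rightarrow> 'f set" where
  "different R S = {x \<in> frac_field S. \<forall>z\<in>codifferent R S. x * z \<in> S}"

text \<open>The different of an extension of subrings of $k[[t]]$, computed inside $k((t))$.\<close>

definition fps_different :: "'k::field fps set \<Rightarrow> 'k fps set \<Rightarrow> 'k fps set" where
  "fps_different R S = {x. fps_to_fls x \<in> different (fps_to_fls ` R) (fps_to_fls ` S)}"

text \<open>The extension to $k[[t]]$ of the different of $k[[t]]^N / k[[t]]^G$; \<open>module.span (*) D\<close> is the
  ideal of $k[[t]]$ generated by \<open>D\<close>.\<close>

definition Theta1 :: "('g, 'b) monoid_scheme \<Rightarrow> 'g set \<Rightarrow> ('g \<Rightarrow> 'k::field fps \<Rightarrow> 'k fps)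
    \<Rightarrow> 'k fps monoid" where
  "Theta1 G N \<rho> =
     \<lparr>carrier = module.span (*) (fps_different (fixed_ring \<rho> (carrier G)) (fixed_ring \<rho> N)),
      mult = (+), one = 0\<rparr>"

definition H1_Theta1 where
  "H1_Theta1 G N \<rho> = H1 G (Theta1 G N \<rho>) \<rho>"

definition H1_Theta1_N where
  "H1_Theta1_N G N \<rho> = H1 (G Mod N) (invariants (Theta1 G N \<rho>) \<rho> N) (coset_act \<rho>)"


section \<open>The maps of the diagram\<close>

text \<open>The embedding of $\Theta^N$ into $\Theta^\sharp$ is restriction of derivations to $k[[t]]^N$.\<close>

definition iota_map where
  "iota_map G N \<rho> =
     H1_map (G Mod N) (Der (fixed_ring \<rho> N)) (Der_act (fixed_ring \<rho> N) (sharp_action N \<rho>))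
       (\<lambda>c. \<lambda>C\<in>carrier (G Mod N). restrict (c C) (fixed_ring \<rho> N))"

text \<open>A derivation \<open>d\<close> in $\Theta$ or $\Theta^\sharp$ is viewed as the power series $d(y_G)$.\<close>

definition j_map where
  "j_map G N \<rho> = H1_map G (Theta1 G N \<rho>) \<rho>
     (\<lambda>c. \<lambda>g\<in>carrier G. c g (norm_param \<rho> (carrier G)))"

definition sharp_ident where
  "sharp_ident G N \<rho> = H1_map (G Mod N) (invariants (Theta1 G N \<rho>) \<rho> N) (coset_act \<rho>)
     (\<lambda>c. \<lambda>C\<in>carrier (G Mod N). c C (norm_param \<rho> (carrier G)))"

definition inf_Theta where
  "inf_Theta G N \<rho> = inflation G N (Der UNIV) (Der_act UNIV \<rho>)"

definition inf_sharp where
  "inf_sharp G N \<rho> = inflation G N (Theta1 G N \<rho>) \<rho> \<circ> sharp_ident G N \<rho>"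


section \<open>The induction map on tangent spaces\<close>

text \<open>The lift attached to a cocycle \<open>c\<close> with values in the derivations of $k[[\pi]]$. On
  $k[[\pi]][\varepsilon]$ it is the $k[\varepsilon]$-linear extension of
  $x \mapsto \rho(h)(x) + \varepsilon\, c_h(\rho(h)(x))$, so it sends $x_0 + \varepsilon x_1$ to
  $\rho(h)(x_0) + \varepsilon(\rho(h)(x_1) + c_h(\rho(h)(x_0)))$. This is transported to
  $k[\varepsilon][[y]]$ along the isomorphism \<open>\<kappa>\<close> of $k[[y]]$ with $k[[\pi]]$ (the identity if
  \<open>\<pi> = fps_X\<close>).\<close>

definition cocycle_lift :: "'k::field fps \<Rightarrow> ('h \<Rightarrow> 'k fps \<Rightarrow> 'k fps) \<Rightarrow> ('h \<Rightarrow> 'k fps \<Rightarrow> 'k fps)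
    \<Rightarrow> 'h \<Rightarrow> 'k dual_number fps \<Rightarrow> 'k dual_number fps" where
  "cocycle_lift \<pi> \<rho> c h f =
     (let \<kappa> = (\<lambda>u. fps_compose u \<pi>);
          x0 = \<kappa> (fps_reduce std_part f);
          x1 = \<kappa> (fps_reduce eps_part f);
          z0 = inv_into UNIV \<kappa> (\<rho> h x0);
          z1 = inv_into UNIV \<kappa> (\<rho> h x1 + c h (\<rho> h x0))
      in Abs_fps (\<lambda>n. Dual (z0 $ n) (z1 $ n)))"

text \<open>The identification of $H^1$ with the value of the deformation functor at $k[\varepsilon]$.\<close>

definition tangent_class :: "('h, 'b) monoid_scheme \<Rightarrow> 'k::field fps
    \<Rightarrow> ('h \<Rightarrow> 'k fps \<Rightarrow> 'k fps) \<Rightarrow> ('h \<Rightarrow> 'k fps \<Rightarrow> 'k fps) set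
    \<Rightarrow> ('h \<Rightarrow> 'k dual_number fps \<Rightarrow> 'k dual_number fps) set" where
  "tangent_class H \<pi> \<rho> X =
     the_elem ((\<lambda>c. lift_equiv std_part H \<pi> \<rho> `` {cocycle_lift \<pi> \<rho> c}) ` X)"

definition ind_tangent :: "('g, 'b) monoid_scheme \<Rightarrow> 'g set \<Rightarrow> ('g \<Rightarrow> 'k::field fps \<Rightarrow> 'k fps)
    \<Rightarrow> ('g \<Rightarrow> 'k fps \<Rightarrow> 'k fps) set \<Rightarrow> ('g set \<Rightarrow> 'k fps \<Rightarrow> 'k fps) set" where
  "ind_tangent G N \<rho> X =
     inv_into (carrier (H1_Theta_sharp G N \<rho>))
       (tangent_class (G Mod N) (norm_param \<rho> N) (sharp_action N \<rho>))
       (ind std_part G N \<rho> (tangent_class G fps_X \<rho> X))"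

end

theory Submission
  imports Defs
begin

text \<open>A lift of \<open>\<rho>\<close> to the dual numbers is \<open>\<rho>_A = (1 + \<epsilon> c) \<rho>\<close> for a cocycle \<open>c\<close>. If the norm parameter of
  $\rho_A$ is $y_A = y + \varepsilon z$, then $A[[y_A]]$ is the image of $k[[y]][\varepsilon]$ under
  $1 + \varepsilon\delta$, where \<open>\<delta> = z d/dy\<close> is a derivation from $k[[t]]^N$ to $k[[t]]$. Transporting
  the action of $\rho_A(g)$ back along this isomorphism, the induced lift is given by the cocycle
  $c_g + g\delta g^{-1} - \delta$ restricted to $k[[t]]^N$. Since $\delta(y_G) = z\, dy_G/dy$ lies in
  \<open>\<Theta>\<^sub>1\<close>, because $dy_G/dy$ generates the different of $k[[t]]^N/k[[t]]^G$, this cocycle is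
  cohomologous to \<open>c\<close> in \<open>\<Theta>\<^sub>1\<close>; and if \<open>c\<close> is inflated from \<open>\<Theta>\<^sup>N\<close>, then \<open>\<delta> = 0\<close> is also admissible.\<close>

section \<open>Group cohomology in degree one\<close>

text \<open>Every map of the diagram is defined on classes by a choice: \<open>the_elem\<close> of
  an image, or \<open>inv_into\<close> of the tangent identification. Its value is known only once
  all representatives are treated, so \<open>ind\<close> must be evaluated on every lift in a class
  and not just on those of the form (1 + \<epsilon> c) \<rho>. Two facts settle this: each lift
  agrees on the group with one of that form, and cohomologous cocycles have cohomologous induced
  cocycles, whatever \<delta> is chosen for each. The second fact also frees the computation from
  the norm parameter: any \<delta> whose coboundary cancels c on N may be used. The other obstacle
  is that \<Theta>_1 is defined by traces in an unspecified basis of fraction fields. Division with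
  remainder makes k[[t]]^N free over k[[t]]^G on powers of y, and Euler's dual basis turns the trace
  into a coordinate. The minimal equation of y never becomes explicit; only its derivative is found,
  up to a unit. That dy_G/dy is nonzero is separability, which comes from faithfulness of the
  action.\<close>

locale gmodule = G: group G + M: comm_group M
  for G :: "('g, 'b) monoid_scheme" (structure) and M :: "('m, 'c) monoid_scheme" +
  fixes act :: "'g \<Rightarrow> 'm \<Rightarrow> 'm"
  assumes act_closed [simp, intro]: "g \<in> carrier G \<Longrightarrow> m \<in> carrier M \<Longrightarrow> act g m \<in> carrier M"
    and act_mult: "g \<in> carrier G \<Longrightarrow> m \<in> carrier M \<Longrightarrow> n \<in> carrier M \<Longrightarrow>
      act g (m \<otimes>\<^bsub>M\<^esub> n) = act g m \<otimes>\<^bsub>M\<^esub> act g n"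
    and act_act: "g \<in> carrier G \<Longrightarrow> h \<in> carrier G \<Longrightarrow> m \<in> carrier M \<Longrightarrow>
      act (g \<otimes> h) m = act g (act h m)"
    and act_one: "m \<in> carrier M \<Longrightarrow> act \<one> m = m"
begin

definition cohomologous :: "('g \<Rightarrow> 'm) \<Rightarrow> ('g \<Rightarrow> 'm) \<Rightarrow> bool" where
  "cohomologous c c' \<longleftrightarrow>
     (\<exists>m\<in>carrier M. \<forall>g\<in>carrier G. c' g = act g m \<otimes>\<^bsub>M\<^esub> inv\<^bsub>M\<^esub> m \<otimes>\<^bsub>M\<^esub> c g)"

lemma Z1_iff: "c \<in> carrier (Z1 G M act) \<longleftrightarrow> c \<in> extensional (carrier G) \<and>
    (\<forall>g\<in>carrier G. c g \<in> carrier M) \<and>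
    (\<forall>g\<in>carrier G. \<forall>h\<in>carrier G. c (g \<otimes> h) = c g \<otimes>\<^bsub>M\<^esub> act g (c h))"
  by (auto simp: Z1_def PiE_def)

lemma Z1_closed: "c \<in> carrier (Z1 G M act) \<Longrightarrow> g \<in> carrier G \<Longrightarrow> c g \<in> carrier M"
  by (simp add: Z1_iff)

lemma Z1_one:
  assumes "c \<in> carrier (Z1 G M act)"
  shows "c \<one> = \<one>\<^bsub>M\<^esub>"
proof -
  have c: "c \<one> \<in> carrier M"
    using assms by (simp add: Z1_iff)
  have "c (\<one> \<otimes> \<one>) = c \<one> \<otimes>\<^bsub>M\<^esub> act \<one> (c \<one>)"
    using assms G.one_closed unfolding Z1_iff by blast
  then have "c \<one> = c \<one> \<otimes>\<^bsub>M\<^esub> c \<one>"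
    using c by (simp add: act_one)
  then show ?thesis
    using c M.r_cancel_one' by metis
qed

lemma act_unit: "g \<in> carrier G \<Longrightarrow> act g \<one>\<^bsub>M\<^esub> = \<one>\<^bsub>M\<^esub>"
  by (metis M.l_cancel_one' M.l_one M.one_closed act_closed act_mult)

lemma act_inv: "g \<in> carrier G \<Longrightarrow> m \<in> carrier M \<Longrightarrow> act g (inv\<^bsub>M\<^esub> m) = inv\<^bsub>M\<^esub> act g m"
  by (metis M.inv_closed M.inv_equality M.l_inv act_closed act_mult act_unit)

lemma cohomologous_refl: "c \<in> carrier (Z1 G M act) \<Longrightarrow> cohomologous c c"
  unfolding cohomologous_def
  by (rule bexI[of _ "\<one>\<^bsub>M\<^esub>"]) (auto simp: act_unit Z1_iff)

lemma cohomologous_sym: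
  assumes "c \<in> carrier (Z1 G M act)" "cohomologous c c'"
  shows "cohomologous c' c"
proof -
  obtain m where m: "m \<in> carrier M"
      "\<forall>g\<in>carrier G. c' g = act g m \<otimes>\<^bsub>M\<^esub> inv\<^bsub>M\<^esub> m \<otimes>\<^bsub>M\<^esub> c g"
    using assms by (auto simp: cohomologous_def)
  have "c g = act g (inv\<^bsub>M\<^esub> m) \<otimes>\<^bsub>M\<^esub> inv\<^bsub>M\<^esub> (inv\<^bsub>M\<^esub> m) \<otimes>\<^bsub>M\<^esub> c' g" if g: "g \<in> carrier G" for g
  proof -
    have [simp]: "c g \<in> carrier M" "act g m \<in> carrier M"
      using assms g m by (auto simp: Z1_iff)
    define b where "b = act g m \<otimes>\<^bsub>M\<^esub> inv\<^bsub>M\<^esub> m"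
    have [simp]: "b \<in> carrier M"
      using m by (simp add: b_def)
    have "act g (inv\<^bsub>M\<^esub> m) \<otimes>\<^bsub>M\<^esub> inv\<^bsub>M\<^esub> (inv\<^bsub>M\<^esub> m) = inv\<^bsub>M\<^esub> b"
      using m g by (simp add: b_def act_inv M.inv_mult del: M.inv_inv)
    moreover have "c' g = b \<otimes>\<^bsub>M\<^esub> c g"
      using m g by (simp add: b_def)
    moreover have "inv\<^bsub>M\<^esub> b \<otimes>\<^bsub>M\<^esub> (b \<otimes>\<^bsub>M\<^esub> c g) = c g"
      by (simp add: M.m_assoc [symmetric])
    ultimately show ?thesis
      by simp
  qed
  then show ?thesis
    using m unfolding cohomologous_def by (intro bexI[of _ "inv\<^bsub>M\<^esub> m"]) auto
qed

lemma cohomologous_trans: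
  assumes "c \<in> carrier (Z1 G M act)" "cohomologous c c'" "cohomologous c' c''"
  shows "cohomologous c c''"
proof -
  obtain m where m: "m \<in> carrier M"
      "\<forall>g\<in>carrier G. c' g = act g m \<otimes>\<^bsub>M\<^esub> inv\<^bsub>M\<^esub> m \<otimes>\<^bsub>M\<^esub> c g"
    using assms by (auto simp: cohomologous_def)
  obtain n where n: "n \<in> carrier M"
      "\<forall>g\<in>carrier G. c'' g = act g n \<otimes>\<^bsub>M\<^esub> inv\<^bsub>M\<^esub> n \<otimes>\<^bsub>M\<^esub> c' g"
    using assms by (auto simp: cohomologous_def)
  have "c'' g = act g (m \<otimes>\<^bsub>M\<^esub> n) \<otimes>\<^bsub>M\<^esub> inv\<^bsub>M\<^esub> (m \<otimes>\<^bsub>M\<^esub> n) \<otimes>\<^bsub>M\<^esub> c g" if g: "g \<in> carrier G" for g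
  proof -
    have [simp]: "c g \<in> carrier M" "act g m \<in> carrier M" "act g n \<in> carrier M"
      using assms g m n by (auto simp: Z1_iff)
    show ?thesis
      using m n g by (simp add: act_mult M.inv_mult M.m_ac)
  qed
  then show ?thesis
    using m n unfolding cohomologous_def by (intro bexI[of _ "m \<otimes>\<^bsub>M\<^esub> n"]) auto
qed

lemma coboundary_add_Z1:
  assumes "c \<in> carrier (Z1 G M act)" "m \<in> carrier M"
  shows "(\<lambda>g\<in>carrier G. act g m \<otimes>\<^bsub>M\<^esub> inv\<^bsub>M\<^esub> m \<otimes>\<^bsub>M\<^esub> c g) \<in> carrier (Z1 G M act)"
proof -
  have "act (g \<otimes> h) m \<otimes>\<^bsub>M\<^esub> inv\<^bsub>M\<^esub> m \<otimes>\<^bsub>M\<^esub> c (g \<otimes> h) =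
     act g m \<otimes>\<^bsub>M\<^esub> inv\<^bsub>M\<^esub> m \<otimes>\<^bsub>M\<^esub> c g \<otimes>\<^bsub>M\<^esub> act g (act h m \<otimes>\<^bsub>M\<^esub> inv\<^bsub>M\<^esub> m \<otimes>\<^bsub>M\<^esub> c h)"
    if gh: "g \<in> carrier G" "h \<in> carrier G" for g h
  proof -
    have [simp]: "c g \<in> carrier M" "c h \<in> carrier M" "act g m \<in> carrier M" "act h m \<in> carrier M"
      "act g (c h) \<in> carrier M" "act g (act h m) \<in> carrier M" "act g (inv\<^bsub>M\<^esub> m) \<in> carrier M"
      using assms gh by (auto simp: Z1_iff)
    have c: "c (g \<otimes> h) = c g \<otimes>\<^bsub>M\<^esub> act g (c h)"
      using assms gh by (simp add: Z1_iff)
    \<comment> \<open>The inner coboundary contributes - g m, which cancels the outer g m and leaves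
      (g h) m - m.\<close>
    have "act g m \<otimes>\<^bsub>M\<^esub> inv\<^bsub>M\<^esub> m \<otimes>\<^bsub>M\<^esub> c g \<otimes>\<^bsub>M\<^esub> act g (act h m \<otimes>\<^bsub>M\<^esub> inv\<^bsub>M\<^esub> m \<otimes>\<^bsub>M\<^esub> c h)
      = (act g m \<otimes>\<^bsub>M\<^esub> act g (inv\<^bsub>M\<^esub> m)) \<otimes>\<^bsub>M\<^esub> (inv\<^bsub>M\<^esub> m \<otimes>\<^bsub>M\<^esub> c g \<otimes>\<^bsub>M\<^esub> act g (act h m) \<otimes>\<^bsub>M\<^esub> act g (c h))"
      using assms gh by (simp add: act_mult M.m_ac)
    also have "act g m \<otimes>\<^bsub>M\<^esub> act g (inv\<^bsub>M\<^esub> m) = \<one>\<^bsub>M\<^esub>"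
      using assms gh by (simp add: act_inv)
    finally show ?thesis
      using assms gh by (simp add: act_act c M.m_ac)
  qed
  then show ?thesis
    using assms by (simp add: Z1_iff)
qed

text \<open>Turns a coset of \<open>B1\<close> into an equivalence class of cocycles, so that later
  arguments exhibit a module element as witness instead of computing in the quotient group.\<close>

lemma H1_class_eq:
  assumes "c \<in> carrier (Z1 G M act)"
  shows "H1_class G M act c = {c' \<in> carrier (Z1 G M act). cohomologous c c'}"
proof (intro equalityI subsetI)
  fix c' assume "c' \<in> H1_class G M act c"
  then obtain m where m: "m \<in> carrier M" and c': "c' =
      (\<lambda>g\<in>carrier G. (\<lambda>g\<in>carrier G. act g m \<otimes>\<^bsub>M\<^esub> inv\<^bsub>M\<^esub> m) g \<otimes>\<^bsub>M\<^esub> c g)"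
    by (auto simp: H1_class_def r_coset_def B1_def Z1_def)
  then have "c' = (\<lambda>g\<in>carrier G. act g m \<otimes>\<^bsub>M\<^esub> inv\<^bsub>M\<^esub> m \<otimes>\<^bsub>M\<^esub> c g)"
    by auto
  then show "c' \<in> {c' \<in> carrier (Z1 G M act). cohomologous c c'}"
    using coboundary_add_Z1[OF assms m] m by (auto simp: cohomologous_def)
next
  fix c' assume "c' \<in> {c' \<in> carrier (Z1 G M act). cohomologous c c'}"
  then obtain m where c': "c' \<in> carrier (Z1 G M act)" and m: "m \<in> carrier M"
      "\<forall>g\<in>carrier G. c' g = act g m \<otimes>\<^bsub>M\<^esub> inv\<^bsub>M\<^esub> m \<otimes>\<^bsub>M\<^esub> c g"
    by (auto simp: cohomologous_def)
  then have "c' = (\<lambda>g\<in>carrier G. (\<lambda>g\<in>carrier G. act g m \<otimes>\<^bsub>M\<^esub> inv\<^bsub>M\<^esub> m) g \<otimes>\<^bsub>M\<^esub> c g)"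
    by (intro extensionalityI[of _ "carrier G"]) (auto simp: Z1_iff)
  then show "c' \<in> H1_class G M act c"
    using m by (auto simp: H1_class_def r_coset_def B1_def Z1_def)
qed

lemma carrier_H1: "carrier (H1 G M act) = H1_class G M act ` carrier (Z1 G M act)"
  by (auto simp: H1_def FactGroup_def RCOSETS_def H1_class_def)

lemma H1_class_in_H1: "c \<in> carrier (Z1 G M act) \<Longrightarrow> H1_class G M act c \<in> carrier (H1 G M act)"
  by (simp add: carrier_H1)

lemma H1_class_eqI:
  assumes "c \<in> carrier (Z1 G M act)" "c' \<in> carrier (Z1 G M act)" "cohomologous c c'"
  shows "H1_class G M act c = H1_class G M act c'"
  using assms by (auto simp: H1_class_eq intro: cohomologous_trans cohomologous_sym)

lemma H1_class_eqD:
  assumes "c \<in> carrier (Z1 G M act)" "c' \<in> carrier (Z1 G M act)"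
    and "H1_class G M act c = H1_class G M act c'"
  shows "cohomologous c c'"
  using assms cohomologous_refl[of c'] by (auto simp: H1_class_eq)

text \<open>\<open>H1_map\<close> is \<open>the_elem\<close> of an image, so its value is determined
  only if all representatives land in one class. All maps given by \<open>H1_map\<close> are
  evaluated through this rule.\<close>

lemma H1_map_eqI:
  assumes "x \<in> X" "\<And>x'. x' \<in> X \<Longrightarrow> F x' \<in> carrier (Z1 G M act)"
    and "\<And>x'. x' \<in> X \<Longrightarrow> cohomologous (F x) (F x')"
  shows "H1_map G M act F X = H1_class G M act (F x)"
proof -
  have "(\<lambda>c. H1_class G M act (F c)) ` X = {H1_class G M act (F x)}"
  proof (intro equalityI image_subsetI)
    fix x' assume x': "x' \<in> X"
    then have "H1_class G M act (F x) = H1_class G M act (F x')"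
      using assms by (intro H1_class_eqI) auto
    then show "H1_class G M act (F x') \<in> {H1_class G M act (F x)}"
      by simp
  qed (use assms(1) in auto)
  then show ?thesis
    by (simp add: H1_map_def)
qed

end

section \<open>Functoriality in the coefficient module\<close>

locale gmodule_hom = M: gmodule G M act + M': gmodule G M' act'
  for G :: "('g, 'b) monoid_scheme" (structure) and M :: "('m, 'c) monoid_scheme" and act
    and M' :: "('n, 'd) monoid_scheme" and act' +
  fixes f :: "'m \<Rightarrow> 'n"
  assumes hom_closed: "m \<in> carrier M \<Longrightarrow> f m \<in> carrier M'"
    and hom_mult: "m \<in> carrier M \<Longrightarrow> n \<in> carrier M \<Longrightarrow> f (m \<otimes>\<^bsub>M\<^esub> n) = f m \<otimes>\<^bsub>M'\<^esub> f n"
    and hom_act: "g \<in> carrier G \<Longrightarrow> m \<in> carrier M \<Longrightarrow> f (act g m) = act' g (f m)"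
begin

abbreviation push :: "('g \<Rightarrow> 'm) \<Rightarrow> 'g \<Rightarrow> 'n" where
  "push c \<equiv> (\<lambda>g\<in>carrier G. f (c g))"

lemma hom_inv: "m \<in> carrier M \<Longrightarrow> f (inv\<^bsub>M\<^esub> m) = inv\<^bsub>M'\<^esub> f m"
  by (rule group_hom.hom_inv)
     (auto simp: group_hom_def group_hom_axioms_def hom_def hom_closed hom_mult)

lemma push_Z1: "c \<in> carrier (Z1 G M act) \<Longrightarrow> push c \<in> carrier (Z1 G M' act')"
  by (simp add: M.Z1_iff M'.Z1_iff hom_closed hom_mult hom_act)

lemma push_cohomologous:
  assumes c: "c \<in> carrier (Z1 G M act)" and coh: "M.cohomologous c c'"
  shows "M'.cohomologous (push c) (push c')"
proof -
  obtain m where m: "m \<in> carrier M"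
      "\<forall>g\<in>carrier G. c' g = act g m \<otimes>\<^bsub>M\<^esub> inv\<^bsub>M\<^esub> m \<otimes>\<^bsub>M\<^esub> c g"
    using coh by (auto simp: M.cohomologous_def)
  show ?thesis
    unfolding M'.cohomologous_def
    using m c by (intro bexI[of _ "f m"]) (simp_all add: hom_closed hom_mult hom_act hom_inv M.Z1_iff)
qed

lemma H1_map_push:
  assumes "c \<in> carrier (Z1 G M act)"
  shows "H1_map G M' act' push (H1_class G M act c) = H1_class G M' act' (push c)"
  using assms
  by (intro M'.H1_map_eqI) (auto simp: M.H1_class_eq M.cohomologous_refl push_Z1 push_cohomologous)

lemma H1_map_push_funcset:
  "H1_map G M' act' push \<in> carrier (H1 G M act) \<rightarrow> carrier (H1 G M' act')"
  by (auto simp: M.carrier_H1 M'.carrier_H1 H1_map_push push_Z1)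

text \<open>Both the witness of a cohomology between pushed cocycles and an arbitrary target cocycle
  can be pulled back along the equivariant bijection \<open>f\<close>.\<close>

lemma H1_map_push_bij:
  assumes f: "bij_betw f (carrier M) (carrier M')"
  shows "bij_betw (H1_map G M' act' push) (carrier (H1 G M act)) (carrier (H1 G M' act'))"
proof (rule bij_betw_imageI)
  have inj: "inj_on f (carrier M)" and surj: "f ` carrier M = carrier M'"
    using f by (auto simp: bij_betw_def)
  show "inj_on (H1_map G M' act' push) (carrier (H1 G M act))"
  proof (rule inj_onI)
    fix X Y assume XY: "X \<in> carrier (H1 G M act)" "Y \<in> carrier (H1 G M act)"
      and eq: "H1_map G M' act' push X = H1_map G M' act' push Y"
    then obtain c c' where c: "c \<in> carrier (Z1 G M act)" "X = H1_class G M act c"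
       and c': "c' \<in> carrier (Z1 G M act)" "Y = H1_class G M act c'"
      by (auto simp: M.carrier_H1)
    have "M'.cohomologous (push c) (push c')"
      using eq c c' by (intro M'.H1_class_eqD) (auto simp: H1_map_push push_Z1)
    then obtain n where n: "n \<in> carrier M'" "\<And>g. g \<in> carrier G \<Longrightarrow>
        f (c' g) = act' g n \<otimes>\<^bsub>M'\<^esub> inv\<^bsub>M'\<^esub> n \<otimes>\<^bsub>M'\<^esub> f (c g)"
      by (auto simp: M'.cohomologous_def)
    then obtain m where m: "m \<in> carrier M" "n = f m"
      using surj by auto
    have "c' g = act g m \<otimes>\<^bsub>M\<^esub> inv\<^bsub>M\<^esub> m \<otimes>\<^bsub>M\<^esub> c g" if g: "g \<in> carrier G" for g
    proof (rule inj_onD[OF inj])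
      show "f (c' g) = f (act g m \<otimes>\<^bsub>M\<^esub> inv\<^bsub>M\<^esub> m \<otimes>\<^bsub>M\<^esub> c g)"
        using n(2)[OF g] m g c by (simp add: hom_mult hom_act hom_inv M.Z1_iff)
    qed (use m g c c' in \<open>auto simp: M.Z1_iff\<close>)
    then have "M.cohomologous c c'"
      using m by (auto simp: M.cohomologous_def)
    then show "X = Y"
      using c c' by (simp add: M.H1_class_eqI)
  qed
  show "H1_map G M' act' push ` carrier (H1 G M act) = carrier (H1 G M' act')"
  proof (intro equalityI subsetI)
    fix Y assume "Y \<in> carrier (H1 G M' act')"
    then obtain c' where c': "c' \<in> carrier (Z1 G M' act')" "Y = H1_class G M' act' c'"
      by (auto simp: M'.carrier_H1)
    define c where "c = (\<lambda>g\<in>carrier G. inv_into (carrier M) f (c' g))"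
    have fc: "f (c g) = c' g" if "g \<in> carrier G" for g
      using that c' surj by (auto simp: c_def M'.Z1_iff intro!: f_inv_into_f)
    have cc: "c g \<in> carrier M" if "g \<in> carrier G" for g
      using that c' surj by (auto simp: c_def M'.Z1_iff intro!: inv_into_into)
    have "c (g \<otimes> h) = c g \<otimes>\<^bsub>M\<^esub> act g (c h)" if gh: "g \<in> carrier G" "h \<in> carrier G" for g h
    proof (rule inj_onD[OF inj])
      show "f (c (g \<otimes> h)) = f (c g \<otimes>\<^bsub>M\<^esub> act g (c h))"
        using gh c' by (simp add: hom_mult hom_act fc cc M'.Z1_iff)
    qed (use gh cc in auto)
    then have c: "c \<in> carrier (Z1 G M act)"
      using cc by (simp add: M.Z1_iff) (simp add: c_def)
    moreover have "push c = c'"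
      using c' fc by (intro extensionalityI[of _ "carrier G"]) (auto simp: M'.Z1_iff)
    ultimately show "Y \<in> H1_map G M' act' push ` carrier (H1 G M act)"
      using c' by (auto simp: M.carrier_H1 image_image H1_map_push intro!: image_eqI[of _ _ c])
  qed (use H1_map_push_funcset in auto)
qed

end

section \<open>Invariants of a normal subgroup and inflation\<close>

locale gmodule_normal = gmodule + fixes N assumes normal: "N \<lhd> G"
begin

lemma N_sub: "N \<subseteq> carrier G"
  using normal by (simp add: normal_imp_subgroup subgroup.subset)

abbreviation MN where "MN \<equiv> invariants M act N"

lemma carrier_MN: "carrier MN = {m \<in> carrier M. \<forall>s\<in>N. act s m = m}"
  by (simp add: invariants_def)

lemma mult_MN [simp]: "m \<otimes>\<^bsub>MN\<^esub> n = m \<otimes>\<^bsub>M\<^esub> n" and one_MN [simp]: "\<one>\<^bsub>MN\<^esub> = \<one>\<^bsub>M\<^esub>"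
  by (simp_all add: invariants_def)

text \<open>Normality rewrites an element of the right coset as \<open>a \<otimes> s'\<close>, so
  that \<open>s'\<close> acts first, on an invariant element, and disappears.\<close>

lemma coset_act_eq:
  assumes "C \<in> carrier (G Mod N)" "g \<in> C" "m \<in> carrier MN"
  shows "coset_act act C m = act g m"
proof -
  obtain a where a: "a \<in> carrier G" "C = N #> a"
    using assms by (auto simp: FactGroup_def RCOSETS_def)
  have "act h m = act a m" if h: "h \<in> C" for h
  proof -
    obtain s where s: "s \<in> N" "h = s \<otimes> a"
      using h a unfolding r_coset_def by blast
    have "h \<in> a <# N"
      using h a normal by (simp add: normal.coset_eq)
    then obtain s' where s': "s' \<in> N" "h = a \<otimes> s'"
      by (auto simp: l_coset_def)
    then show ?thesis
      using assms(3) a N_sub by (auto simp: act_act carrier_MN)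
  qed
  then have "(\<lambda>g. act g m) ` C = {act g m}"
    using assms(2) by auto
  then show ?thesis
    by (simp add: coset_act_def)
qed

lemma coset_nonempty: "C \<in> carrier (G Mod N) \<Longrightarrow> \<exists>g\<in>carrier G. g \<in> C \<and> C = N #> g"
  using G.rcos_self[OF _ normal_imp_subgroup[OF normal]] by (auto simp: FactGroup_def RCOSETS_def)

lemma coset_act_rcos: "g \<in> carrier G \<Longrightarrow> m \<in> carrier MN \<Longrightarrow> coset_act act (N #> g) m = act g m"
  using normal by (intro coset_act_eq)
    (auto simp: FactGroup_def RCOSETS_def G.rcos_self normal_imp_subgroup)

lemma act_in_MN:
  assumes "g \<in> carrier G" "m \<in> carrier MN"
  shows "act g m \<in> carrier MN"
proof -
  have "act s (act g m) = act g m" if s: "s \<in> N" for s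
  proof -
    \<comment> \<open>Again \<open>s\<close> is moved to the right of \<open>g\<close>, where it
      meets an invariant element.\<close>
    have "s \<otimes> g \<in> g <# N"
      using s assms normal normal.coset_eq[OF normal] by (auto simp: r_coset_def)
    then obtain s' where "s' \<in> N" "s \<otimes> g = g \<otimes> s'"
      by (auto simp: l_coset_def)
    moreover from this have "act s (act g m) = act (s \<otimes> g) m" "act g (act s' m) = act (g \<otimes> s') m"
      using assms s N_sub by (subst act_act; auto simp: carrier_MN)+
    moreover have "act s' m = m"
      using assms \<open>s' \<in> N\<close> by (simp add: carrier_MN)
    ultimately show ?thesis
      by simp
  qed
  then show ?thesis
    using assms by (auto simp: carrier_MN)
qed

lemma comm_group_MN: "comm_group MN"
proof (rule comm_groupI)
  fix x assume x: "x \<in> carrier MN"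
  then show "\<exists>y\<in>carrier MN. y \<otimes>\<^bsub>MN\<^esub> x = \<one>\<^bsub>MN\<^esub>"
    using N_sub by (intro bexI[of _ "inv\<^bsub>M\<^esub> x"]) (auto simp: carrier_MN act_inv)
qed (use N_sub in \<open>auto simp: carrier_MN act_mult act_unit M.m_ac\<close>)

lemma rcos_in_Mod: "g \<in> carrier G \<Longrightarrow> N #> g \<in> carrier (G Mod N)"
  by (auto simp: FactGroup_def RCOSETS_def)

lemma rcos_mult:
  "g \<in> carrier G \<Longrightarrow> h \<in> carrier G \<Longrightarrow> (N #> g) \<otimes>\<^bsub>G Mod N\<^esub> (N #> h) = N #> (g \<otimes> h)"
  using normal by (simp add: FactGroup_def normal.rcos_sum)

lemma gmodule_MN: "gmodule (G Mod N) MN (coset_act act)"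
proof (intro gmodule.intro gmodule_axioms.intro comm_group_MN)
  show "group (G Mod N)"
    using normal by (simp add: normal.factorgroup_is_group)
next
  fix C m assume C: "C \<in> carrier (G Mod N)" and m: "m \<in> carrier MN"
  then show "coset_act act C m \<in> carrier MN"
    using coset_nonempty[OF C] by (auto simp: coset_act_rcos act_in_MN)
next
  fix C m n assume C: "C \<in> carrier (G Mod N)" and m: "m \<in> carrier MN" "n \<in> carrier MN"
  moreover have "m \<otimes>\<^bsub>M\<^esub> n \<in> carrier MN"
    using monoid.m_closed[OF comm_monoid.axioms(1)[OF comm_group.axioms(1)[OF comm_group_MN]], of m n] m
    by simp
  ultimately show "coset_act act C (m \<otimes>\<^bsub>MN\<^esub> n) = coset_act act C m \<otimes>\<^bsub>MN\<^esub> coset_act act C n"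
    using coset_nonempty[OF C] by (auto simp: coset_act_rcos act_mult) (simp add: carrier_MN act_mult)
next
  fix C D m assume "C \<in> carrier (G Mod N)" "D \<in> carrier (G Mod N)" and m: "m \<in> carrier MN"
  then show "coset_act act (C \<otimes>\<^bsub>G Mod N\<^esub> D) m = coset_act act C (coset_act act D m)"
    using coset_nonempty[of C] coset_nonempty[of D]
    by (auto simp: rcos_mult coset_act_rcos act_in_MN simp del: mult_FactGroup)
       (simp add: carrier_MN act_act)
next
  fix m assume m: "m \<in> carrier MN"
  have "\<one>\<^bsub>G Mod N\<^esub> = N #> \<one>"
    using N_sub by (simp add: FactGroup_def G.coset_mult_one)
  then have "coset_act act \<one>\<^bsub>G Mod N\<^esub> m = act \<one> m"
    using coset_act_rcos[OF G.one_closed m] by simp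
  then show "coset_act act \<one>\<^bsub>G Mod N\<^esub> m = m"
    using m by (simp add: carrier_MN act_one)
qed

sublocale MN: gmodule "G Mod N" MN "coset_act act"
  by (rule gmodule_MN)

lemma inv_MN: "m \<in> carrier MN \<Longrightarrow> inv\<^bsub>MN\<^esub> m = inv\<^bsub>M\<^esub> m"
  using MN.M.l_inv[of m] MN.M.inv_closed[of m]
  by (intro M.inv_equality [symmetric]) (auto simp: carrier_MN)

abbreviation inflate :: "('a set \<Rightarrow> 'c) \<Rightarrow> 'a \<Rightarrow> 'c" where
  "inflate c \<equiv> (\<lambda>g\<in>carrier G. c (N #> g))"

lemma inflate_Z1:
  assumes "c \<in> carrier (Z1 (G Mod N) MN (coset_act act))"
  shows "inflate c \<in> carrier (Z1 G M act)"
proof -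
  have c: "c C \<in> carrier MN" "c C \<in> carrier M" if "C \<in> carrier (G Mod N)" for C
    using assms that by (auto simp: MN.Z1_iff) (auto simp: carrier_MN)
  have "c (N #> (g \<otimes> h)) = c (N #> g) \<otimes>\<^bsub>M\<^esub> act g (c (N #> h))"
    if "g \<in> carrier G" "h \<in> carrier G" for g h
  proof -
    have "c ((N #> g) \<otimes>\<^bsub>G Mod N\<^esub> (N #> h)) = c (N #> g) \<otimes>\<^bsub>MN\<^esub> coset_act act (N #> g) (c (N #> h))"
      using assms rcos_in_Mod that unfolding MN.Z1_iff by blast
    then show ?thesis
      using that c(1) rcos_in_Mod by (simp add: rcos_mult coset_act_rcos del: mult_FactGroup)
  qed
  then show ?thesis
    using c by (auto simp: Z1_iff rcos_in_Mod)
qed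

text \<open>From left to right this is the injectivity of inflation: on N both inflated cocycles are
  trivial, so the coboundary relation there says that the witness \<open>m\<close> is N-invariant
  and hence a witness over the quotient.\<close>

lemma inflate_cohomologous_iff:
  assumes c: "c \<in> carrier (Z1 (G Mod N) MN (coset_act act))"
    and c': "c' \<in> carrier (Z1 (G Mod N) MN (coset_act act))"
  shows "cohomologous (inflate c) (inflate c') \<longleftrightarrow> MN.cohomologous c c'"
proof
  assume "cohomologous (inflate c) (inflate c')"
  then obtain m where m: "m \<in> carrier M" "\<And>g. g \<in> carrier G \<Longrightarrow>
      c' (N #> g) = act g m \<otimes>\<^bsub>M\<^esub> inv\<^bsub>M\<^esub> m \<otimes>\<^bsub>M\<^esub> c (N #> g)"
    by (auto simp: cohomologous_def)
  have "act s m = m" if s: "s \<in> N" for s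
  proof -
    have "N #> s = \<one>\<^bsub>G Mod N\<^esub>" "s \<in> carrier G"
      using s normal N_sub
      by (auto simp: FactGroup_def subgroup.rcos_const normal_imp_subgroup)
    then have "\<one>\<^bsub>M\<^esub> = act s m \<otimes>\<^bsub>M\<^esub> inv\<^bsub>M\<^esub> m"
      using m(2)[of s] MN.Z1_one[OF c] MN.Z1_one[OF c'] m(1) by simp
    then show ?thesis
      using m(1) \<open>s \<in> carrier G\<close> by (metis M.inv_closed M.inv_equality M.inv_inv act_closed)
  qed
  then have mN: "m \<in> carrier MN"
    using m by (auto simp: carrier_MN)
  show "MN.cohomologous c c'"
    unfolding MN.cohomologous_def
  proof (intro bexI[OF _ mN] ballI)
    fix C assume "C \<in> carrier (G Mod N)"
    then obtain g where "g \<in> carrier G" "C = N #> g"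
      using coset_nonempty by blast
    then show "c' C = coset_act act C m \<otimes>\<^bsub>MN\<^esub> inv\<^bsub>MN\<^esub> m \<otimes>\<^bsub>MN\<^esub> c C"
      using m mN by (simp add: coset_act_rcos inv_MN)
  qed
next
  assume "MN.cohomologous c c'"
  then obtain m where m: "m \<in> carrier MN" "\<And>C. C \<in> carrier (G Mod N) \<Longrightarrow>
      c' C = coset_act act C m \<otimes>\<^bsub>MN\<^esub> inv\<^bsub>MN\<^esub> m \<otimes>\<^bsub>MN\<^esub> c C"
    by (auto simp: MN.cohomologous_def)
  show "cohomologous (inflate c) (inflate c')"
    unfolding cohomologous_def
  proof (intro bexI[of _ m] ballI)
    fix g assume g: "g \<in> carrier G"
    then show "inflate c' g = act g m \<otimes>\<^bsub>M\<^esub> inv\<^bsub>M\<^esub> m \<otimes>\<^bsub>M\<^esub> inflate c g"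
      using m by (simp add: rcos_in_Mod coset_act_rcos inv_MN)
  qed (use m in \<open>simp add: carrier_MN\<close>)
qed

lemma inflation_class:
  assumes "c \<in> carrier (Z1 (G Mod N) MN (coset_act act))"
  shows "inflation G N M act (H1_class (G Mod N) MN (coset_act act) c) = H1_class G M act (inflate c)"
  unfolding inflation_def using assms
  by (intro H1_map_eqI)
     (auto simp: MN.H1_class_eq MN.cohomologous_refl inflate_cohomologous_iff
        simp del: restrict_apply intro: inflate_Z1)

lemma inflation_funcset:
  "inflation G N M act \<in> carrier (H1 (G Mod N) MN (coset_act act)) \<rightarrow> carrier (H1 G M act)"
  by (auto simp: MN.carrier_H1 carrier_H1 inflation_class inflate_Z1)

lemma inflation_inj: "inj_on (inflation G N M act) (carrier (H1 (G Mod N) MN (coset_act act)))"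
proof (rule inj_onI)
  fix X Y assume X: "X \<in> carrier (H1 (G Mod N) MN (coset_act act))"
    and Y: "Y \<in> carrier (H1 (G Mod N) MN (coset_act act))"
    and eq: "inflation G N M act X = inflation G N M act Y"
  obtain c where c: "c \<in> carrier (Z1 (G Mod N) MN (coset_act act))"
     "X = H1_class (G Mod N) MN (coset_act act) c"
    using X by (auto simp: MN.carrier_H1)
  obtain c' where c': "c' \<in> carrier (Z1 (G Mod N) MN (coset_act act))"
     "Y = H1_class (G Mod N) MN (coset_act act) c'"
    using Y by (auto simp: MN.carrier_H1)
  have "cohomologous (inflate c) (inflate c')"
    using eq c c' by (intro H1_class_eqD) (auto simp: inflation_class inflate_Z1)
  then show "X = Y"
    using c c' by (simp add: inflate_cohomologous_iff MN.H1_class_eqI)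
qed

end

section \<open>Power series, substitution and derivations\<close>

text \<open>Iterating the step writes \<open>E f\<close> as a multiple of every power of
  \<open>g\<close>, so all its coefficients vanish. Applied to the defect of an identity, this
  replaces any continuity assumption on automorphisms and derivations.\<close>

lemma fps_zero_by_iteration:
  fixes E :: "'b \<Rightarrow> 'a::comm_ring_1 fps"
  assumes g: "g $ 0 = 0" and step: "\<And>f. \<exists>f'. E f = g * E f'"
  shows "E f = 0"
proof -
  have "\<forall>f. \<forall>m<n. E f $ m = 0" for n
  proof (induction n)
    case (Suc n)
    show ?case
    proof (intro allI impI)
      fix f m assume m: "m < Suc n"
      obtain f' where f': "E f = g * E f'"
        using step by blast
      have "g $ i * E f' $ (m - i) = 0" if "i \<le> m" for i
        using that m g Suc by (cases "i = 0") auto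
      then show "E f $ m = 0"
        by (simp add: f' fps_mult_nth)
    qed
  qed auto
  then show ?thesis
    by (intro fps_ext) (metis fps_zero_nth lessI)
qed

lemma fps_decompose_X:
  fixes f :: "'a::comm_ring_1 fps"
  shows "f = fps_const (f $ 0) + fps_X * fps_shift 1 f"
  by (rule fps_ext) (simp add: fps_X_mult_nth split: nat_diff_split)

lemma fps_compose_decompose:
  fixes f :: "'a::idom fps"
  assumes "g $ 0 = 0"
  shows "f oo g = fps_const (f $ 0) + g * (fps_shift 1 f oo g)"
  by (subst fps_decompose_X[of f])
     (simp only: fps_compose_add_distrib fps_compose_mult_distrib[OF assms] fps_const_compose
        fps_X_fps_compose_startby0[OF assms])

text \<open>Automatic continuity: splitting off the constant term of \<open>f\<close> shows that the
  defect \<open>E f\<close> is \<sigma>(t) times the defect of the shifted series.\<close>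

lemma alg_hom_eq_compose:
  fixes \<sigma> :: "'a::idom fps \<Rightarrow> 'a fps"
  assumes add: "\<And>x y. \<sigma> (x + y) = \<sigma> x + \<sigma> y" and mult: "\<And>x y. \<sigma> (x * y) = \<sigma> x * \<sigma> y"
    and const: "\<And>a. \<sigma> (fps_const a) = fps_const a" and X: "\<sigma> fps_X $ 0 = 0"
  shows "\<sigma> f = f oo \<sigma> fps_X"
proof -
  define E where "E = (\<lambda>f. \<sigma> f - (f oo \<sigma> fps_X))"
  have "E f = \<sigma> fps_X * E (fps_shift 1 f)" for f
  proof -
    have "\<sigma> f = fps_const (f $ 0) + \<sigma> fps_X * \<sigma> (fps_shift 1 f)"
      by (subst fps_decompose_X[of f]) (simp only: add mult const)
    then show ?thesis
      unfolding E_def by (subst fps_compose_decompose[OF X]) (simp add: algebra_simps)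
  qed
  then have "E f = 0"
    by (intro fps_zero_by_iteration[OF X]) blast
  then show ?thesis
    by (simp add: E_def)
qed

text \<open>The chain rule without continuity. The hypotheses speak only of series in
  \<open>y\<close>, because \<open>d\<close> may be a derivation of the subring k[[y]]
  alone.\<close>

lemma derivation_compose:
  fixes d :: "'a::idom fps \<Rightarrow> 'a fps"
  assumes y: "y $ 0 = 0"
    and add: "\<And>u v. d ((u oo y) + (v oo y)) = d (u oo y) + d (v oo y)"
    and mult: "\<And>u v. d ((u oo y) * (v oo y)) = d (u oo y) * (v oo y) + (u oo y) * d (v oo y)"
    and lin: "\<And>a u. d (fps_const a * (u oo y)) = fps_const a * d (u oo y)"
  shows "d (u oo y) = (fps_deriv u oo y) * d y"
proof -
  have yX: "fps_X oo y = y"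
    using y by simp
  have "d 1 + 0 = d 1 + d 1"
    using mult[of 1 1] by (simp only: fps_compose_1 mult_1_left mult_1_right add_0_right)
  then have d1: "d 1 = 0"
    by (metis add_left_imp_eq)
  have dc: "d (fps_const a) = 0" for a
    using lin[of a 1] d1 by simp
  define E where "E = (\<lambda>u. d (u oo y) - (fps_deriv u oo y) * d y)"
  have "E u = y * E (fps_shift 1 u)" for u
  proof -
    define v where "v = fps_shift 1 u"
    have u: "u = fps_const (u $ 0) + fps_X * v"
      unfolding v_def by (rule fps_decompose_X)
    have uy: "u oo y = (fps_const (u $ 0) oo y) + (fps_X * v oo y)"
      by (subst u) (rule fps_compose_add_distrib)
    have "d (u oo y) = d (fps_const (u $ 0) oo y) + d (fps_X * v oo y)"
      unfolding uy by (rule add)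
    also have "fps_X * v oo y = (fps_X oo y) * (v oo y)"
      by (rule fps_compose_mult_distrib[OF y])
    also have "d \<dots> = d y * (v oo y) + y * d (v oo y)"
      unfolding mult by (simp only: yX)
    finally have 1: "d (u oo y) = d y * (v oo y) + y * d (v oo y)"
      by (simp add: dc)
    have "fps_deriv u = v + fps_X * fps_deriv v"
      by (subst u) (simp add: mult.commute)
    then have "fps_deriv u oo y = (v oo y) + y * (fps_deriv v oo y)"
      by (simp add: fps_compose_add_distrib fps_compose_mult_distrib[OF y] yX)
    then show ?thesis
      unfolding E_def v_def [symmetric] 1 by (simp add: algebra_simps)
  qed
  then have "E u = 0"
    by (intro fps_zero_by_iteration[OF y]) blast
  then show ?thesis
    by (simp add: E_def)
qed

lemma fps_compose_inj:
  fixes y :: "'a::idom fps"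
  assumes "y $ 0 = 0" "y \<noteq> 0"
  shows "inj (\<lambda>u. u oo y)"
proof (rule injI)
  fix u v assume "u oo y = v oo y"
  then have "(u - v) oo y = 0"
    by (simp add: fps_compose_sub_distrib)
  then show "u = v"
    using assms by (simp add: fps_compose_eq_0_iff)
qed

section \<open>Expansion with respect to a series of positive order\<close>

text \<open>Divide repeatedly with remainder by \<open>g\<close>.\<close>

lemma fps_expansion:
  fixes g :: "'a::field fps"
  assumes g: "g $ 0 = 0" "g \<noteq> 0"
  shows "\<exists>a. f = (\<Sum>i<subdegree g. (a i oo g) * fps_X ^ i)"
proof -
  define m where "m = subdegree g"
  \<comment> \<open>The base-\<open>g\<close> digits of \<open>f\<close>: \<open>q\<close> is the
    quotient by \<open>g\<close>, and the coefficient of index j of \<open>a f i\<close> is the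
    coefficient of t^i in the j-th iterated quotient.\<close>
  define q where "q = (\<lambda>f::'a fps. fps_shift m f / fps_shift m g)"
  define a where "a = (\<lambda>f i. Abs_fps (\<lambda>j. (q ^^ j) f $ i))"
  define E where "E = (\<lambda>f. f - (\<Sum>i<m. (a f i oo g) * fps_X ^ i))"
  have unit: "fps_shift m g $ 0 \<noteq> 0"
    using g by (simp add: m_def)
  have "E f = g * E (q f)" for f
  proof -
    have a_step: "a f i = fps_const (f $ i) + fps_X * a (q f) i" for i
    proof (rule fps_ext)
      show "a f i $ j = (fps_const (f $ i) + fps_X * a (q f) i) $ j" for j
        by (cases j) (simp_all add: a_def funpow_Suc_right del: funpow.simps(2))
    qed
    have "a f i oo g = fps_const (f $ i) + g * (a (q f) i oo g)" for i
      unfolding a_step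
      by (simp add: fps_compose_add_distrib fps_compose_mult_distrib[OF g(1)] g(1))
    then have "(\<Sum>i<m. (a f i oo g) * fps_X ^ i)
       = (\<Sum>i<m. fps_const (f $ i) * fps_X ^ i) + g * (\<Sum>i<m. (a (q f) i oo g) * fps_X ^ i)"
      by (simp add: algebra_simps sum.distrib sum_distrib_left)
    moreover have "f = (\<Sum>i<m. fps_const (f $ i) * fps_X ^ i) + g * q f"
    proof -
      have "fps_shift m g * q f = fps_shift m f"
        using unit unfolding q_def by (simp add: fps_divide_unit inverse_mult_eq_1')
      then have "g * q f = fps_X ^ m * fps_shift m f"
        using subdegree_decompose[of g] by (metis m_def mult.commute mult.left_commute)
      moreover have "(\<Sum>i<m. fps_const (f $ i) * fps_X ^ i) = fps_cutoff m f"
        by (rule fps_ext)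
           (simp add: fps_sum_nth fps_X_power_nth if_distrib[of "(*) _"] sum.delta' cong: if_cong)
      ultimately show ?thesis
        using fps_shift_cutoff[of m f] by (simp add: mult.commute add.commute)
    qed
    ultimately show ?thesis
      unfolding E_def by (simp add: algebra_simps)
  qed
  then have "E f = 0"
    by (intro fps_zero_by_iteration[OF g(1)]) blast
  then show ?thesis
    unfolding E_def m_def by (intro exI[of _ "a f"]) simp
qed

text \<open>Below the order of \<open>g\<close> the expansion coincides with its remainder, since
  every multiple of \<open>g\<close> vanishes there and only the constant terms of the
  \<open>a i\<close> survive.\<close>

lemma fps_expansion_nth:
  fixes g :: "'a::field fps"
  assumes g: "g $ 0 = 0" and j: "j < subdegree g"
  shows "(\<Sum>i<subdegree g. (a i oo g) * fps_X ^ i) $ j = a j $ 0"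
proof -
  have "((a i oo g) * fps_X ^ i) $ j = (if i = j then a i $ 0 else 0)" for i
  proof -
    have z: "(g * h) $ l = 0" if "l \<le> j" for l h
    proof -
      have "g $ x * h $ (l - x) = 0" if x: "x \<in> {0..l}" for x
      proof -
        have "x < subdegree g"
          using x \<open>l \<le> j\<close> j by (meson atLeastAtMost_iff le_less_trans order_trans)
        then have "g $ x = 0"
          by (rule nth_less_subdegree_zero)
        then show ?thesis
          by (simp only: mult_zero_left)
      qed
      then show ?thesis
        unfolding fps_mult_nth by (rule sum.neutral[OF ballI])
    qed
    have "(a i oo g) $ l = (if l = 0 then a i $ 0 else 0)" if "l \<le> j" for l
      unfolding fps_compose_decompose[OF g, of "a i"] fps_add_nth z[OF that] by simp
    then show ?thesis
      unfolding fps_X_power_mult_right_nth by auto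
  qed
  then show ?thesis
    using j by (simp add: fps_sum_nth)
qed

text \<open>The constant terms vanish by comparing low coefficients; then \<open>g\<close> can be
  cancelled and the shifted coefficient series satisfy the same relation. The induction therefore
  quantifies over all families \<open>a\<close>.\<close>

lemma fps_expansion_unique:
  fixes g :: "'a::field fps"
  assumes g: "g $ 0 = 0" "g \<noteq> 0" and "(\<Sum>i<subdegree g. (a i oo g) * fps_X ^ i) = 0"
    and i: "i < subdegree g"
  shows "a i = 0"
proof -
  have "\<forall>a. (\<Sum>i<subdegree g. (a i oo g) * fps_X ^ i) = 0 \<longrightarrow> (\<forall>i<subdegree g. a i $ j = 0)" for j
  proof (induction j)
    case 0
    then show ?case
      using fps_expansion_nth[OF g(1)] by (metis fps_zero_nth)
  next
    case (Suc j)
    show ?case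
    proof (intro allI impI)
      fix a i assume a: "(\<Sum>i<subdegree g. (a i oo g) * fps_X ^ i) = 0" and i: "i < subdegree g"
      have "a i $ 0 = 0" if "i < subdegree g" for i
        using that fps_expansion_nth[OF g(1) that, of a] a by simp
      then have "a i oo g = g * (fps_shift 1 (a i) oo g)" if "i < subdegree g" for i
        using that fps_compose_decompose[OF g(1), of "a i"] by simp
      then have "g * (\<Sum>i<subdegree g. (fps_shift 1 (a i) oo g) * fps_X ^ i) = 0"
        using a by (simp add: sum_distrib_left mult.assoc)
      then have "(\<Sum>i<subdegree g. (fps_shift 1 (a i) oo g) * fps_X ^ i) = 0"
        using g by simp
      then show "a i $ Suc j = 0"
        using Suc i by fastforce
    qed
  qed
  then show ?thesis
    using assms(3) i by (intro fps_ext) auto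
qed

section \<open>Finite groups of automorphisms of a power series ring\<close>

lemma GamD:
  assumes "\<sigma> \<in> carrier Gam"
  shows "\<sigma> (x + y) = \<sigma> x + \<sigma> y" "\<sigma> (x * y) = \<sigma> x * \<sigma> y" "\<sigma> (fps_const a) = fps_const a" "bij \<sigma>"
  using assms by (auto simp: Gam_def alg_Aut_def Bij_def)

lemma GamI:
  assumes "\<And>x y. \<sigma> (x + y) = \<sigma> x + \<sigma> y" "\<And>x y. \<sigma> (x * y) = \<sigma> x * \<sigma> y"
    "\<And>a. \<sigma> (fps_const a) = fps_const a" "bij \<sigma>"
  shows "\<sigma> \<in> carrier Gam"
  using assms by (auto simp: Gam_def alg_Aut_def Bij_def)

lemma Gam_mult:
  assumes "\<sigma> \<in> carrier Gam" "\<tau> \<in> carrier Gam"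
  shows "\<sigma> \<otimes>\<^bsub>Gam\<^esub> \<tau> = \<sigma> \<circ> \<tau>"
  using assms by (auto simp: Gam_def alg_Aut_def BijGroup_def compose_def fun_eq_iff)

lemma Gam_one: "\<one>\<^bsub>Gam\<^esub> = id"
  by (auto simp: Gam_def alg_Aut_def BijGroup_def)

lemma Gam_id: "id \<in> carrier Gam"
  by (auto intro!: GamI)

lemma group_Gam: "group (Gam :: ('a::comm_ring_1 fps \<Rightarrow> _) monoid)"
proof (rule groupI)
  fix \<sigma> \<tau> :: "'a fps \<Rightarrow> 'a fps"
  assume "\<sigma> \<in> carrier Gam" "\<tau> \<in> carrier Gam"
  then show "\<sigma> \<otimes>\<^bsub>Gam\<^esub> \<tau> \<in> carrier Gam"
    by (auto simp: Gam_mult GamD intro!: GamI bij_comp)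
next
  show "\<one>\<^bsub>Gam\<^esub> \<in> carrier (Gam :: ('a fps \<Rightarrow> _) monoid)"
    by (auto simp: Gam_one intro!: GamI)
next
  fix \<sigma> \<tau> \<upsilon> :: "'a fps \<Rightarrow> 'a fps"
  assume s: "\<sigma> \<in> carrier Gam" "\<tau> \<in> carrier Gam" "\<upsilon> \<in> carrier Gam"
  then have "\<sigma> \<circ> \<tau> \<in> carrier Gam" "\<tau> \<circ> \<upsilon> \<in> carrier Gam"
    by (auto simp: GamD intro!: GamI bij_comp)
  then show "\<sigma> \<otimes>\<^bsub>Gam\<^esub> \<tau> \<otimes>\<^bsub>Gam\<^esub> \<upsilon> = \<sigma> \<otimes>\<^bsub>Gam\<^esub> (\<tau> \<otimes>\<^bsub>Gam\<^esub> \<upsilon>)"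
    using s by (simp add: Gam_mult comp_assoc)
next
  fix \<sigma> :: "'a fps \<Rightarrow> 'a fps"
  assume s: "\<sigma> \<in> carrier Gam"
  have surj: "\<sigma> (inv_into UNIV \<sigma> x) = x" and inj: "inv_into UNIV \<sigma> (\<sigma> x) = x" for x
    using GamD(4)[OF s] by (auto simp: bij_is_surj bij_is_inj surj_f_inv_f)
  have "inv_into UNIV \<sigma> \<in> carrier Gam"
  proof (rule GamI)
    show "inv_into UNIV \<sigma> (x + y) = inv_into UNIV \<sigma> x + inv_into UNIV \<sigma> y" for x y
      by (metis GamD(1)[OF s] surj inj)
    show "inv_into UNIV \<sigma> (x * y) = inv_into UNIV \<sigma> x * inv_into UNIV \<sigma> y" for x y
      by (metis GamD(2)[OF s] surj inj)
    show "inv_into UNIV \<sigma> (fps_const a) = fps_const a" for a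
      by (metis GamD(3)[OF s] inj)
    show "bij (inv_into UNIV \<sigma>)"
      using GamD(4)[OF s] by (rule bij_imp_bij_inv)
  qed
  moreover from this have "inv_into UNIV \<sigma> \<otimes>\<^bsub>Gam\<^esub> \<sigma> = \<one>\<^bsub>Gam\<^esub>"
    using s inj by (auto simp: Gam_mult Gam_one)
  ultimately show "\<exists>\<tau>\<in>carrier Gam. \<tau> \<otimes>\<^bsub>Gam\<^esub> \<sigma> = \<one>\<^bsub>Gam\<^esub>"
    by blast
qed (simp add: Gam_mult Gam_one Gam_id)

text \<open>Otherwise \<sigma>(t) would be a unit, and by bijectivity t would be one too.\<close>

lemma Gam_X_nth_0:
  fixes \<sigma> :: "'k::field fps \<Rightarrow> 'k fps"
  assumes s: "\<sigma> \<in> carrier Gam"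
  shows "\<sigma> fps_X $ 0 = 0"
proof (rule ccontr)
  assume "\<sigma> fps_X $ 0 \<noteq> 0"
  then have "\<sigma> fps_X * inverse (\<sigma> fps_X) = 1"
    by (rule inverse_mult_eq_1')
  moreover obtain w where "\<sigma> w = inverse (\<sigma> fps_X)"
    using GamD(4)[OF s] by (metis bij_pointE)
  ultimately have "\<sigma> (fps_X * w) = \<sigma> (fps_const 1)"
    by (simp only: GamD(2,3)[OF s]) simp
  then have "fps_X * w = fps_const 1"
    using GamD(4)[OF s] by (metis bij_def injD)
  then have "(fps_X * w) $ 0 = 1"
    by simp
  then show False
    by simp
qed

lemma Gam_compose:
  fixes \<sigma> :: "'k::field fps \<Rightarrow> 'k fps"
  assumes "\<sigma> \<in> carrier Gam"
  shows "\<sigma> f = f oo \<sigma> fps_X"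
  by (intro alg_hom_eq_compose Gam_X_nth_0 GamD assms)

text \<open>If w is the preimage of t, then w(\<sigma>(t)) = t, and comparing linear coefficients
  shows that the one of \<sigma>(t) is invertible.\<close>

lemma Gam_X_subdegree:
  fixes \<sigma> :: "'k::field fps \<Rightarrow> 'k fps"
  assumes s: "\<sigma> \<in> carrier Gam"
  shows "subdegree (\<sigma> fps_X) = 1"
proof -
  obtain w where w: "\<sigma> w = fps_X"
    using GamD(4)[OF s] by (metis bij_pointE)
  then have wX: "w oo \<sigma> fps_X = fps_X"
    using Gam_compose[OF s, of w] by (simp only:)
  have "(w oo \<sigma> fps_X) $ 0 = w $ 0"
    by simp
  then have "w $ 0 = 0"
    using wX by simp
  moreover have "(w oo \<sigma> fps_X) $ 1 = w $ 0 * (1::'k fps) $ 1 + w $ 1 * \<sigma> fps_X $ 1"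
    by (simp add: fps_compose_nth atLeast0AtMost)
  ultimately have "w $ 1 * \<sigma> fps_X $ 1 = 1"
    using wX by simp
  then show ?thesis
    using Gam_X_nth_0[OF s] by (intro subdegreeI) auto
qed

lemma Gam_prod:
  assumes "\<sigma> \<in> carrier Gam"
  shows "\<sigma> (prod f A) = (\<Prod>a\<in>A. \<sigma> (f a))"
proof -
  have "\<sigma> 1 = 1"
    using GamD(3)[OF assms, of 1] by simp
  then show ?thesis
    by (induction A rule: infinite_finite_induct) (auto simp: GamD(2)[OF assms])
qed

text \<open>Left translation by \<open>s\<close> permutes the factors. The coefficient ring is left
  general because the lemma is applied over k and also over the dual numbers, where it yields the
  invariance of y_A.\<close>

lemma (in group) norm_param_invariant:
  assumes \<rho>: "\<rho> \<in> hom G Gam" and S: "subgroup S G" and s: "s \<in> S"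
  shows "\<rho> s (norm_param \<rho> S) = norm_param \<rho> S"
proof -
  have sG: "s \<in> carrier G" and SG: "S \<subseteq> carrier G"
    using S s by (auto simp: subgroup.mem_carrier subgroup.subset)
  have \<rho>s: "\<rho> s \<in> carrier Gam"
    using \<rho> sG by (auto simp: hom_def)
  have "\<rho> s (norm_param \<rho> S) = (\<Prod>t\<in>S. \<rho> (s \<otimes> t) fps_X)"
    unfolding norm_param_def using \<rho> \<rho>s sG SG
    by (auto simp: Gam_prod hom_def Gam_mult Pi_iff subset_iff intro!: prod.cong)
  also have "\<dots> = norm_param \<rho> S"
    unfolding norm_param_def
    by (rule prod.reindex_bij_witness[of _ "\<lambda>t. inv s \<otimes> t" "\<lambda>t. s \<otimes> t"])
       (use S s sG SG in \<open>auto simp: subgroup.m_closed subgroup.m_inv_closed subsetD simp flip: m_assoc\<close>)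
  finally show ?thesis .
qed

section \<open>Faithful finite actions on k[[t]]: conjugates, invariants, separability\<close>

locale fps_action = group G for G :: "('g, 'b) monoid_scheme" (structure) +
  fixes \<rho> :: "'g \<Rightarrow> 'k::field fps \<Rightarrow> 'k fps"
  assumes finite_G: "finite (carrier G)" and local_action: "local_action G \<rho>"
begin

lemma rho_hom: "\<rho> \<in> hom G Gam"
  using local_action by (simp add: local_action_def)

lemma rho_Gam: "g \<in> carrier G \<Longrightarrow> \<rho> g \<in> carrier Gam"
  using local_action by (auto simp: local_action_def hom_def)

lemmas rho_add = GamD(1)[OF rho_Gam] and rho_mult = GamD(2)[OF rho_Gam]
  and rho_const = GamD(3)[OF rho_Gam] and rho_bij = GamD(4)[OF rho_Gam]

lemma rho_rho: "g \<in> carrier G \<Longrightarrow> h \<in> carrier G \<Longrightarrow> \<rho> (g \<otimes> h) x = \<rho> g (\<rho> h x)"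
  using local_action by (auto simp: local_action_def hom_def Gam_mult Pi_iff)

lemma rho_one: "\<rho> \<one> x = x"
proof -
  have "\<rho> \<one> (\<rho> \<one> x) = \<rho> \<one> x"
    using rho_rho[of \<one> \<one> x] by simp
  then show ?thesis
    using rho_bij[OF one_closed] by (metis bij_def injD)
qed

lemma rho_0: "g \<in> carrier G \<Longrightarrow> \<rho> g 0 = 0"
  using rho_const[of g 0] by simp

lemma rho_1: "g \<in> carrier G \<Longrightarrow> \<rho> g 1 = 1"
  using rho_const[of g 1] by simp

lemma rho_minus: "g \<in> carrier G \<Longrightarrow> \<rho> g (- x) = - \<rho> g x"
  using rho_add[of g x "- x"] rho_0[of g] by (simp add: add_eq_0_iff)

lemma rho_diff: "g \<in> carrier G \<Longrightarrow> \<rho> g (x - y) = \<rho> g x - \<rho> g y"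
  using rho_add[of g x "- y"] rho_minus[of g y] by simp

lemma rho_sum: "g \<in> carrier G \<Longrightarrow> \<rho> g (sum f A) = (\<Sum>a\<in>A. \<rho> g (f a))"
  by (induction A rule: infinite_finite_induct) (auto simp: rho_0 rho_add)

lemma rho_power: "g \<in> carrier G \<Longrightarrow> \<rho> g (x ^ n) = \<rho> g x ^ n"
  by (induction n) (auto simp: rho_1 rho_mult)

lemma rho_inv: "g \<in> carrier G \<Longrightarrow> \<rho> (inv g) (\<rho> g x) = x" "g \<in> carrier G \<Longrightarrow> \<rho> g (\<rho> (inv g) x) = x"
  by (simp_all flip: rho_rho add: rho_one)

text \<open>An automorphism is substitution of its value at t, so faithfulness makes the conjugates
  of t pairwise distinct. Both root-counting and separability rest on this.\<close>

lemma inj_on_rho_X: "inj_on (\<lambda>g. \<rho> g fps_X) (carrier G)"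
proof (rule inj_onI)
  fix g h assume gh: "g \<in> carrier G" "h \<in> carrier G" "\<rho> g fps_X = \<rho> h fps_X"
  then have "\<rho> g f = \<rho> h f" for f
    using Gam_compose[OF rho_Gam, of g f] Gam_compose[OF rho_Gam, of h f] by simp
  then have "\<rho> g = \<rho> h"
    by (rule ext)
  then show "g = h"
    using local_action gh by (auto simp: local_action_def inj_on_def)
qed

lemma norm_param_subdegree:
  assumes "S \<subseteq> carrier G"
  shows "subdegree (norm_param \<rho> S) = card S"
proof -
  have "\<rho> s fps_X \<noteq> 0" "subdegree (\<rho> s fps_X) = 1" if "s \<in> S" for s
    using Gam_X_subdegree[OF rho_Gam, of s] that assms by auto
  then show ?thesis
    unfolding norm_param_def by (subst subdegree_prod) auto
qed

lemma subgroup_card_pos: "subgroup S G \<Longrightarrow> card S > 0"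
  using finite_G finite_subset[OF subgroup.subset, of S G] subgroup.one_closed[of S G]
  by (auto simp: card_gt_0_iff)

lemma norm_param_nth_0:
  assumes S: "subgroup S G"
  shows "norm_param \<rho> S $ 0 = 0" "norm_param \<rho> S \<noteq> 0"
proof -
  have "subdegree (norm_param \<rho> S) > 0"
    using S subgroup_card_pos by (simp add: norm_param_subdegree subgroup.subset)
  then show "norm_param \<rho> S $ 0 = 0" "norm_param \<rho> S \<noteq> 0"
    by auto
qed

lemma rho_compose_fixed:
  assumes g: "g \<in> carrier G" and y: "\<rho> g y = y" "y $ 0 = 0"
  shows "\<rho> g (u oo y) = u oo y"
proof -
  have "\<rho> g (u oo y) = u oo (y oo \<rho> g fps_X)"
    unfolding Gam_compose[OF rho_Gam[OF g], of "u oo y"]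
    using y(2) Gam_X_nth_0[OF rho_Gam[OF g]] by (simp add: fps_compose_assoc)
  then show ?thesis
    using y(1) Gam_compose[OF rho_Gam[OF g], of y] by simp
qed

text \<open>If \<open>f\<close> is invariant and $f = \sum_{i<n} a_i t^i$ with $a_i \in k[[y]]$, then the polynomial
  $\sum a_i T^i - f$ has the \<open>n\<close> distinct conjugates of \<open>t\<close> as roots, hence vanishes.\<close>

lemma fixed_ring_eq:
  assumes S: "subgroup S G"
  shows "fixed_ring \<rho> S = range (\<lambda>u. u oo norm_param \<rho> S)"
proof (intro equalityI subsetI)
  let ?y = "norm_param \<rho> S"
  have SG: "S \<subseteq> carrier G"
    using S by (rule subgroup.subset)
  have inv: "\<rho> s (u oo ?y) = u oo ?y" if "s \<in> S" for s u
    using that SG norm_param_invariant[OF rho_hom S that] norm_param_nth_0[OF S]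
    by (intro rho_compose_fixed) auto
  then show "f \<in> fixed_ring \<rho> S" if "f \<in> range (\<lambda>u. u oo ?y)" for f
    using that by (auto simp: fixed_ring_def)
  fix f assume f: "f \<in> fixed_ring \<rho> S"
  obtain a where a: "f = (\<Sum>i<card S. (a i oo ?y) * fps_X ^ i)"
    using fps_expansion[OF norm_param_nth_0[OF S], of f] norm_param_subdegree[OF SG] by auto
  define P where "P = (\<Sum>i<card S. monom (a i oo ?y) i) - [:f:]"
  have "poly P (\<rho> s fps_X) = 0" if s: "s \<in> S" for s
  proof -
    have sG: "s \<in> carrier G"
      using s SG by auto
    have "f = \<rho> s f"
      using f s by (simp add: fixed_ring_def)
    also have "\<dots> = (\<Sum>i<card S. (a i oo ?y) * \<rho> s fps_X ^ i)"
      by (subst a) (simp add: rho_sum[OF sG] rho_mult[OF sG] rho_power[OF sG] inv[OF s])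
    finally show ?thesis
      unfolding P_def by (simp add: poly_sum poly_monom)
  qed
  then have sub: "(\<lambda>s. \<rho> s fps_X) ` S \<subseteq> {x. poly P x = 0}"
    by auto
  have "degree P \<le> card S - 1"
    unfolding P_def
    by (intro degree_diff_le degree_sum_le) (auto intro: order.trans[OF degree_monom_le])
  have "P = 0"
  proof (rule ccontr)
    assume P: "P \<noteq> 0"
    then have "card ((\<lambda>s. \<rho> s fps_X) ` S) \<le> card {x. poly P x = 0}"
      using sub by (intro card_mono poly_roots_finite)
    also have "\<dots> \<le> degree P"
      using P by (rule card_poly_roots_bound)
    finally have "card S \<le> card S - 1"
      using card_image[OF inj_on_subset[OF inj_on_rho_X SG]] \<open>degree P \<le> card S - 1\<close> by simp
    then show False
      using subgroup_card_pos[OF S] by simp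
  qed
  then have "coeff P 0 = 0"
    by simp
  then have "f = a 0 oo ?y"
    using subgroup_card_pos[OF S] by (simp add: P_def coeff_sum)
  then show "f \<in> range (\<lambda>u. u oo ?y)"
    by blast
qed

text \<open>Separability: the polynomial \<open>\<Prod>g. (T - g t)\<close> has coefficients in $k[[y_G]]$, on which
  \<open>d/dt\<close> would vanish if $y_G' = 0$; but its derivative at \<open>t\<close> is nonzero.\<close>

lemma fps_deriv_norm_param_nonzero: "fps_deriv (norm_param \<rho> (carrier G)) \<noteq> 0"
proof
  let ?y = "norm_param \<rho> (carrier G)"
  assume y': "fps_deriv ?y = 0"
  have y0: "?y $ 0 = 0"
    by (intro norm_param_nth_0 subgroup_self)
  define P where "P = (\<Prod>g\<in>carrier G. [:- \<rho> g fps_X, 1:])"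
  have inv: "map_poly (\<rho> g) P = P" if g: "g \<in> carrier G" for g
  proof -
    have hom: "map_poly (\<rho> g) (p * q) = map_poly (\<rho> g) p * map_poly (\<rho> g) q" for p q
      by (rule poly_eqI) (simp add: coeff_map_poly rho_0[OF g] coeff_mult rho_sum[OF g] rho_mult[OF g])
    have "map_poly (\<rho> g) (prod f A) = (\<Prod>a\<in>A. map_poly (\<rho> g) (f a))" for f :: "'g \<Rightarrow> _" and A
      by (induction A rule: infinite_finite_induct) (auto simp: hom rho_1[OF g] map_poly_1')
    then have "map_poly (\<rho> g) P = (\<Prod>h\<in>carrier G. [:- \<rho> (g \<otimes> h) fps_X, 1:])"
      using g by (simp add: P_def map_poly_pCons rho_0 rho_1 rho_minus rho_rho)
    also have "\<dots> = P"
      unfolding P_def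
      by (rule prod.reindex_bij_witness[of _ "\<lambda>t. inv g \<otimes> t" "\<lambda>t. g \<otimes> t"])
         (use g in \<open>auto simp flip: m_assoc\<close>)
    finally show ?thesis .
  qed
  have "fps_deriv (coeff P i) = 0" for i
  proof -
    have "\<rho> g (coeff P i) = coeff P i" if "g \<in> carrier G" for g
      using inv[OF that] by (metis coeff_map_poly rho_0 that)
    then have "coeff P i \<in> range (\<lambda>u. u oo ?y)"
      by (subst fixed_ring_eq [symmetric]) (auto simp: subgroup_self fixed_ring_def)
    then show ?thesis
      using y' y0 by (auto simp: fps_compose_deriv)
  qed
  \<comment> \<open>Differentiating Q(x) gives the part from the coefficients plus Q'(x) dx/dt; at x
    = t with constant-like coefficients only P'(t) remains.\<close>
  moreover have "fps_deriv (poly Q x) =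
      poly (map_poly fps_deriv Q) x + poly (pderiv Q) x * fps_deriv x" for Q and x :: "'k fps"
  proof (induction Q)
    case (pCons a Q)
    then show ?case
      by (simp add: map_poly_pCons pderiv_pCons algebra_simps)
  qed simp
  moreover from calculation have "map_poly fps_deriv P = 0"
    by (intro poly_eqI) (simp add: coeff_map_poly)
  ultimately have "fps_deriv (poly P fps_X) = poly (pderiv P) fps_X"
    by simp
  moreover have "poly P fps_X = 0"
    unfolding P_def poly_prod using finite_G
    by (intro prod_zero) (auto intro!: bexI[of _ \<one>] simp: rho_one)
  ultimately have "poly (pderiv P) fps_X = 0"
    by simp
  \<comment> \<open>Splitting off the factor T - t of \<open>P\<close> leaves \<open>Q\<close> with
    P'(t) = Q(t), the product of the differences of t and its other conjugates.\<close>
  moreover have "poly (pderiv P) fps_X = (\<Prod>g\<in>carrier G - {\<one>}. fps_X - \<rho> g fps_X)"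
  proof -
    define Q where "Q = (\<Prod>g\<in>carrier G - {\<one>}. [:- \<rho> g fps_X, 1:])"
    have "P = [:- fps_X, 1:] * Q"
      unfolding P_def Q_def using finite_G by (subst prod.remove[of _ \<one>]) (auto simp: rho_one)
    then have "poly (pderiv P) fps_X = poly Q fps_X"
      by (simp add: pderiv_mult pderiv_pCons del: mult_pCons_left)
    then show ?thesis
      by (simp add: Q_def poly_prod)
  qed
  ultimately have "(\<Prod>g\<in>carrier G - {\<one>}. fps_X - \<rho> g fps_X) = 0"
    by metis
  then have "\<exists>g\<in>carrier G - {\<one>}. fps_X - \<rho> g fps_X = 0"
    using prod_zero_iff[OF finite_Diff[OF finite_G], of "\<lambda>g. fps_X - \<rho> g fps_X"] by (rule iffD1[rotated])
  then obtain g where "g \<in> carrier G" "g \<noteq> \<one>" "\<rho> g fps_X = fps_X"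
    by (metis Diff_iff eq_iff_diff_eq_0 singletonI)
  then show False
    using inj_onD[OF inj_on_rho_X, of g \<one>] by (simp add: rho_one)
qed

end

section \<open>The different of a monogenic extension\<close>

text \<open>S is free over R on 1, \<theta>, ..., \<theta>^(m-1), and \<open>min_eq\<close> is the
  monic equation of \<theta>. By \<open>denom\<close> every nonzero element of S divides a nonzero
  element of R, so the same powers span the fraction field of S over that of R.\<close>

locale monogenic =
  fixes R S :: "'f::field set" and \<theta> :: 'f and a :: "nat \<Rightarrow> 'f" and m :: nat
  assumes m_pos: "0 < m"
    and R_0: "0 \<in> R" and R_1: "1 \<in> R"
    and R_add: "x \<in> R \<Longrightarrow> y \<in> R \<Longrightarrow> x + y \<in> R" and R_mult: "x \<in> R \<Longrightarrow> y \<in> R \<Longrightarrow> x * y \<in> R"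
    and R_uminus: "x \<in> R \<Longrightarrow> - x \<in> R"
    and S_eq: "S = {\<Sum>i<m. r i * \<theta> ^ i | r. \<forall>i<m. r i \<in> R}"
    and S_mult: "x \<in> S \<Longrightarrow> y \<in> S \<Longrightarrow> x * y \<in> S"
    and indep: "\<And>r i. (\<And>i. i < m \<Longrightarrow> r i \<in> R) \<Longrightarrow> (\<Sum>i<m. r i * \<theta> ^ i) = 0 \<Longrightarrow> i < m \<Longrightarrow> r i = 0"
    and a_R: "i < m \<Longrightarrow> a i \<in> R"
    and min_eq: "\<theta> ^ m = (\<Sum>i<m. a i * \<theta> ^ i)"
    and denom: "s \<in> S \<Longrightarrow> s \<noteq> 0 \<Longrightarrow> \<exists>s'\<in>S. s * s' \<in> R \<and> s * s' \<noteq> 0"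
begin

abbreviation K where "K \<equiv> frac_field R"
abbreviation L where "L \<equiv> frac_field S"

lemma R_prod: "(\<And>x. x \<in> A \<Longrightarrow> f x \<in> R) \<Longrightarrow> prod f A \<in> R"
  by (induction A rule: infinite_finite_induct) (auto simp: R_1 R_mult)

lemma S_I: "(\<And>i. i < m \<Longrightarrow> r i \<in> R) \<Longrightarrow> (\<Sum>i<m. r i * \<theta> ^ i) \<in> S"
  unfolding S_eq by blast

lemma S_E:
  assumes "s \<in> S" obtains r where "\<forall>i<m. r i \<in> R" "s = (\<Sum>i<m. r i * \<theta> ^ i)"
  using assms unfolding S_eq by blast

lemma S_add: "x \<in> S \<Longrightarrow> y \<in> S \<Longrightarrow> x + y \<in> S"
proof (elim S_E)
  fix r r' assume "\<forall>i<m. r i \<in> R" "\<forall>i<m. r' i \<in> R"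
    "x = (\<Sum>i<m. r i * \<theta> ^ i)" "y = (\<Sum>i<m. r' i * \<theta> ^ i)"
  then show "x + y \<in> S"
    using S_I[of "\<lambda>i. r i + r' i"] by (simp add: R_add algebra_simps sum.distrib)
qed

lemma theta_pow_S: "i < m \<Longrightarrow> r \<in> R \<Longrightarrow> r * \<theta> ^ i \<in> S"
  using S_I[of "\<lambda>j. if j = i then r else 0"] by (simp add: R_0 if_distrib[of "\<lambda>x. x * _"] cong: if_cong)

lemma theta_S: "i < m \<Longrightarrow> \<theta> ^ i \<in> S"
  using theta_pow_S[OF _ R_1] by simp

lemma R_S: "r \<in> R \<Longrightarrow> r \<in> S"
  using theta_pow_S[OF m_pos] by simp

lemma S_sum: "(\<And>x. x \<in> A \<Longrightarrow> f x \<in> S) \<Longrightarrow> sum f A \<in> S"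
  by (induction A rule: infinite_finite_induct) (auto simp: R_S R_0 S_add)

lemma K_I: "p \<in> R \<Longrightarrow> q \<in> R \<Longrightarrow> q \<noteq> 0 \<Longrightarrow> p / q \<in> K"
  by (auto simp: frac_field_def)

lemma L_I: "p \<in> S \<Longrightarrow> q \<in> S \<Longrightarrow> q \<noteq> 0 \<Longrightarrow> p / q \<in> L"
  by (auto simp: frac_field_def)

lemma R_K: "r \<in> R \<Longrightarrow> r \<in> K"
  using K_I[of r 1] by (simp add: R_1)

lemma S_L: "r \<in> S \<Longrightarrow> r \<in> L"
  using L_I[of r 1] by (simp add: R_S R_1)

lemma theta_L: "i < m \<Longrightarrow> \<theta> ^ i \<in> L"
  by (intro S_L theta_S)

lemma K_L: "x \<in> K \<Longrightarrow> x \<in> L"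
  using R_S by (force simp: frac_field_def)

lemma K_add: "x \<in> K \<Longrightarrow> y \<in> K \<Longrightarrow> x + y \<in> K"
  unfolding frac_field_def
  by clarify (rule exI, rule exI, rule conjI, erule add_frac_eq, assumption, simp add: R_add R_mult)

lemma K_mult: "x \<in> K \<Longrightarrow> y \<in> K \<Longrightarrow> x * y \<in> K"
  unfolding frac_field_def
  by clarify (rule exI, rule exI, rule conjI, rule times_divide_times_eq, simp add: R_mult)

lemma K_uminus: "x \<in> K \<Longrightarrow> - x \<in> K"
  unfolding frac_field_def
  by clarify (rule exI, rule exI, rule conjI, rule minus_divide_left, simp add: R_uminus)

lemma L_add: "x \<in> L \<Longrightarrow> y \<in> L \<Longrightarrow> x + y \<in> L"
  unfolding frac_field_def
  by clarify (rule exI, rule exI, rule conjI, erule add_frac_eq, assumption, simp add: S_add S_mult)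

lemma L_mult: "x \<in> L \<Longrightarrow> y \<in> L \<Longrightarrow> x * y \<in> L"
  unfolding frac_field_def
  by clarify (rule exI, rule exI, rule conjI, rule times_divide_times_eq, simp add: S_mult)

lemma L_inverse: "x \<in> S \<Longrightarrow> x \<noteq> 0 \<Longrightarrow> 1 / x \<in> L"
  by (rule L_I[OF R_S[OF R_1]])

lemma K_sum: "(\<And>x. x \<in> A \<Longrightarrow> f x \<in> K) \<Longrightarrow> sum f A \<in> K"
  by (induction A rule: infinite_finite_induct) (auto simp: R_K R_0 K_add)

lemma L_sum: "(\<And>x. x \<in> A \<Longrightarrow> f x \<in> L) \<Longrightarrow> sum f A \<in> L"
  by (induction A rule: infinite_finite_induct) (auto simp: S_L R_S R_0 L_add)

section \<open>Coordinates in the power basis\<close>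

lemma indep_K:
  assumes c: "\<And>i. i < m \<Longrightarrow> c i \<in> K" and sum: "(\<Sum>i<m. c i * \<theta> ^ i) = 0" and i: "i < m"
  shows "c i = 0"
proof -
  have "\<exists>p q. p \<in> R \<and> q \<in> R \<and> q \<noteq> 0 \<and> c i = p / q" if "i < m" for i
    using c[OF that] by (auto simp: frac_field_def)
  then obtain p q where pq: "\<And>i. i < m \<Longrightarrow> p i \<in> R \<and> q i \<in> R \<and> q i \<noteq> 0 \<and> c i = p i / q i"
    by metis
  \<comment> \<open>A common denominator moves the relation into \<open>R\<close>, where
    \<open>indep\<close> applies.\<close>
  define d where "d = (\<Prod>i<m. q i)"
  have d: "d \<noteq> 0"
    using pq by (simp add: d_def)
  have "d * c i \<in> R" if "i < m" for i
  proof -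
    have "d = q i * (\<Prod>i\<in>{..<m} - {i}. q i)"
      unfolding d_def using that by (intro prod.remove) auto
    then have dc: "d * c i = p i * (\<Prod>i\<in>{..<m} - {i}. q i)"
      using pq[OF that] by simp
    show ?thesis
      unfolding dc using pq that by (intro R_mult R_prod) auto
  qed
  moreover have "(\<Sum>i<m. (d * c i) * \<theta> ^ i) = 0"
    using sum by (simp add: mult.assoc flip: sum_distrib_left)
  ultimately have "d * c i = 0"
    using indep[of "\<lambda>i. d * c i"] i by blast
  then show ?thesis
    using d by simp
qed

lemma coord_exists:
  assumes "x \<in> L"
  shows "\<exists>c. (\<forall>i<m. c i \<in> K) \<and> x = (\<Sum>i<m. c i * \<theta> ^ i)"
proof -
  obtain s t where st: "s \<in> S" "t \<in> S" "t \<noteq> 0" "x = s / t"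
    using assms by (auto simp: frac_field_def)
  obtain t' where t': "t' \<in> S" "t * t' \<in> R" "t * t' \<noteq> 0"
    using denom[OF st(2,3)] by blast
  obtain r where r: "\<forall>i<m. r i \<in> R" "s * t' = (\<Sum>i<m. r i * \<theta> ^ i)"
    using S_mult[OF st(1) t'(1)] by (rule S_E)
  have "x = (s * t') / (t * t')"
    using st t' by simp
  also have "\<dots> = (\<Sum>i<m. r i / (t * t') * \<theta> ^ i)"
    unfolding r(2) by (simp add: sum_divide_distrib)
  finally show ?thesis
    using r t' K_I by (intro exI[of _ "\<lambda>i. r i / (t * t')"]) auto
qed

text \<open>\<open>field_trace\<close> uses a basis chosen by \<open>SOME\<close>; in these
  coordinates membership in \<open>S\<close> can be read off (\<open>S_iff\<close>), so traces are
  to be compared with them.\<close>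

definition coord :: "'f \<Rightarrow> nat \<Rightarrow> 'f" where
  "coord x = (SOME c. (\<forall>i<m. c i \<in> K) \<and> x = (\<Sum>i<m. c i * \<theta> ^ i))"

lemma coord:
  assumes "x \<in> L"
  shows "i < m \<Longrightarrow> coord x i \<in> K" "(\<Sum>i<m. coord x i * \<theta> ^ i) = x"
  using someI_ex[OF coord_exists[OF assms]] unfolding coord_def by auto

lemma sum_in_L: "(\<And>i. i < m \<Longrightarrow> c i \<in> K) \<Longrightarrow> (\<Sum>i<m. c i * \<theta> ^ i) \<in> L"
  by (intro L_sum L_mult K_L theta_L) auto

lemma coord_unique:
  assumes c: "\<And>i. i < m \<Longrightarrow> c i \<in> K" and x: "x = (\<Sum>i<m. c i * \<theta> ^ i)" and i: "i < m"
  shows "coord x i = c i"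
proof -
  have xL: "x \<in> L"
    unfolding x using c by (rule sum_in_L)
  have "(\<Sum>i<m. (coord x i + - c i) * \<theta> ^ i) = 0"
    using coord(2)[OF xL] x by (simp add: algebra_simps sum_subtractf)
  moreover have "coord x i + - c i \<in> K" if "i < m" for i
    using that by (intro K_add K_uminus coord(1)[OF xL] c)
  ultimately have "coord x i + - c i = 0"
    using indep_K[of "\<lambda>i. coord x i + - c i" i] i by blast
  then show ?thesis
    by simp
qed

lemma coord_add: "x \<in> L \<Longrightarrow> y \<in> L \<Longrightarrow> i < m \<Longrightarrow> coord (x + y) i = coord x i + coord y i"
  by (rule coord_unique) (simp_all add: K_add coord distrib_right sum.distrib)

lemma coord_scale: "k \<in> K \<Longrightarrow> x \<in> L \<Longrightarrow> i < m \<Longrightarrow> coord (k * x) i = k * coord x i"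
  by (rule coord_unique) (auto simp: K_mult coord mult.assoc simp flip: sum_distrib_left)

lemma coord_0: "i < m \<Longrightarrow> coord 0 i = 0"
  by (rule coord_unique) (auto simp: R_K R_0)

lemma coord_sum:
  "(\<And>j. j \<in> A \<Longrightarrow> k j \<in> K \<and> x j \<in> L) \<Longrightarrow> i < m \<Longrightarrow>
    coord (\<Sum>j\<in>A. k j * x j) i = (\<Sum>j\<in>A. k j * coord (x j) i)"
  by (induction A rule: infinite_finite_induct)
     (auto simp: coord_0 coord_add coord_scale L_sum L_mult K_L)

lemma coord_theta: "j < m \<Longrightarrow> i < m \<Longrightarrow> coord (\<theta> ^ j) i = (if i = j then 1 else 0)"
  by (rule coord_unique) (auto simp: R_K R_0 R_1 if_distrib[of "\<lambda>x. x * _"] cong: if_cong)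

lemma S_iff: "x \<in> L \<Longrightarrow> x \<in> S \<longleftrightarrow> (\<forall>i<m. coord x i \<in> R)"
proof
  assume "x \<in> S"
  then obtain r where r: "\<forall>i<m. r i \<in> R" "x = (\<Sum>i<m. r i * \<theta> ^ i)"
    by (rule S_E) blast
  then show "\<forall>i<m. coord x i \<in> R"
    using coord_unique[of r x] by (auto simp: R_K)
next
  assume "x \<in> L" "\<forall>i<m. coord x i \<in> R"
  then show "x \<in> S"
    using S_I[of "coord x"] by (simp add: coord)
qed

text \<open>Euler's dual basis: with $F(T) = \sum_{l \le m} f_l T^l$ the minimal polynomial of \<open>\<theta>\<close>, the
  \<open>dual j\<close> are the coefficients of \<open>F(T) / (T - \<theta>)\<close>. They are dual to the powers of \<open>\<theta>\<close> for the
  form $(x, y) \mapsto \tau(xy)$, where \<open>\<tau>\<close> is the coordinate at $\theta^{m-1}$.\<close>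

definition f :: "nat \<Rightarrow> 'f" where "f l = (if l = m then 1 else - a l)"

definition dual :: "nat \<Rightarrow> 'f" where "dual i = (\<Sum>l\<in>{i<..m}. f l * \<theta> ^ (l - 1 - i))"

text \<open>The value at \<theta> of the derivative of the minimal polynomial. The truncated
  exponent at l = 0 is harmless, since that term has the factor 0.\<close>

definition F' :: 'f where "F' = (\<Sum>l\<le>m. of_nat l * f l * \<theta> ^ (l - 1))"

abbreviation \<tau> :: "'f \<Rightarrow> 'f" where "\<tau> x \<equiv> coord x (m - Suc 0)"

lemma f_R: "l \<le> m \<Longrightarrow> f l \<in> R"
  by (auto simp: f_def R_1 R_uminus a_R)

lemma f_root: "(\<Sum>l\<le>m. f l * \<theta> ^ l) = 0"
proof -
  have "(\<Sum>l\<le>m. f l * \<theta> ^ l) = (\<Sum>l<m. f l * \<theta> ^ l) + \<theta> ^ m"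
    by (simp add: f_def flip: lessThan_Suc_atMost)
  also have "(\<Sum>l<m. f l * \<theta> ^ l) = - (\<theta> ^ m)"
    unfolding min_eq by (simp add: f_def sum_negf)
  finally show ?thesis
    by simp
qed

lemma dual_S: "i < m \<Longrightarrow> dual i \<in> S"
  unfolding dual_def by (intro S_sum theta_pow_S f_R) auto

lemma dual_L: "i < m \<Longrightarrow> dual i \<in> L"
  by (intro S_L dual_S)

text \<open>F(T) / (T - \<theta>) evaluated at T = \<theta> is F'(\<theta>): the term with f_l
  occurs once for each j < l.\<close>

lemma sum_dual: "(\<Sum>j<m. dual j * \<theta> ^ j) = F'"
proof -
  have "(\<Sum>j<m. dual j * \<theta> ^ j) = (\<Sum>j<m. \<Sum>l\<in>{j<..m}. f l * \<theta> ^ (l - 1))"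
    unfolding dual_def sum_distrib_right
    by (intro sum.cong refl) (auto simp: mult.assoc simp flip: power_add)
  also have "\<dots> = (\<Sum>j<m. \<Sum>l | l \<in> {..m} \<and> j < l. f l * \<theta> ^ (l - 1))"
    by (intro sum.cong refl) auto
  also have "\<dots> = (\<Sum>l\<le>m. \<Sum>j | j \<in> {..<m} \<and> j < l. f l * \<theta> ^ (l - 1))"
    by (rule sum.swap_restrict) auto
  also have "\<dots> = (\<Sum>l\<le>m. of_nat l * f l * \<theta> ^ (l - 1))"
  proof (intro sum.cong refl)
    fix l assume "l \<in> {..m}"
    then have "{j. j \<in> {..<m} \<and> j < l} = {..<l}"
      by auto
    then show "(\<Sum>j | j \<in> {..<m} \<and> j < l. f l * \<theta> ^ (l - 1)) = of_nat l * f l * \<theta> ^ (l - 1)"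
      by simp
  qed
  finally show ?thesis
    by (simp add: F'_def)
qed

lemma F'_S: "F' \<in> S"
  unfolding sum_dual [symmetric]
  by (intro S_sum S_mult dual_S theta_S) auto

lemma tau_theta_sum:
  assumes "finite A" "\<And>l. l \<in> A \<Longrightarrow> c l \<in> R \<and> e l < m"
  shows "\<tau> (\<Sum>l\<in>A. c l * \<theta> ^ e l) = (\<Sum>l\<in>A. if e l = m - 1 then c l else 0)"
proof -
  have "\<tau> (\<Sum>l\<in>A. c l * \<theta> ^ e l) = (\<Sum>l\<in>A. c l * \<tau> (\<theta> ^ e l))"
    using assms m_pos by (intro coord_sum) (auto simp: R_K intro!: theta_L)
  then show ?thesis
    using assms m_pos by (auto simp: coord_theta intro!: sum.cong)
qed

text \<open>For j \<le> i all exponents stay below m, and m - 1 is reached only for l = m and i = j.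
  For j > i they may reach m or more, so F(\<theta>) = 0 is used to replace the upper part of F by
  its lower part, whose exponents stay below m - 1.\<close>

lemma tau_dual:
  assumes i: "i < m" and j: "j < m"
  shows "\<tau> (dual i * \<theta> ^ j) = (if i = j then 1 else 0)"
proof (cases "j \<le> i")
  case True
  have "dual i * \<theta> ^ j = (\<Sum>l\<in>{i<..m}. f l * \<theta> ^ (l - 1 - i + j))"
    unfolding dual_def sum_distrib_right
    by (intro sum.cong refl) (auto simp: mult.assoc simp flip: power_add)
  also have "\<tau> \<dots> = (\<Sum>l\<in>{i<..m}. if l - 1 - i + j = m - 1 then f l else 0)"
  proof (rule tau_theta_sum)
    fix l assume "l \<in> {i<..m}"
    then show "f l \<in> R \<and> l - 1 - i + j < m"
      using True f_R[of l] by (simp, linarith)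
  qed simp
  also have "\<dots> = (\<Sum>l\<in>{i<..m}. if l = m then if i = j then 1 else 0 else 0)"
    using True i by (intro sum.cong) (auto simp: f_def)
  finally show ?thesis
    using i by simp
next
  case False
  have "dual i * \<theta> ^ j = (\<Sum>l\<in>{i<..m}. f l * \<theta> ^ l) * \<theta> ^ (j - 1 - i)"
    unfolding dual_def sum_distrib_right using False
    by (intro sum.cong refl) (auto simp: mult.assoc simp flip: power_add)
  also have "(\<Sum>l\<in>{i<..m}. f l * \<theta> ^ l) = (\<Sum>l\<le>i. - f l * \<theta> ^ l)"
  proof -
    have "{..m} = {..i} \<union> {i<..m}" "{..i} \<inter> {i<..m} = {}"
      using i by auto
    then have "(\<Sum>l\<le>m. f l * \<theta> ^ l) = (\<Sum>l\<le>i. f l * \<theta> ^ l) + (\<Sum>l\<in>{i<..m}. f l * \<theta> ^ l)"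
      by (simp add: sum.union_disjoint)
    then show ?thesis
      unfolding f_root by (simp add: sum_negf eq_neg_iff_add_eq_0 add.commute)
  qed
  also have "\<dots> * \<theta> ^ (j - 1 - i) = (\<Sum>l\<le>i. - f l * \<theta> ^ (l + (j - 1 - i)))"
    by (simp add: sum_distrib_right mult.assoc power_add)
  finally have "\<tau> (dual i * \<theta> ^ j) = (\<Sum>l\<le>i. if l + (j - 1 - i) = m - 1 then - f l else 0)"
    using i j False f_R tau_theta_sum[of "{..i}" "\<lambda>l. - f l" "\<lambda>l. l + (j - 1 - i)"]
    by (auto simp: R_uminus)
  also have "\<dots> = 0"
    using False j by (intro sum.neutral) auto
  finally show ?thesis
    using False by simp
qed

text \<open>Duality makes every coordinate a value of the single functional \<open>\<tau>\<close>,
  so that coordinates and traces can be expressed alike.\<close>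

lemma coord_eq_tau:
  assumes z: "z \<in> L" and j: "j < m"
  shows "coord z j = \<tau> (dual j * z)"
proof -
  have "dual j * z = (\<Sum>i<m. coord z i * (dual j * \<theta> ^ i))"
    by (subst coord(2)[OF z, symmetric]) (simp add: sum_distrib_left mult_ac)
  also have "\<tau> \<dots> = (\<Sum>i<m. coord z i * \<tau> (dual j * \<theta> ^ i))"
    using z j m_pos by (intro coord_sum) (auto simp: coord intro!: L_mult dual_L theta_L)
  also have "\<dots> = (\<Sum>i<m. if i = j then coord z i else 0)"
    using j by (intro sum.cong) (auto simp: tau_dual)
  finally show ?thesis
    using j by simp
qed

section \<open>The trace and the different\<close>

lemma theta_inj: "inj_on (\<lambda>i. \<theta> ^ i) {..<m}"
proof (rule inj_onI)
  fix i j assume "i \<in> {..<m}" "j \<in> {..<m}" "\<theta> ^ i = \<theta> ^ j"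
  then show "i = j"
    using coord_theta[of i i] coord_theta[of j i] by (auto split: if_splits)
qed

lemma rel_basis_exists: "\<exists>B. rel_basis K L B"
proof (intro exI)
  let ?B = "(\<lambda>i. \<theta> ^ i) ` {..<m}"
  show "rel_basis K L ?B"
    unfolding rel_basis_def
  proof (intro conjI ballI)
    show "?B \<subseteq> L"
      by (auto intro!: theta_L)
    fix x assume x: "x \<in> L"
    show "\<exists>!c. c \<in> ?B \<rightarrow>\<^sub>E K \<and> x = (\<Sum>b\<in>?B. c b * b)"
    proof (rule ex1I)
      let ?c = "\<lambda>b\<in>?B. coord x (the_inv_into {..<m} (\<lambda>i. \<theta> ^ i) b)"
      show "?c \<in> ?B \<rightarrow>\<^sub>E K \<and> x = (\<Sum>b\<in>?B. ?c b * b)"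
        using coord[OF x] theta_inj by (auto simp: sum.reindex the_inv_into_f_f)
      fix c assume c: "c \<in> ?B \<rightarrow>\<^sub>E K \<and> x = (\<Sum>b\<in>?B. c b * b)"
      then have "coord x i = c (\<theta> ^ i)" if "i < m" for i
        using that theta_inj by (intro coord_unique) (auto simp: sum.reindex)
      then show "c = ?c"
        using c theta_inj by (intro extensionalityI[of _ ?B]) (auto simp: the_inv_into_f_f PiE_iff)
    qed
  qed auto
qed

lemma rel_coord:
  assumes B: "rel_basis K L B" and x: "x \<in> L"
  shows "rel_coord K B x \<in> B \<rightarrow>\<^sub>E K" "(\<Sum>b\<in>B. rel_coord K B x b * b) = x"
proof -
  have "\<exists>!c. c \<in> B \<rightarrow>\<^sub>E K \<and> x = (\<Sum>b\<in>B. c b * b)"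
    using B x by (auto simp: rel_basis_def)
  from theI'[OF this] show "rel_coord K B x \<in> B \<rightarrow>\<^sub>E K" "(\<Sum>b\<in>B. rel_coord K B x b * b) = x"
    unfolding rel_coord_def by auto
qed

lemma rel_coord_unique:
  assumes B: "rel_basis K L B" and c: "\<And>b. b \<in> B \<Longrightarrow> c b \<in> K" and b: "b \<in> B"
  shows "rel_coord K B (\<Sum>b\<in>B. c b * b) b = c b"
proof -
  have L: "(\<Sum>b\<in>B. c b * b) \<in> L"
  proof (rule L_sum)
    show "c b * b \<in> L" if "b \<in> B" for b
      using B c[OF that] that by (intro L_mult) (auto simp: rel_basis_def K_L)
  qed
  then have "\<exists>!c'. c' \<in> B \<rightarrow>\<^sub>E K \<and> (\<Sum>b\<in>B. c b * b) = (\<Sum>b\<in>B. c' b * b)"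
    using B unfolding rel_basis_def by blast
  moreover have "restrict c B \<in> B \<rightarrow>\<^sub>E K \<and> (\<Sum>b\<in>B. c b * b) = (\<Sum>b\<in>B. restrict c B b * b)"
    using c by auto
  moreover have "rel_coord K B (\<Sum>b\<in>B. c b * b) \<in> B \<rightarrow>\<^sub>E K \<and>
      (\<Sum>b\<in>B. c b * b) = (\<Sum>b\<in>B. rel_coord K B (\<Sum>b\<in>B. c b * b) b * b)"
    using rel_coord[OF B L] by simp
  ultimately have "rel_coord K B (\<Sum>b\<in>B. c b * b) = restrict c B"
    by blast
  then show ?thesis
    using b by simp
qed

text \<open>Euler's formula. Expanding x b in powers of \<theta> and writing its coordinates as
  \<open>\<tau> (dual j * x * b)\<close>, the sum over the unknown basis reassembles \<theta>^j;
  what remains is \<open>\<tau>\<close> of x times the sum of \<open>dual j * \<theta> ^ j\<close>,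
  which is \<open>F'\<close>.\<close>

lemma trace_eq_tau:
  assumes x: "x \<in> L"
  shows "field_trace K L x = \<tau> (x * F')"
proof -
  define B where "B = (SOME B. rel_basis K L B)"
  have B: "rel_basis K L B"
    unfolding B_def using rel_basis_exists by (rule someI_ex)
  then have BL: "b \<in> L" if "b \<in> B" for b
    using that by (auto simp: rel_basis_def)
  have th: "\<theta> ^ j \<in> L" if "j < m" for j
    using that by (rule theta_L)
  have rc: "rel_coord K B z b \<in> K" if "z \<in> L" "b \<in> B" for z b
    using rel_coord(1)[OF B that(1)] that(2) by auto
  have "rel_coord K B (x * b) b = (\<Sum>j<m. coord (x * b) j * rel_coord K B (\<theta> ^ j) b)"
    if b: "b \<in> B" for b
  proof -
    have xb: "x * b \<in> L"
      using x BL[OF b] by (rule L_mult)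
    have "x * b = (\<Sum>j<m. coord (x * b) j * \<theta> ^ j)"
      using coord(2)[OF xb] by simp
    also have "\<dots> = (\<Sum>j<m. coord (x * b) j * (\<Sum>b'\<in>B. rel_coord K B (\<theta> ^ j) b' * b'))"
      by (intro sum.cong refl) (simp add: rel_coord(2)[OF B] th)
    also have "\<dots> = (\<Sum>b'\<in>B. (\<Sum>j<m. coord (x * b) j * rel_coord K B (\<theta> ^ j) b') * b')"
      unfolding sum_distrib_left sum_distrib_right by (subst sum.swap) (simp add: mult.assoc)
    finally have eq: "x * b = (\<Sum>b'\<in>B. (\<Sum>j<m. coord (x * b) j * rel_coord K B (\<theta> ^ j) b') * b')" .
    have "(\<Sum>j<m. coord (x * b) j * rel_coord K B (\<theta> ^ j) b') \<in> K" if "b' \<in> B" for b'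
      using that coord(1)[OF xb] rc th by (intro K_sum K_mult) auto
    then show ?thesis
      using b by (subst eq) (rule rel_coord_unique[OF B])
  qed
  then have "field_trace K L x = (\<Sum>b\<in>B. \<Sum>j<m. coord (x * b) j * rel_coord K B (\<theta> ^ j) b)"
    by (simp add: field_trace_def Let_def flip: B_def)
  also have "\<dots> = (\<Sum>j<m. \<Sum>b\<in>B. rel_coord K B (\<theta> ^ j) b * \<tau> (dual j * x * b))"
  proof (subst sum.swap, intro sum.cong refl)
    fix j b assume "j \<in> {..<m}" "b \<in> B"
    then have "coord (x * b) j = \<tau> (dual j * x * b)"
      using coord_eq_tau[OF L_mult[OF x BL]] by (simp add: mult.assoc)
    then show "coord (x * b) j * rel_coord K B (\<theta> ^ j) b = rel_coord K B (\<theta> ^ j) b * \<tau> (dual j * x * b)"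
      by simp
  qed
  also have "\<dots> = (\<Sum>j<m. \<tau> (dual j * x * \<theta> ^ j))"
  proof (intro sum.cong refl)
    fix j assume j: "j \<in> {..<m}"
    have "(\<Sum>b\<in>B. rel_coord K B (\<theta> ^ j) b * \<tau> (dual j * x * b))
        = \<tau> (\<Sum>b\<in>B. rel_coord K B (\<theta> ^ j) b * (dual j * x * b))"
      using j m_pos x by (intro coord_sum [symmetric]) (auto simp: rc th BL intro!: L_mult dual_L)
    also have "(\<Sum>b\<in>B. rel_coord K B (\<theta> ^ j) b * (dual j * x * b))
        = dual j * x * (\<Sum>b\<in>B. rel_coord K B (\<theta> ^ j) b * b)"
      by (simp add: sum_distrib_left mult_ac)
    finally show "(\<Sum>b\<in>B. rel_coord K B (\<theta> ^ j) b * \<tau> (dual j * x * b)) = \<tau> (dual j * x * \<theta> ^ j)"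
      using j by (simp add: rel_coord(2)[OF B th])
  qed
  also have "\<dots> = \<tau> (\<Sum>j<m. 1 * (dual j * x * \<theta> ^ j))"
    using m_pos x by (subst coord_sum) (auto simp: R_K R_1 th intro!: L_mult dual_L)
  also have "(\<Sum>j<m. 1 * (dual j * x * \<theta> ^ j)) = x * F'"
    unfolding sum_dual [symmetric] by (simp add: sum_distrib_left mult_ac)
  finally show ?thesis .
qed

text \<open>The coordinates of x F' are exactly the traces of x against the dual elements, which lie
  in S; so integral traces amount to x F' being in S.\<close>

lemma codifferent_eq:
  assumes "F' \<noteq> 0"
  shows "codifferent R S = {x \<in> L. x * F' \<in> S}"
proof (intro equalityI subsetI CollectI conjI)
  fix x assume "x \<in> codifferent R S"
  then have x: "x \<in> L" and tr: "\<And>s. s \<in> S \<Longrightarrow> field_trace K L (x * s) \<in> R"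
    by (auto simp: codifferent_def)
  show "x \<in> L" by fact
  have xF: "x * F' \<in> L"
    by (rule L_mult[OF x S_L[OF F'_S]])
  have "coord (x * F') j \<in> R" if j: "j < m" for j
  proof -
    have "coord (x * F') j = \<tau> (x * dual j * F')"
      by (simp add: coord_eq_tau[OF xF j] mult_ac)
    also have "\<dots> = field_trace K L (x * dual j)"
      using x j by (subst trace_eq_tau) (auto intro!: L_mult dual_L)
    also have "\<dots> \<in> R"
      using j by (intro tr dual_S)
    finally show ?thesis .
  qed
  then show "x * F' \<in> S"
    using S_iff[OF xF] by blast
next
  fix x assume "x \<in> {x \<in> L. x * F' \<in> S}"
  then have x: "x \<in> L" "x * F' \<in> S"
    by auto
  have "field_trace K L (x * s) \<in> R" if s: "s \<in> S" for s
  proof -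
    have "field_trace K L (x * s) = \<tau> (x * F' * s)"
      using trace_eq_tau[OF L_mult[OF x(1) S_L[OF s]]] by (simp add: mult_ac)
    moreover have "x * F' * s \<in> S"
      by (rule S_mult[OF x(2) s])
    ultimately show ?thesis
      using S_iff[OF S_L] m_pos by auto
  qed
  then show "x \<in> codifferent R S"
    using x by (auto simp: codifferent_def)
qed

theorem different_eq:
  assumes F': "F' \<noteq> 0"
  shows "different R S = (\<lambda>s. F' * s) ` S"
proof (intro equalityI subsetI)
  fix x assume "x \<in> different R S"
  then have x: "\<And>z. z \<in> codifferent R S \<Longrightarrow> x * z \<in> S"
    by (auto simp: different_def)
  \<comment> \<open>Testing against 1 / F', which lies in the codifferent, already forces x into F'
    S.\<close>
  have "x * (1 / F') \<in> S"
    using F' L_inverse[OF F'_S F'] R_S[OF R_1] by (intro x) (simp add: codifferent_eq)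
  then show "x \<in> (\<lambda>s. F' * s) ` S"
    using F' by (intro image_eqI[of _ _ "x * (1 / F')"]) auto
next
  fix x assume "x \<in> (\<lambda>s. F' * s) ` S"
  then obtain s where s: "s \<in> S" "x = F' * s"
    by auto
  have "x * z \<in> S" if "z \<in> codifferent R S" for z
    using that s S_mult[of s "z * F'"] F' by (simp add: codifferent_eq mult_ac)
  moreover have "x \<in> L"
    using s F'_S by (simp add: S_L S_mult)
  ultimately show "x \<in> different R S"
    by (simp add: different_def)
qed

end

section \<open>The different of k[[y]] over k[[g(y)]]\<close>

lemma fps_to_fls_sum: "fps_to_fls (sum f A) = (\<Sum>x\<in>A. fps_to_fls (f x))"
  by (induction A rule: infinite_finite_induct) auto

text \<open>The generator is \<theta> = y, and its equation comes from expanding t^m in base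
  \<open>g\<close>, with m the order of \<open>g\<close>. Differentiating t^m = \<Sum> a_i(g) t^i
  gives F'(t) = g' W with a unit W, so F'(y) and g'(y) generate the same ideal.\<close>

theorem fps_different_eq:
  fixes y g :: "'k::field fps"
  assumes y: "y $ 0 = 0" "y \<noteq> 0" and g: "g $ 0 = 0" "g \<noteq> 0" and g': "fps_deriv g \<noteq> 0"
  shows "fps_different (range (\<lambda>u. u oo (g oo y))) (range (\<lambda>u. u oo y))
       = range (\<lambda>u. (fps_deriv g oo y) * (u oo y))"
proof -
  define m where "m = subdegree g"
  have m: "0 < m"
    using g by (metis m_def bot_nat_0.not_eq_extremum subdegree_eq_0_iff)
  note [simp] = fps_compose_add_distrib fps_compose_sub_distrib fps_compose_uminus fps_compose_sum_distrib
    fps_compose_mult_distrib[OF y(1)] fps_compose_mult_distrib[OF g(1)]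
    fps_X_power_compose[OF y(1)] fps_X_power_compose[OF g(1)]
  have assoc: "(u oo g) oo y = u oo (g oo y)" for u
    using y g by (simp add: fps_compose_assoc)
  have gy: "(g oo y) $ 0 = 0" "g oo y \<noteq> 0"
    using y g by (auto simp: fps_compose_eq_0_iff)
  obtain a where a: "fps_X ^ m = (\<Sum>i<m. (a i oo g) * fps_X ^ i)"
    using fps_expansion[OF g] unfolding m_def by blast
  have a0: "a i $ 0 = 0" if "i < m" for i
  proof -
    have "fps_X ^ m $ i = a i $ 0"
      unfolding a using fps_expansion_nth[OF g(1), of i a] that by (simp add: m_def)
    then show ?thesis
      using that by simp
  qed
  define W where "W = (\<Sum>i<m. (fps_deriv (a i) oo g) * fps_X ^ i)"
  have W0: "W $ 0 \<noteq> 0"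
  proof -
    have W0: "W $ 0 = a 0 $ 1"
      using fps_expansion_nth[OF g(1), of 0 "\<lambda>i. fps_deriv (a i)"] m unfolding W_def m_def by simp
    \<comment> \<open>Since no \<open>a i\<close> has a constant term, t^m = g V; as
      \<open>g\<close> has order exactly m, V is a unit, and its constant term is the linear
      coefficient of \<open>a 0\<close>, the same as that of W.\<close>
    define V where "V = (\<Sum>i<m. (fps_shift 1 (a i) oo g) * fps_X ^ i)"
    have "a i oo g = g * (fps_shift 1 (a i) oo g)" if "i < m" for i
      using fps_compose_decompose[OF g(1), of "a i"] a0[OF that] by simp
    then have gV: "fps_X ^ m = g * V"
      unfolding a V_def by (simp add: sum_distrib_left mult.assoc)
    then have "V \<noteq> 0"
      by auto
    then have "m = m + subdegree V"
      using arg_cong[OF gV, of subdegree] g(2) by (simp add: m_def)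
    then have "V $ 0 \<noteq> 0"
      using \<open>V \<noteq> 0\<close> by (metis add_cancel_right_right nth_subdegree_nonzero)
    moreover have "V $ 0 = a 0 $ 1"
      using fps_expansion_nth[OF g(1), of 0 "\<lambda>i. fps_shift 1 (a i)"] m unfolding V_def m_def by simp
    ultimately show ?thesis
      using W0 by simp
  qed
  let ?R = "fps_to_fls ` range (\<lambda>u. u oo (g oo y))" and ?S = "fps_to_fls ` range (\<lambda>u. u oo y)"
  let ?a = "\<lambda>i. fps_to_fls (a i oo (g oo y))"
  have R: "x \<in> ?R \<longleftrightarrow> (\<exists>u. x = fps_to_fls ((u oo g) oo y))"
    and S: "x \<in> ?S \<longleftrightarrow> (\<exists>u. x = fps_to_fls (u oo y))" for x
    by (auto simp: assoc)
  have sum_eq: "(\<Sum>i<m. fps_to_fls ((r i oo g) oo y) * fps_to_fls y ^ i)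
     = fps_to_fls ((\<Sum>i<m. (r i oo g) * fps_X ^ i) oo y)" for r
    using y by (simp add: fps_to_fls_sum fps_to_fls_power fls_times_fps_to_fls)
  have lift: "\<exists>r'. \<forall>i<m. r i = fps_to_fls ((r' i oo g) oo y)" if "\<forall>i<m. r i \<in> ?R" for r
    using that unfolding R by metis
  interpret monogenic ?R ?S "fps_to_fls y" ?a m
  proof unfold_locales
    show "0 \<in> ?R"
      unfolding R by (intro exI[of _ 0]) simp
    show "1 \<in> ?R"
      unfolding R by (intro exI[of _ 1]) simp
    show "x + z \<in> ?R" if "x \<in> ?R" "z \<in> ?R" for x z
      using that unfolding R by (metis fps_to_fls_plus fps_compose_add_distrib)
    show "x * z \<in> ?R" if "x \<in> ?R" "z \<in> ?R" for x z
      using that unfolding R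
      by (metis fls_times_fps_to_fls fps_compose_mult_distrib[OF y(1)] fps_compose_mult_distrib[OF g(1)])
    show "x * z \<in> ?S" if "x \<in> ?S" "z \<in> ?S" for x z
      using that unfolding S by (metis fls_times_fps_to_fls fps_compose_mult_distrib[OF y(1)])
    show "- x \<in> ?R" if "x \<in> ?R" for x
      using that unfolding R by (metis fps_to_fls_uminus fps_compose_uminus)
    show "?S = {\<Sum>i<m. r i * fps_to_fls y ^ i |r. \<forall>i<m. r i \<in> ?R}"
    proof (intro equalityI subsetI)
      fix x assume "x \<in> ?S"
      then obtain u where u: "x = fps_to_fls (u oo y)"
        unfolding S by blast
      obtain r where r: "u = (\<Sum>i<m. (r i oo g) * fps_X ^ i)"
        using fps_expansion[OF g, of u] unfolding m_def by blast
      have "x = (\<Sum>i<m. fps_to_fls ((r i oo g) oo y) * fps_to_fls y ^ i)"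
        unfolding sum_eq u r ..
      then show "x \<in> {\<Sum>i<m. r i * fps_to_fls y ^ i |r. \<forall>i<m. r i \<in> ?R}"
        unfolding R by (intro CollectI exI[of _ "\<lambda>i. fps_to_fls ((r i oo g) oo y)"]) auto
    next
      fix x assume "x \<in> {\<Sum>i<m. r i * fps_to_fls y ^ i |r. \<forall>i<m. r i \<in> ?R}"
      then obtain r where r: "\<And>i. i < m \<Longrightarrow> r i \<in> ?R" "x = (\<Sum>i<m. r i * fps_to_fls y ^ i)"
        by blast
      obtain r' where r': "\<forall>i<m. r i = fps_to_fls ((r' i oo g) oo y)"
        using lift[of r] r(1) by blast
      then have "x = fps_to_fls ((\<Sum>i<m. (r' i oo g) * fps_X ^ i) oo y)"
        unfolding r(2) sum_eq [symmetric] by simp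
      then show "x \<in> ?S"
        unfolding S by blast
    qed
    show "r i = 0"
      if r: "\<And>i. i < m \<Longrightarrow> r i \<in> ?R" and sum: "(\<Sum>i<m. r i * fps_to_fls y ^ i) = 0" and i: "i < m"
      for r i
    proof -
      obtain r' where r': "\<forall>i<m. r i = fps_to_fls ((r' i oo g) oo y)"
        using lift[of r] r by blast
      then have "fps_to_fls ((\<Sum>i<m. (r' i oo g) * fps_X ^ i) oo y) = 0"
        unfolding sum_eq [symmetric] using sum by simp
      then have "(\<Sum>i<m. (r' i oo g) * fps_X ^ i) = 0"
        using y by (simp only: fps_to_fls_eq_0_iff fps_compose_eq_0_iff) simp
      then have "r' i = 0"
        using fps_expansion_unique[OF g] i unfolding m_def by blast
      then show "r i = 0"
        using r' i by simp
    qed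
    show "?a i \<in> ?R" for i
      by blast
    show "fps_to_fls y ^ m = (\<Sum>i<m. ?a i * fps_to_fls y ^ i)"
      using sum_eq[of a] y by (simp add: assoc fps_to_fls_power flip: a)
    show "\<exists>s'\<in>?S. s * s' \<in> ?R \<and> s * s' \<noteq> 0" if s: "s \<in> ?S" "s \<noteq> 0" for s
    proof -
      obtain u where u: "s = fps_to_fls (u oo y)"
        using s(1) unfolding S by blast
      have "u \<noteq> 0"
        using s(2) u by auto
      define v where "v = subdegree u"
      \<comment> \<open>\<open>g\<close> has positive order, so g^v vanishes at least to the order v
        of \<open>u\<close>; this power gives a multiple of \<open>s\<close> inside the base
        ring.\<close>
      have "u dvd g ^ v"
        using \<open>u \<noteq> 0\<close> g m by (simp add: fps_dvd_iff v_def m_def)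
      then obtain w where w: "g ^ v = u * w"
        by (auto simp: dvd_def)
      have "s * fps_to_fls (w oo y) = fps_to_fls (g ^ v oo y)"
        unfolding u w by (simp add: fls_times_fps_to_fls)
      also have "g ^ v = fps_X ^ v oo g"
        using g by (simp add: fps_X_power_compose)
      finally have eq: "s * fps_to_fls (w oo y) = fps_to_fls ((fps_X ^ v oo g) oo y)" .
      have "fps_to_fls ((fps_X ^ v oo g) oo y) \<in> ?R"
        unfolding R by blast
      moreover have "fps_to_fls ((fps_X ^ v oo g) oo y) \<noteq> 0"
        using y g by (simp add: fps_compose_eq_0_iff)
      moreover have "fps_to_fls (w oo y) \<in> ?S"
        by blast
      ultimately show ?thesis
        unfolding eq [symmetric] by blast
    qed
  qed (use m in auto)
  have F'_eq: "F' = fps_to_fls ((fps_deriv g oo y) * (W oo y))"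
  proof -
    \<comment> \<open>The terms in which t^i is differentiated belong to F'(t); those in which
      a_i(g) is differentiated collect to g' W.\<close>
    have "fps_deriv (fps_X ^ m) = fps_deriv (\<Sum>i<m. (a i oo g) * fps_X ^ i)"
      by (simp only: a)
    then have "of_nat m * fps_X ^ (m - 1) = (\<Sum>i<m. fps_deriv (a i oo g) * fps_X ^ i
        + (a i oo g) * (of_nat i * fps_X ^ (i - 1)))"
      by (simp add: fps_deriv_power fps_deriv_sum fps_of_nat mult_ac add.commute)
    also have "\<dots> = fps_deriv g * W + (\<Sum>i<m. of_nat i * (a i oo g) * fps_X ^ (i - 1))"
      by (simp add: fps_compose_deriv[OF g(1)] W_def sum.distrib sum_distrib_left mult_ac)
    finally have "fps_deriv g * W = (\<Sum>l<m. of_nat l * - (a l oo g) * fps_X ^ (l - 1))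
        + of_nat m * fps_X ^ (m - 1)"
      by (simp add: sum_negf)
    then have "(fps_deriv g oo y) * (W oo y) =
       ((\<Sum>l<m. of_nat l * - (a l oo g) * fps_X ^ (l - 1)) + of_nat m * fps_X ^ (m - 1)) oo y"
      by (metis fps_compose_mult_distrib[OF y(1)])
    also have "\<dots> = (\<Sum>l<m. of_nat l * - ((a l oo g) oo y) * y ^ (l - 1)) + of_nat m * y ^ (m - 1)"
      using y by (simp flip: fps_of_nat)
    finally show ?thesis
      by (simp add: F'_def f_def assoc fps_to_fls_sum fps_to_fls_power fls_times_fps_to_fls
            flip: lessThan_Suc_atMost)
  qed
  have Wy: "W oo y \<noteq> 0" "(W oo y) * (inverse W oo y) = 1"
    using W0 y inverse_mult_eq_1'[OF W0]
    by (auto simp: fps_compose_eq_0_iff simp flip: fps_compose_mult_distrib[OF y(1)])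
  have "F' \<noteq> 0"
    unfolding F'_eq using g' y Wy by (simp add: fps_compose_eq_0_iff)
  then have D: "different ?R ?S = (\<lambda>s. F' * s) ` ?S"
    by (rule different_eq)
  show ?thesis
    unfolding fps_different_def D
  proof (intro equalityI subsetI)
    fix x assume "x \<in> {x. fps_to_fls x \<in> (\<lambda>s. F' * s) ` ?S}"
    then obtain u where "fps_to_fls x = F' * fps_to_fls (u oo y)"
      by auto
    then have "x = (fps_deriv g oo y) * (W * u oo y)"
      by (simp add: F'_eq mult.assoc flip: fls_times_fps_to_fls)
    then show "x \<in> range (\<lambda>u. (fps_deriv g oo y) * (u oo y))"
      by blast
  next
    fix x assume "x \<in> range (\<lambda>u. (fps_deriv g oo y) * (u oo y))"
    then obtain u where x: "x = (fps_deriv g oo y) * (u oo y)"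
      by auto
    have "x = (fps_deriv g oo y) * (W oo y) * ((inverse W * u) oo y)"
      using Wy(2) by (simp add: x algebra_simps)
    then have "fps_to_fls x = F' * fps_to_fls ((inverse W * u) oo y)"
      by (simp add: F'_eq fls_times_fps_to_fls)
    then show "x \<in> {x. fps_to_fls x \<in> (\<lambda>s. F' * s) ` ?S}"
      by blast
  qed
qed

section \<open>Derivations of a ring with a group action\<close>

text \<open>Serves both G on k[[t]], with \<open>R = UNIV\<close>, and G/N on k[[t]]^N. The axioms
  are restricted to \<open>R\<close> because the induced action is a \<open>restrict\<close> and
  carries no information outside.\<close>

locale ring_action = group H for H :: "('h, 'b) monoid_scheme" (structure) +
  fixes R :: "'k::field fps set" and \<rho> :: "'h \<Rightarrow> 'k fps \<Rightarrow> 'k fps"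
  assumes R_add: "x \<in> R \<Longrightarrow> y \<in> R \<Longrightarrow> x + y \<in> R"
    and R_mult: "x \<in> R \<Longrightarrow> y \<in> R \<Longrightarrow> x * y \<in> R"
    and R_const: "fps_const a \<in> R"
    and r_closed: "h \<in> carrier H \<Longrightarrow> x \<in> R \<Longrightarrow> \<rho> h x \<in> R"
    and r_add: "h \<in> carrier H \<Longrightarrow> x \<in> R \<Longrightarrow> y \<in> R \<Longrightarrow> \<rho> h (x + y) = \<rho> h x + \<rho> h y"
    and r_mult: "h \<in> carrier H \<Longrightarrow> x \<in> R \<Longrightarrow> y \<in> R \<Longrightarrow> \<rho> h (x * y) = \<rho> h x * \<rho> h y"
    and r_const: "h \<in> carrier H \<Longrightarrow> \<rho> h (fps_const a) = fps_const a"
    and r_act: "h \<in> carrier H \<Longrightarrow> h' \<in> carrier H \<Longrightarrow> x \<in> R \<Longrightarrow> \<rho> (h \<otimes> h') x = \<rho> h (\<rho> h' x)"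
    and r_one: "x \<in> R \<Longrightarrow> \<rho> \<one> x = x"
begin

lemma R_uminus: "x \<in> R \<Longrightarrow> - x \<in> R"
  using R_mult[OF R_const[of "- 1"], of x] by (simp flip: fps_const_neg)

lemma R_0: "0 \<in> R"
  using R_const[of 0] by simp

lemma r_inv: "h \<in> carrier H \<Longrightarrow> x \<in> R \<Longrightarrow> \<rho> (inv h) (\<rho> h x) = x"
  "h \<in> carrier H \<Longrightarrow> x \<in> R \<Longrightarrow> \<rho> h (\<rho> (inv h) x) = x"
  by (simp_all add: r_one flip: r_act)

lemma r_inv_into: "h \<in> carrier H \<Longrightarrow> x \<in> R \<Longrightarrow> inv_into R (\<rho> h) x = \<rho> (inv h) x"
  by (rule inv_into_f_eq) (auto intro!: inj_onI simp: r_closed r_inv, metis r_inv(1))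

text \<open>With the Leibniz rule, k-linearity amounts to vanishing on constants, which is the
  easier condition to check and to transport.\<close>

lemma Der_iff: "d \<in> carrier (Der R) \<longleftrightarrow> d \<in> extensional R \<and> (\<forall>x\<in>R. d x \<in> R) \<and>
    (\<forall>x\<in>R. \<forall>y\<in>R. d (x + y) = d x + d y) \<and> (\<forall>x\<in>R. \<forall>y\<in>R. d (x * y) = d x * y + x * d y) \<and>
    (\<forall>a. d (fps_const a) = 0)" (is "_ \<longleftrightarrow> ?P")
proof
  assume ?P
  then show "d \<in> carrier (Der R)"
    by (auto simp: Der_def PiE_def R_const)
next
  assume "d \<in> carrier (Der R)"
  then have d: "d \<in> extensional R" "\<forall>x\<in>R. d x \<in> R" "\<forall>x\<in>R. \<forall>y\<in>R. d (x + y) = d x + d y"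
    "\<forall>x\<in>R. \<forall>y\<in>R. d (x * y) = d x * y + x * d y"
    "\<forall>a. \<forall>x\<in>R. d (fps_const a * x) = fps_const a * d x"
    by (auto simp: Der_def PiE_def)
  have R1: "1 \<in> R"
    using R_const[of 1] by simp
  have "d (1 * 1) = d 1 * 1 + 1 * d 1"
    using d(4) R1 by blast
  then have "d 1 + 0 = d 1 + d 1"
    by (simp only: mult_1_right mult_1_left add_0_right)
  then have "d 1 = 0"
    by (metis add_left_imp_eq)
  moreover have "d (fps_const a * 1) = fps_const a * d 1" for a
    using d(5) R1 by blast
  ultimately show ?P
    using d by simp
qed

lemma Der_mult: "d \<otimes>\<^bsub>Der R\<^esub> e = (\<lambda>x\<in>R. d x + e x)" and Der_one: "\<one>\<^bsub>Der R\<^esub> = (\<lambda>x\<in>R. 0)"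
  by (simp_all add: Der_def)

lemma Der_one_apply: "x \<in> R \<Longrightarrow> \<one>\<^bsub>Der R\<^esub> x = 0"
  by (simp add: Der_one)

lemma Der_mult_apply: "x \<in> R \<Longrightarrow> (d \<otimes>\<^bsub>Der R\<^esub> e) x = d x + e x"
  by (simp add: Der_mult)

lemma Der_closed: "d \<in> carrier (Der R) \<Longrightarrow> x \<in> R \<Longrightarrow> d x \<in> R"
  by (simp add: Der_iff)

lemma Der_uminus: "d \<in> carrier (Der R) \<Longrightarrow> (\<lambda>x\<in>R. - d x) \<in> carrier (Der R)"
  by (simp add: Der_iff R_add R_mult R_const R_uminus)

lemma Der_eqI:
  "d \<in> carrier (Der R) \<Longrightarrow> e \<in> carrier (Der R) \<Longrightarrow> (\<And>x. x \<in> R \<Longrightarrow> d x = e x) \<Longrightarrow> d = e"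
  by (rule extensionalityI[of _ R]) (auto simp: Der_iff)

lemma Der_add: "d \<in> carrier (Der R) \<Longrightarrow> e \<in> carrier (Der R) \<Longrightarrow> d \<otimes>\<^bsub>Der R\<^esub> e \<in> carrier (Der R)"
  by (simp add: Der_iff Der_mult R_add R_mult R_const algebra_simps)

lemma comm_group_Der: "comm_group (Der R)"
proof (rule comm_groupI)
  show "\<one>\<^bsub>Der R\<^esub> \<in> carrier (Der R)"
    by (simp add: Der_iff Der_one R_0 R_add R_mult R_const)
next
  fix d assume d: "d \<in> carrier (Der R)"
  then show "\<exists>e\<in>carrier (Der R). e \<otimes>\<^bsub>Der R\<^esub> d = \<one>\<^bsub>Der R\<^esub>"
    by (intro bexI[OF _ Der_uminus[OF d]]) (auto simp: Der_mult Der_one)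
next
  fix d assume d: "d \<in> carrier (Der R)"
  then show "\<one>\<^bsub>Der R\<^esub> \<otimes>\<^bsub>Der R\<^esub> d = d"
    using d by (auto simp: Der_iff Der_mult Der_one extensional_def)
next
  fix d e assume "d \<in> carrier (Der R)" "e \<in> carrier (Der R)"
  then show "d \<otimes>\<^bsub>Der R\<^esub> e \<in> carrier (Der R)"
    by (rule Der_add)
qed (auto simp: Der_mult add_ac)

sublocale Der: comm_group "Der R"
  by (rule comm_group_Der)

lemma Der_inv: "d \<in> carrier (Der R) \<Longrightarrow> inv\<^bsub>Der R\<^esub> d = (\<lambda>x\<in>R. - d x)"
  by (rule Der.inv_equality) (auto simp: Der_mult Der_one Der_uminus)

lemma Der_act_apply: "h \<in> carrier H \<Longrightarrow> x \<in> R \<Longrightarrow> Der_act R \<rho> h d x = \<rho> h (d (\<rho> (inv h) x))"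
  by (simp add: Der_act_def r_inv_into)

lemma Der_act_closed:
  assumes h: "h \<in> carrier H" and d: "d \<in> carrier (Der R)"
  shows "Der_act R \<rho> h d \<in> carrier (Der R)"
proof -
  have ih: "inv h \<in> carrier H"
    using h by simp
  have "Der_act R \<rho> h d \<in> extensional R"
    by (simp add: Der_act_def)
  then show ?thesis
    using h ih d unfolding Der_iff
    using r_const[OF h, of 0]
    by (simp add: Der_act_apply r_closed r_add r_mult r_const r_inv R_add R_mult R_const)
qed

lemma gmodule_Der: "gmodule H (Der R) (Der_act R \<rho>)"
proof unfold_locales
  fix h d e assume h: "h \<in> carrier H" and d: "d \<in> carrier (Der R)"
  show "Der_act R \<rho> h d \<in> carrier (Der R)"
    using h d by (rule Der_act_closed)
  assume e: "e \<in> carrier (Der R)"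
  show "Der_act R \<rho> h (d \<otimes>\<^bsub>Der R\<^esub> e) = Der_act R \<rho> h d \<otimes>\<^bsub>Der R\<^esub> Der_act R \<rho> h e"
    using h d e
    by (intro Der_eqI)
       (auto simp: Der_add Der_act_closed Der_mult_apply Der_act_apply r_closed r_add Der_closed)
next
  fix h h' d assume "h \<in> carrier H" "h' \<in> carrier H" "d \<in> carrier (Der R)"
  then show "Der_act R \<rho> (h \<otimes> h') d = Der_act R \<rho> h (Der_act R \<rho> h' d)"
    by (intro Der_eqI)
       (auto simp: Der_act_closed Der_act_apply r_closed r_act Der_closed inv_mult_group)
next
  fix d assume "d \<in> carrier (Der R)"
  then show "Der_act R \<rho> \<one> d = d"
    by (intro Der_eqI) (auto simp: Der_act_closed Der_act_apply r_one Der_closed)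
qed

sublocale Der: gmodule H "Der R" "Der_act R \<rho>"
  by (rule gmodule_Der)

end

section \<open>Power series over the dual numbers\<close>

lemma dual_number_simps [simp]:
  "std_part (x + y) = std_part x + std_part y" "eps_part (x + y) = eps_part x + eps_part y"
  "std_part (x * y) = std_part x * std_part y"
  "eps_part (x * y) = std_part x * eps_part y + eps_part x * std_part y"
  "std_part 0 = 0" "eps_part 0 = 0" "std_part 1 = 1" "eps_part 1 = 0"
  for x y :: "'a::comm_ring_1 dual_number"
  by (simp_all add: plus_dual_number_def times_dual_number_def zero_dual_number_def one_dual_number_def)

lemma dual_number_eqI: "std_part x = std_part y \<Longrightarrow> eps_part x = eps_part y \<Longrightarrow> x = y"
  by (cases x; cases y) simp

lemma dual_number_sum:
  "std_part (sum f A) = (\<Sum>x\<in>A. std_part (f x))" "eps_part (sum f A) = (\<Sum>x\<in>A. eps_part (f x))"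
  for f :: "_ \<Rightarrow> 'a::comm_ring_1 dual_number"
  by (induction A rule: infinite_finite_induct) simp_all

abbreviation re :: "'a::comm_ring_1 dual_number fps \<Rightarrow> 'a fps" where "re \<equiv> fps_reduce std_part"
abbreviation ep :: "'a::comm_ring_1 dual_number fps \<Rightarrow> 'a fps" where "ep \<equiv> fps_reduce eps_part"

definition dual_fps :: "'a::comm_ring_1 fps \<Rightarrow> 'a fps \<Rightarrow> 'a dual_number fps" where
  "dual_fps a b = Abs_fps (\<lambda>n. Dual (a $ n) (b $ n))"

lemma fps_reduce_nth [simp]: "fps_reduce h f $ n = h (f $ n)"
  by (simp add: fps_reduce_def)

lemma re_ep_dual_fps [simp]: "re (dual_fps a b) = a" "ep (dual_fps a b) = b"
  by (simp_all add: dual_fps_def fps_eq_iff)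

lemma dual_fps_eqI: "re f = re g \<Longrightarrow> ep f = ep g \<Longrightarrow> f = g"
  by (auto simp: fps_eq_iff intro: dual_number_eqI)

lemma re_ep_simps [simp]:
  "re (f + g) = re f + re g" "ep (f + g) = ep f + ep g"
  "re (f * g) = re f * re g" "ep (f * g) = re f * ep g + ep f * re g"
  "re (fps_const a) = fps_const (std_part a)" "ep (fps_const a) = fps_const (eps_part a)"
  "re 0 = 0" "ep 0 = 0" "re 1 = 1" "ep 1 = 0" "re fps_X = fps_X" "ep fps_X = 0"
  for f g :: "'a::comm_ring_1 dual_number fps"
  by (auto simp: fps_eq_iff fps_mult_nth dual_number_sum sum.distrib fps_X_def)

lemma re_prod: "re (prod f A) = (\<Prod>x\<in>A. re (f x))"
  by (induction A rule: infinite_finite_induct) auto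

lemma re_power: "re (f ^ n) = re f ^ n"
  by (induction n) auto

section \<open>The deformation functor and its tangent space\<close>

lemma Gam_inv:
  assumes "\<sigma> \<in> carrier Gam"
  shows "inv\<^bsub>Gam\<^esub> \<sigma> \<in> carrier Gam" "(inv\<^bsub>Gam\<^esub> \<sigma>) (\<sigma> x) = x" "\<sigma> ((inv\<^bsub>Gam\<^esub> \<sigma>) x) = x"
proof -
  interpret Gam: group Gam
    by (rule group_Gam)
  show c: "inv\<^bsub>Gam\<^esub> \<sigma> \<in> carrier Gam"
    using assms by simp
  have "inv\<^bsub>Gam\<^esub> \<sigma> \<circ> \<sigma> = id" "\<sigma> \<circ> inv\<^bsub>Gam\<^esub> \<sigma> = id"
    using Gam.l_inv[OF assms] Gam.r_inv[OF assms] c assms by (simp_all add: Gam_mult Gam_one)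
  then show "(inv\<^bsub>Gam\<^esub> \<sigma>) (\<sigma> x) = x" "\<sigma> ((inv\<^bsub>Gam\<^esub> \<sigma>) x) = x"
    by (simp_all add: fun_eq_iff)
qed

lemma Gam_comp: "\<sigma> \<in> carrier Gam \<Longrightarrow> \<tau> \<in> carrier Gam \<Longrightarrow> \<sigma> \<circ> \<tau> \<in> carrier Gam"
  by (auto simp: GamD intro!: GamI bij_comp)

text \<open>The intertwining form avoids inverses in \<open>Gam\<close>, so equivalences can be
  composed and compared as plain functions.\<close>

lemma lift_equiv_iff:
  "(\<rho>1, \<rho>2) \<in> lift_equiv res H \<pi> \<rho> \<longleftrightarrow> \<rho>1 \<in> lifts res H \<pi> \<rho> \<and> \<rho>2 \<in> lifts res H \<pi> \<rho> \<and>
    (\<exists>\<gamma>\<in>Gam_kernel res. \<forall>h\<in>carrier H. \<rho>2 h \<circ> \<gamma> = \<gamma> \<circ> \<rho>1 h)"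
proof -
  have "\<rho>2 h = \<gamma> \<otimes>\<^bsub>Gam\<^esub> \<rho>1 h \<otimes>\<^bsub>Gam\<^esub> inv\<^bsub>Gam\<^esub> \<gamma> \<longleftrightarrow> \<rho>2 h \<circ> \<gamma> = \<gamma> \<circ> \<rho>1 h"
    if r1: "\<rho>1 \<in> lifts res H \<pi> \<rho>" and "\<gamma> \<in> Gam_kernel res" and h: "h \<in> carrier H" for \<gamma> h
  proof -
    have g: "\<gamma> \<in> carrier Gam"
      using that by (simp add: Gam_kernel_def)
    have r: "\<rho>1 h \<in> carrier Gam"
      using r1 h by (auto simp: lifts_def hom_def)
    have "\<gamma> \<otimes>\<^bsub>Gam\<^esub> \<rho>1 h \<otimes>\<^bsub>Gam\<^esub> inv\<^bsub>Gam\<^esub> \<gamma> = \<gamma> \<circ> \<rho>1 h \<circ> inv\<^bsub>Gam\<^esub> \<gamma>"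
      using g r by (simp add: Gam_mult Gam_comp Gam_inv)
    then show ?thesis
      using Gam_inv(2,3)[OF g] by (auto simp: fun_eq_iff) metis
  qed
  then show ?thesis
    unfolding lift_equiv_def by blast
qed

lemma Gam_kernel_id: "id \<in> Gam_kernel res"
  by (simp add: Gam_kernel_def Gam_id)

lemma Gam_kernel_comp: "\<gamma> \<in> Gam_kernel res \<Longrightarrow> \<delta> \<in> Gam_kernel res \<Longrightarrow> \<gamma> \<circ> \<delta> \<in> Gam_kernel res"
  by (simp add: Gam_kernel_def Gam_comp)

lemma lift_equiv_class_eqI:
  assumes "(\<rho>1, \<rho>2) \<in> lift_equiv res H \<pi> \<rho>"
  shows "lift_equiv res H \<pi> \<rho> `` {\<rho>1} = lift_equiv res H \<pi> \<rho> `` {\<rho>2}"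
proof -
  obtain \<gamma> where g: "\<gamma> \<in> Gam_kernel res" "\<And>h. h \<in> carrier H \<Longrightarrow> \<rho>2 h \<circ> \<gamma> = \<gamma> \<circ> \<rho>1 h"
     and r: "\<rho>1 \<in> lifts res H \<pi> \<rho>" "\<rho>2 \<in> lifts res H \<pi> \<rho>"
    using assms by (auto simp: lift_equiv_iff)
  have gG: "\<gamma> \<in> carrier Gam"
    using g by (simp add: Gam_kernel_def)
  define \<gamma>' where "\<gamma>' = inv\<^bsub>Gam\<^esub> \<gamma>"
  have g': "\<gamma>' \<in> Gam_kernel res"
    using g(1) Gam_inv[OF gG] unfolding Gam_kernel_def \<gamma>'_def by simp metis
  have inv: "\<gamma>' (\<gamma> x) = x" "\<gamma> (\<gamma>' x) = x" for x
    using Gam_inv[OF gG] by (simp_all add: \<gamma>'_def)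
  have c: "\<rho>2 h (\<gamma> x) = \<gamma> (\<rho>1 h x)" if "h \<in> carrier H" for h x
    using g(2)[OF that] by (simp add: fun_eq_iff)
  have "(\<rho>1, \<rho>3) \<in> lift_equiv res H \<pi> \<rho> \<longleftrightarrow> (\<rho>2, \<rho>3) \<in> lift_equiv res H \<pi> \<rho>" for \<rho>3
  proof
    assume "(\<rho>1, \<rho>3) \<in> lift_equiv res H \<pi> \<rho>"
    then obtain \<delta> where d: "\<delta> \<in> Gam_kernel res" "\<And>h. h \<in> carrier H \<Longrightarrow> \<rho>3 h \<circ> \<delta> = \<delta> \<circ> \<rho>1 h"
       "\<rho>3 \<in> lifts res H \<pi> \<rho>"
      by (auto simp: lift_equiv_iff)
    have "\<rho>3 h \<circ> (\<delta> \<circ> \<gamma>') = (\<delta> \<circ> \<gamma>') \<circ> \<rho>2 h" if "h \<in> carrier H" for h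
    proof
      fix x
      have "\<gamma>' (\<rho>2 h x) = \<rho>1 h (\<gamma>' x)"
        using c[OF that, of "\<gamma>' x"] inv by metis
      then show "(\<rho>3 h \<circ> (\<delta> \<circ> \<gamma>')) x = ((\<delta> \<circ> \<gamma>') \<circ> \<rho>2 h) x"
        using d(2)[OF that] by (simp add: fun_eq_iff)
    qed
    then show "(\<rho>2, \<rho>3) \<in> lift_equiv res H \<pi> \<rho>"
      using r d Gam_kernel_comp[OF d(1) g'] by (auto simp: lift_equiv_iff)
  next
    assume "(\<rho>2, \<rho>3) \<in> lift_equiv res H \<pi> \<rho>"
    then obtain \<delta> where d: "\<delta> \<in> Gam_kernel res" "\<And>h. h \<in> carrier H \<Longrightarrow> \<rho>3 h \<circ> \<delta> = \<delta> \<circ> \<rho>2 h"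
       "\<rho>3 \<in> lifts res H \<pi> \<rho>"
      by (auto simp: lift_equiv_iff)
    have "\<rho>3 h \<circ> (\<delta> \<circ> \<gamma>) = (\<delta> \<circ> \<gamma>) \<circ> \<rho>1 h" if "h \<in> carrier H" for h
      using d(2)[OF that] c[OF that] by (simp add: fun_eq_iff)
    then show "(\<rho>1, \<rho>3) \<in> lift_equiv res H \<pi> \<rho>"
      using r d Gam_kernel_comp[OF d(1) g(1)] by (auto simp: lift_equiv_iff)
  qed
  then show ?thesis
    by auto
qed

lemma lifts_cong:
  assumes "\<rho>1 \<in> lifts res H \<pi> \<rho>" "\<And>h. h \<in> carrier H \<Longrightarrow> \<rho>2 h = \<rho>1 h" "group H"
  shows "\<rho>2 \<in> lifts res H \<pi> \<rho>" "(\<rho>1, \<rho>2) \<in> lift_equiv res H \<pi> \<rho>"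
proof -
  interpret group H by fact
  show 2: "\<rho>2 \<in> lifts res H \<pi> \<rho>"
    using assms(1,2) by (auto simp: lifts_def hom_def Pi_iff)
  show "(\<rho>1, \<rho>2) \<in> lift_equiv res H \<pi> \<rho>"
    unfolding lift_equiv_iff using assms(1,2) 2 Gam_kernel_id by (auto intro!: bexI[of _ id])
qed

text \<open>Adds a parameter \<pi> of \<open>R\<close>, so that substitution of \<pi> identifies
  k[[y]] with \<open>R\<close>. Automorphisms of k[\<epsilon>][[y]] are then compared through their
  real and \<epsilon>-parts inside \<open>R\<close>.\<close>

locale param_action = ring_action H R \<rho>
  for H :: "('h, 'b) monoid_scheme" (structure) and R :: "'k::field fps set" and \<rho> +
  fixes \<pi> :: "'k fps"
  assumes pi: "\<pi> $ 0 = 0" "\<pi> \<noteq> 0" and R_eq: "R = range (\<lambda>u. u oo \<pi>)"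
begin

definition \<kappa> :: "'k fps \<Rightarrow> 'k fps" where "\<kappa> u = u oo \<pi>"
definition \<kappa>i :: "'k fps \<Rightarrow> 'k fps" where "\<kappa>i = inv_into UNIV \<kappa>"

lemma inj_kappa: "inj \<kappa>"
  using fps_compose_inj[OF pi] by (simp add: \<kappa>_def [abs_def])

lemma kappa_R [simp, intro]: "\<kappa> u \<in> R"
  by (auto simp: R_eq \<kappa>_def)

lemma kappa_i [simp]: "\<kappa>i (\<kappa> u) = u" "x \<in> R \<Longrightarrow> \<kappa> (\<kappa>i x) = x"
proof -
  show "\<kappa>i (\<kappa> u) = u"
    unfolding \<kappa>i_def using inj_kappa by (rule inv_f_f)
  show "\<kappa> (\<kappa>i x) = x" if "x \<in> R"
    unfolding \<kappa>i_def using that by (intro f_inv_into_f) (simp add: R_eq \<kappa>_def [abs_def])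
qed

lemma kappa_eq_iff: "\<kappa> u = \<kappa> v \<longleftrightarrow> u = v"
  using inj_kappa by (auto simp: inj_def)

lemma kappa_simps [simp]: "\<kappa> (u + v) = \<kappa> u + \<kappa> v" "\<kappa> (u * v) = \<kappa> u * \<kappa> v"
  "\<kappa> (fps_const a) = fps_const a" "\<kappa> 0 = 0"
  by (simp_all add: \<kappa>_def fps_compose_add_distrib fps_compose_mult_distrib[OF pi(1)])

text \<open>The automorphism (1 + \<epsilon> D) \<rho>(h), moved to k[\<epsilon>][[y]]. Separating
  \<open>D\<close> from \<open>h\<close> exposes the semidirect product of derivations and group
  elements behind \<open>cocycle_lift\<close>.\<close>

definition twist :: "'h \<Rightarrow> ('k fps \<Rightarrow> 'k fps) \<Rightarrow> 'k dual_number fps \<Rightarrow> 'k dual_number fps" where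
  "twist h D f = dual_fps (\<kappa>i (\<rho> h (\<kappa> (re f)))) (\<kappa>i (\<rho> h (\<kappa> (ep f)) + D (\<rho> h (\<kappa> (re f)))))"

lemma cocycle_lift_eq_twist: "cocycle_lift \<pi> \<rho> c h = twist h (c h)"
  by (rule ext) (simp add: cocycle_lift_def Let_def twist_def dual_fps_def \<kappa>i_def \<kappa>_def [abs_def])

lemma twist_parts:
  assumes "h \<in> carrier H" "D \<in> carrier (Der R)"
  shows "\<kappa> (re (twist h D f)) = \<rho> h (\<kappa> (re f))"
    and "\<kappa> (ep (twist h D f)) = \<rho> h (\<kappa> (ep f)) + D (\<rho> h (\<kappa> (re f)))"
  using assms by (auto simp: twist_def r_closed R_add Der_closed)

lemma dual_fps_kappa_eqI: "\<kappa> (re f) = \<kappa> (re g) \<Longrightarrow> \<kappa> (ep f) = \<kappa> (ep g) \<Longrightarrow> f = g"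
  by (rule dual_fps_eqI) (auto simp: kappa_eq_iff)

text \<open>Moving \<rho>(h) past 1 + \<epsilon> D' conjugates D', and \<epsilon>^2 = 0 makes the
  derivations add. Hence the homomorphism property of a lift is exactly the cocycle
  identity.\<close>

lemma twist_comp:
  assumes h: "h \<in> carrier H" "h' \<in> carrier H" and D: "D \<in> carrier (Der R)" "D' \<in> carrier (Der R)"
  shows "twist h D \<circ> twist h' D' = twist (h \<otimes> h') (D \<otimes>\<^bsub>Der R\<^esub> Der_act R \<rho> h D')"
  using assms
  by (intro ext dual_fps_kappa_eqI)
     (auto simp: twist_parts Der_add Der_act_closed Der_mult_apply Der_act_apply r_act r_closed
        r_add r_inv Der_closed)

lemma twist_one: "twist \<one> \<one>\<^bsub>Der R\<^esub> = id"
  by (intro ext dual_fps_kappa_eqI)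
     (simp_all only: twist_parts[OF one_closed Der.one_closed] r_one kappa_R Der_one_apply
        add_0_right id_apply)

lemma twist_inj:
  assumes h: "h \<in> carrier H" and D: "D \<in> carrier (Der R)" "D' \<in> carrier (Der R)"
    and eq: "twist h D = twist h D'"
  shows "D = D'"
proof (rule Der_eqI[OF D])
  fix x assume x: "x \<in> R"
  define f where "f = dual_fps (\<kappa>i (\<rho> (inv h) x)) 0"
  have "\<kappa> (ep (twist h D f)) = \<kappa> (ep (twist h D' f))"
    by (simp only: eq)
  then show "D x = D' x"
    using x h D by (simp add: twist_parts f_def r_closed r_inv)
qed

lemma twist_Gam:
  assumes h: "h \<in> carrier H" and D: "D \<in> carrier (Der R)"
  shows "twist h D \<in> carrier Gam"
proof (rule GamI)
  note [simp] = twist_parts[OF h D] r_add[OF h] r_mult[OF h] r_const[OF h] r_closed[OF h]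
  have add: "D (x + y) = D x + D y" and mult: "D (x * y) = D x * y + x * D y"
    if "x \<in> R" "y \<in> R" for x y
    using D that by (auto simp: Der_iff)
  have const: "D (fps_const a) = 0" for a
    using D by (simp add: Der_iff)
  show "twist h D (x + y) = twist h D x + twist h D y" for x y
    by (rule dual_fps_kappa_eqI) (simp_all add: add)
  show "twist h D (x * y) = twist h D x * twist h D y" for x y
    by (rule dual_fps_kappa_eqI) (simp_all add: mult R_mult algebra_simps)
  show "twist h D (fps_const a) = fps_const a" for a
    by (rule dual_fps_kappa_eqI) (simp_all add: const)
  have inv: "inv h \<in> carrier H"
    using h by simp
  \<comment> \<open>The inverse in the semidirect product: the derivation belonging to h^-1 is -
    h^-1 D h.\<close>
  define D1 where "D1 = Der_act R \<rho> (inv h) (inv\<^bsub>Der R\<^esub> D)"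
  have D1: "D1 \<in> carrier (Der R)"
    using D inv unfolding D1_def by (intro Der_act_closed) auto
  have "Der_act R \<rho> h D1 = inv\<^bsub>Der R\<^esub> D"
    using h D by (simp add: D1_def Der.act_one flip: Der.act_act)
  moreover have "D1 \<otimes>\<^bsub>Der R\<^esub> Der_act R \<rho> (inv h) D = \<one>\<^bsub>Der R\<^esub>"
    using inv D by (simp add: D1_def Der.act_unit flip: Der.act_mult)
  ultimately have "twist h D \<circ> twist (inv h) D1 = id" "twist (inv h) D1 \<circ> twist h D = id"
    using h inv D D1 by (simp_all add: twist_comp twist_one)
  then show "bij (twist h D)"
    using o_bij by blast
qed

text \<open>The \<epsilon>-part of \<sigma> on series without \<epsilon>-part is a derivation along
  \<rho>(h); undoing \<rho>(h) in its argument gives \<open>D\<close>. Multiplicativity of \<sigma>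
  becomes the Leibniz rule.\<close>

lemma twist_surj:
  assumes h: "h \<in> carrier H" and \<sigma>: "\<sigma> \<in> carrier Gam"
    and red: "\<And>f. \<kappa> (re (\<sigma> f)) = \<rho> h (\<kappa> (re f))"
  shows "\<exists>D\<in>carrier (Der R). \<sigma> = twist h D"
proof -
  define e where "e a = \<kappa> (ep (\<sigma> (dual_fps a 0)))" for a
  define D where "D = (\<lambda>x\<in>R. e (\<kappa>i (\<rho> (inv h) x)))"
  define s where "s a = \<rho> h (\<kappa> a)" for a
  have Ds: "D (s a) = e a" for a
    using h by (simp add: D_def s_def r_closed r_inv)
  have sR: "s a \<in> R" for a
    using h by (simp add: s_def r_closed)
  have s: "\<exists>a. x = s a" if "x \<in> R" for x
    using that h by (intro exI[of _ "\<kappa>i (\<rho> (inv h) x)"]) (simp add: s_def r_closed r_inv)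
  have s_simps: "s (a + b) = s a + s b" "s (a * b) = s a * s b" "s (fps_const c) = fps_const c" for a b c
    using h by (auto simp: s_def r_add r_mult r_const)
  have e_add: "e (a + b) = e a + e b" for a b
  proof -
    have "dual_fps (a + b) 0 = dual_fps a 0 + dual_fps b 0"
      by (rule dual_fps_eqI) auto
    then show ?thesis
      by (simp add: e_def GamD[OF \<sigma>])
  qed
  have e_mult: "e (a * b) = e a * s b + s a * e b" for a b
  proof -
    have "dual_fps (a * b) 0 = dual_fps a 0 * dual_fps b 0"
      by (rule dual_fps_eqI) auto
    then show ?thesis
      by (simp add: e_def GamD[OF \<sigma>] red s_def add.commute)
  qed
  have e_const: "e (fps_const c) = 0" for c
  proof -
    have "dual_fps (fps_const c) 0 = fps_const (Dual c 0)"
      by (rule dual_fps_eqI) auto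
    then show ?thesis
      by (simp add: e_def GamD[OF \<sigma>])
  qed
  have "D x \<in> R" if "x \<in> R" for x
    using s[OF that] by (auto simp: Ds) (simp add: e_def)
  moreover have "D (x + y) = D x + D y" if xy: "x \<in> R" "y \<in> R" for x y
  proof -
    obtain a b where ab: "x = s a" "y = s b"
      using s[OF xy(1)] s[OF xy(2)] by auto
    have "D (x + y) = e (a + b)"
      using Ds[of "a + b"] by (simp only: ab s_simps)
    then show ?thesis
      by (simp add: ab Ds e_add)
  qed
  moreover have "D (x * y) = D x * y + x * D y" if xy: "x \<in> R" "y \<in> R" for x y
  proof -
    obtain a b where ab: "x = s a" "y = s b"
      using s[OF xy(1)] s[OF xy(2)] by auto
    have "D (x * y) = e (a * b)"
      using Ds[of "a * b"] by (simp add: ab s_simps)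
    then show ?thesis
      by (simp add: ab Ds e_mult)
  qed
  moreover have "D (fps_const c) = 0" for c
    using Ds[of "fps_const c"] by (simp add: s_simps e_const)
  ultimately have D: "D \<in> carrier (Der R)"
    by (simp add: Der_iff) (simp add: D_def)
  have "\<sigma> f = twist h D f" for f
  proof (rule dual_fps_kappa_eqI)
    show "\<kappa> (re (\<sigma> f)) = \<kappa> (re (twist h D f))"
      by (simp add: red twist_parts[OF h D])
    \<comment> \<open>\<sigma> fixes the constant \<epsilon>, so it is determined by its values on
      series with zero \<epsilon>-part.\<close>
    have "f = dual_fps (re f) 0 + fps_const (Dual 0 1) * dual_fps (ep f) 0"
      by (rule dual_fps_eqI) auto
    then have "\<sigma> f = \<sigma> (dual_fps (re f) 0) + fps_const (Dual 0 1) * \<sigma> (dual_fps (ep f) 0)"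
      by (metis GamD(1-3)[OF \<sigma>])
    then have "\<kappa> (ep (\<sigma> f)) = e (re f) + \<rho> h (\<kappa> (ep f))"
      by (simp add: e_def red)
    then show "\<kappa> (ep (\<sigma> f)) = \<kappa> (ep (twist h D f))"
      using Ds[of "re f"] by (simp add: twist_parts[OF h D] s_def)
  qed
  then show ?thesis
    using D by blast
qed

lemma Der_chain:
  assumes D: "D \<in> carrier (Der R)"
  shows "D (\<kappa> u) = \<kappa> (fps_deriv u) * D \<pi>"
  unfolding \<kappa>_def
  by (rule derivation_compose[OF pi(1)]) (use D kappa_R R_const in \<open>auto simp: Der_iff \<kappa>_def\<close>)

section \<open>Lifts to the dual numbers as cocycles\<close>

lemma lifts_iff: "\<rho>A \<in> lifts std_part H \<pi> \<rho> \<longleftrightarrow>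
    \<rho>A \<in> hom H Gam \<and> (\<forall>h\<in>carrier H. \<forall>f. \<kappa> (re (\<rho>A h f)) = \<rho> h (\<kappa> (re f)))"
  by (simp add: lifts_def \<kappa>_def)

abbreviation Z where "Z \<equiv> carrier (Z1 H (Der R) (Der_act R \<rho>))"

lemma cocycle_lift_lifts:
  assumes "c \<in> Z"
  shows "cocycle_lift \<pi> \<rho> c \<in> lifts std_part H \<pi> \<rho>"
  using assms unfolding lifts_iff
  by (auto simp: hom_def cocycle_lift_eq_twist Der.Z1_iff twist_Gam Gam_mult twist_comp twist_parts)

text \<open>Needed because \<open>ind\<close> runs over all lifts in a class. The agreement is only
  on the group, since lifts are arbitrary functions outside its carrier.\<close>

lemma lifts_cocycle:
  assumes \<rho>A: "\<rho>A \<in> lifts std_part H \<pi> \<rho>"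
  shows "\<exists>c\<in>Z. \<forall>h\<in>carrier H. \<rho>A h = cocycle_lift \<pi> \<rho> c h"
proof -
  have "\<exists>D\<in>carrier (Der R). \<rho>A h = twist h D" if "h \<in> carrier H" for h
    using \<rho>A that by (intro twist_surj) (auto simp: lifts_iff hom_def)
  then obtain c' where c': "\<And>h. h \<in> carrier H \<Longrightarrow> c' h \<in> carrier (Der R) \<and> \<rho>A h = twist h (c' h)"
    by metis
  define c where "c = restrict c' (carrier H)"
  have c: "c h \<in> carrier (Der R)" "\<rho>A h = twist h (c h)" if "h \<in> carrier H" for h
    using c'[OF that] that by (simp_all add: c_def)
  have "c (h \<otimes> h') = c h \<otimes>\<^bsub>Der R\<^esub> Der_act R \<rho> h (c h')" if hh: "h \<in> carrier H" "h' \<in> carrier H" for h h'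
  proof (rule twist_inj)
    have "twist (h \<otimes> h') (c (h \<otimes> h')) = \<rho>A h \<circ> \<rho>A h'"
      using \<rho>A hh by (auto simp: lifts_iff hom_def Gam_mult c(2) [symmetric] Pi_iff)
    then show "twist (h \<otimes> h') (c (h \<otimes> h')) = twist (h \<otimes> h') (c h \<otimes>\<^bsub>Der R\<^esub> Der_act R \<rho> h (c h'))"
      using hh by (simp add: c twist_comp)
  qed (use hh c in \<open>auto simp: Der_add Der_act_closed\<close>)
  then have "c \<in> Z"
    using c by (simp add: Der.Z1_iff) (simp add: c_def)
  then show ?thesis
    using c by (auto simp: cocycle_lift_eq_twist)
qed

text \<open>An automorphism reducing to the identity is a lift of the neutral element, hence of the
  form 1 + \<epsilon> D.\<close>

lemma Gam_kernel_iff: "\<gamma> \<in> Gam_kernel std_part \<longleftrightarrow> (\<exists>D\<in>carrier (Der R). \<gamma> = twist \<one> D)"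
proof
  assume g: "\<gamma> \<in> Gam_kernel std_part"
  show "\<exists>D\<in>carrier (Der R). \<gamma> = twist \<one> D"
    using g by (intro twist_surj) (auto simp: Gam_kernel_def r_one)
next
  assume "\<exists>D\<in>carrier (Der R). \<gamma> = twist \<one> D"
  then obtain D where D: "D \<in> carrier (Der R)" "\<gamma> = twist \<one> D"
    by blast
  have "\<kappa> (re (\<gamma> f)) = \<kappa> (re f)" for f
    by (simp add: D twist_parts r_one)
  then show "\<gamma> \<in> Gam_kernel std_part"
    using D by (simp add: Gam_kernel_def kappa_eq_iff twist_Gam)
qed

text \<open>Conjugating by 1 + \<epsilon> D adds D - h D h^-1 to the value at h, which is the
  coboundary of - D; this is why \<open>D\<close> enters inverted.\<close>

lemma cocycle_lift_equiv_iff: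
  assumes c: "c \<in> Z" "c' \<in> Z"
  shows "(cocycle_lift \<pi> \<rho> c, cocycle_lift \<pi> \<rho> c') \<in> lift_equiv std_part H \<pi> \<rho> \<longleftrightarrow> Der.cohomologous c c'"
proof -
  have key: "cocycle_lift \<pi> \<rho> c' h \<circ> twist \<one> D = twist \<one> D \<circ> cocycle_lift \<pi> \<rho> c h \<longleftrightarrow>
      c' h = Der_act R \<rho> h (inv\<^bsub>Der R\<^esub> D) \<otimes>\<^bsub>Der R\<^esub> inv\<^bsub>Der R\<^esub> (inv\<^bsub>Der R\<^esub> D) \<otimes>\<^bsub>Der R\<^esub> c h"
    if D: "D \<in> carrier (Der R)" and h: "h \<in> carrier H" for D h
  proof -
    note ch = Der.Z1_closed[OF c(1) h] Der.Z1_closed[OF c(2) h]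
    define a where "a = Der_act R \<rho> h D"
    have a: "a \<in> carrier (Der R)"
      using D h by (simp add: a_def)
    have "cocycle_lift \<pi> \<rho> c' h \<circ> twist \<one> D = twist \<one> D \<circ> cocycle_lift \<pi> \<rho> c h \<longleftrightarrow>
        twist h (c' h \<otimes>\<^bsub>Der R\<^esub> a) = twist h (D \<otimes>\<^bsub>Der R\<^esub> c h)"
      using D h ch by (simp add: cocycle_lift_eq_twist twist_comp Der.act_one a_def)
    also have "\<dots> \<longleftrightarrow> c' h \<otimes>\<^bsub>Der R\<^esub> a = D \<otimes>\<^bsub>Der R\<^esub> c h"
      using twist_inj[OF h] D a ch by (metis Der_add)
    also have "\<dots> \<longleftrightarrow> c' h = inv\<^bsub>Der R\<^esub> a \<otimes>\<^bsub>Der R\<^esub> D \<otimes>\<^bsub>Der R\<^esub> c h"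
      using D a ch by (metis Der.m_closed Der.inv_closed Der.inv_solve_left' Der.m_assoc Der.m_comm)
    finally show ?thesis
      using D h by (simp add: Der.act_inv a_def)
  qed
  have "(cocycle_lift \<pi> \<rho> c, cocycle_lift \<pi> \<rho> c') \<in> lift_equiv std_part H \<pi> \<rho> \<longleftrightarrow>
     (\<exists>D\<in>carrier (Der R). \<forall>h\<in>carrier H. cocycle_lift \<pi> \<rho> c' h \<circ> twist \<one> D = twist \<one> D \<circ> cocycle_lift \<pi> \<rho> c h)"
  proof -
    have "Gam_kernel std_part = twist \<one> ` carrier (Der R)"
      using Gam_kernel_iff by blast
    then show ?thesis
      unfolding lift_equiv_iff using c cocycle_lift_lifts by simp
  qed
  also have "\<dots> \<longleftrightarrow> (\<exists>D\<in>carrier (Der R). \<forall>h\<in>carrier H.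
     c' h = Der_act R \<rho> h (inv\<^bsub>Der R\<^esub> D) \<otimes>\<^bsub>Der R\<^esub> inv\<^bsub>Der R\<^esub> (inv\<^bsub>Der R\<^esub> D) \<otimes>\<^bsub>Der R\<^esub> c h)"
    using key by auto
  also have "\<dots> \<longleftrightarrow> Der.cohomologous c c'"
    unfolding Der.cohomologous_def by (metis Der.inv_closed Der.inv_inv)
  finally show ?thesis .
qed

lemma tangent_class_eq:
  assumes c: "c \<in> Z"
  shows "tangent_class H \<pi> \<rho> (H1_class H (Der R) (Der_act R \<rho>) c)
    = lift_equiv std_part H \<pi> \<rho> `` {cocycle_lift \<pi> \<rho> c}"
proof -
  have "(\<lambda>c. lift_equiv std_part H \<pi> \<rho> `` {cocycle_lift \<pi> \<rho> c}) ` H1_class H (Der R) (Der_act R \<rho>) c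
      = {lift_equiv std_part H \<pi> \<rho> `` {cocycle_lift \<pi> \<rho> c}}"
  proof (intro equalityI image_subsetI)
    fix c' assume "c' \<in> H1_class H (Der R) (Der_act R \<rho>) c"
    then have "c' \<in> Z" "Der.cohomologous c c'"
      using c by (auto simp: Der.H1_class_eq)
    then show "lift_equiv std_part H \<pi> \<rho> `` {cocycle_lift \<pi> \<rho> c'} \<in> {lift_equiv std_part H \<pi> \<rho> `` {cocycle_lift \<pi> \<rho> c}}"
      using lift_equiv_class_eqI[of "cocycle_lift \<pi> \<rho> c" "cocycle_lift \<pi> \<rho> c'" std_part H \<pi> \<rho>] c
      by (simp add: cocycle_lift_equiv_iff)
  qed (use c in \<open>auto simp: Der.H1_class_eq Der.cohomologous_refl\<close>)
  then show ?thesis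
    by (simp add: tangent_class_def)
qed

text \<open>\<open>ind_tangent\<close> undoes the tangent identification by \<open>inv_into\<close>;
  injectivity is what makes it return the intended class.\<close>

lemma tangent_class_inj:
  "inj_on (tangent_class H \<pi> \<rho>) (carrier (H1 H (Der R) (Der_act R \<rho>)))"
proof (rule inj_onI)
  fix X Y assume "X \<in> carrier (H1 H (Der R) (Der_act R \<rho>))" "Y \<in> carrier (H1 H (Der R) (Der_act R \<rho>))"
    and eq: "tangent_class H \<pi> \<rho> X = tangent_class H \<pi> \<rho> Y"
  then obtain c c' where c: "c \<in> Z" "X = H1_class H (Der R) (Der_act R \<rho>) c"
     and c': "c' \<in> Z" "Y = H1_class H (Der R) (Der_act R \<rho>) c'"
    by (auto simp: Der.carrier_H1)
  have "(cocycle_lift \<pi> \<rho> c', cocycle_lift \<pi> \<rho> c') \<in> lift_equiv std_part H \<pi> \<rho>"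
    using c' by (simp add: cocycle_lift_equiv_iff Der.cohomologous_refl)
  then have "(cocycle_lift \<pi> \<rho> c, cocycle_lift \<pi> \<rho> c') \<in> lift_equiv std_part H \<pi> \<rho>"
    using eq c c' by (auto simp: tangent_class_eq)
  then show "X = Y"
    using c c' by (simp add: cocycle_lift_equiv_iff Der.H1_class_eqI)
qed

end

section \<open>Induction\<close>

text \<open>Taylor expansion f(y + \<epsilon> z) = f(y) + \<epsilon> f'(y) z, plus the
  \<epsilon>-part of f evaluated at y. Only y has to vanish at 0; the constant term of z is
  arbitrary.\<close>

lemma fps_subst_dual:
  fixes f g :: "'a::field dual_number fps"
  assumes y: "re g $ 0 = 0"
  shows "re (fps_subst f g) = re f oo re g"
    and "ep (fps_subst f g) = (ep f oo re g) + (fps_deriv (re f) oo re g) * ep g"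
proof -
  define y z where "y = re g" and "z = ep g"
  have y0: "y $ i = 0" if "i < 1" for i
    using y that by (simp add: y_def)
  have ep_power: "ep (g ^ Suc i) = of_nat (Suc i) * (y ^ i * z)" for i
    by (induction i) (simp_all add: re_power y_def z_def algebra_simps)
  have y_low: "(y ^ i) $ n = 0" if "n < i" for i n
    using startsby_zero_power_prefix[of y i] y that by (auto simp: y_def)
  have yz_low: "(y ^ i * z) $ n = 0" if "n < i" for i n
    unfolding fps_mult_nth using y_low that by (intro sum.neutral) auto
  \<comment> \<open>The \<epsilon>-part of g^i is i y^(i-1) z, where z may be a unit, so one order
    of vanishing is lost. The sums therefore run up to \<open>Suc n\<close>, one index further than
    for ordinary composition.\<close>
  have low: "(g ^ i) $ n = 0" if "Suc n < i" for i n
  proof (rule dual_number_eqI)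
    obtain j where j: "i = Suc j"
      using \<open>Suc n < i\<close> by (cases i) auto
    have "re (g ^ i) $ n = 0"
      using y_low that by (simp add: re_power flip: y_def)
    then show "std_part (g ^ i $ n) = std_part 0"
      by simp
    have "ep (g ^ i) $ n = 0"
      unfolding j ep_power using yz_low that j by (simp flip: fps_of_nat)
    then show "eps_part (g ^ i $ n) = eps_part 0"
      by simp
  qed
  have subst: "fps_subst f g $ n = (\<Sum>i\<le>Suc n. f $ i * (g ^ i) $ n)" for n
  proof -
    have "{i. (g ^ i) $ n \<noteq> 0} \<subseteq> {..Suc n}"
      using low[of n] by (auto simp: not_less[symmetric])
    then show ?thesis
      unfolding fps_subst_def fps_nth_Abs_fps by (intro sum.mono_neutral_left) auto
  qed
  have comp: "(a oo y) $ n = (\<Sum>i\<le>Suc n. a $ i * (y ^ i) $ n)" for a n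
    using y_low[of n "Suc n"] by (simp add: fps_compose_nth atLeast0AtMost)
  have comp_mult: "((a oo y) * z) $ n = (\<Sum>i\<le>n. a $ i * (y ^ i * z) $ n)" for a n
  proof -
    have "((a oo y) * z) $ n = (\<Sum>k\<le>n. (\<Sum>i\<le>n. a $ i * (y ^ i) $ k) * z $ (n - k))"
      unfolding fps_mult_nth atLeast0AtMost
    proof (intro sum.cong refl)
      fix k assume "k \<in> {..n}"
      then have "(\<Sum>i\<le>n. a $ i * (y ^ i) $ k) = (\<Sum>i\<le>k. a $ i * (y ^ i) $ k)"
        using y_low by (intro sum.mono_neutral_right) auto
      then show "(a oo y) $ k * z $ (n - k) = (\<Sum>i\<le>n. a $ i * (y ^ i) $ k) * z $ (n - k)"
        by (simp add: fps_compose_nth atLeast0AtMost)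
    qed
    also have "\<dots> = (\<Sum>i\<le>n. \<Sum>k\<le>n. a $ i * (y ^ i) $ k * z $ (n - k))"
      unfolding sum_distrib_right by (rule sum.swap)
    also have "\<dots> = (\<Sum>i\<le>n. a $ i * (y ^ i * z) $ n)"
      by (simp add: fps_mult_nth atLeast0AtMost sum_distrib_left mult.assoc)
    finally show ?thesis .
  qed
  show "re (fps_subst f g) = re f oo re g"
  proof (rule fps_ext)
    fix n
    have "std_part (f $ i * (g ^ i) $ n) = re f $ i * (y ^ i) $ n" for i
      by (simp add: y_def flip: re_power)
    then show "re (fps_subst f g) $ n = (re f oo re g) $ n"
      by (simp only: fps_reduce_nth subst dual_number_sum comp flip: y_def)
  qed
  show "ep (fps_subst f g) = (ep f oo re g) + (fps_deriv (re f) oo re g) * ep g"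
  proof (rule fps_ext)
    fix n
    have 1: "eps_part (f $ i * (g ^ i) $ n) = ep f $ i * (y ^ i) $ n + re f $ i * ep (g ^ i) $ n" for i
      by (simp add: y_def add.commute flip: re_power)
    have "(\<Sum>i\<le>Suc n. re f $ i * ep (g ^ i) $ n) = (\<Sum>i\<le>n. re f $ Suc i * ep (g ^ Suc i) $ n)"
      by (subst sum.atMost_Suc_shift) (simp del: power_Suc)
    also have "\<dots> = (\<Sum>i\<le>n. fps_deriv (re f) $ i * (y ^ i * z) $ n)"
      by (intro sum.cong refl, subst ep_power) (simp flip: fps_of_nat)
    finally have "(\<Sum>i\<le>Suc n. re f $ i * ep (g ^ i) $ n) = ((fps_deriv (re f) oo y) * z) $ n"
      by (simp only: comp_mult)
    then show "ep (fps_subst f g) $ n = ((ep f oo re g) + (fps_deriv (re f) oo re g) * ep g) $ n"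
      by (simp only: fps_reduce_nth subst dual_number_sum 1 sum.distrib fps_add_nth comp flip: y_def z_def)
  qed
qed

section \<open>The actions of G and of G/N together\<close>

locale fps_action_normal = fps_action G \<rho> for G :: "('g, 'b) monoid_scheme" (structure)
    and \<rho> :: "'g \<Rightarrow> 'k::field fps \<Rightarrow> 'k fps" +
  fixes N :: "'g set"
  assumes normal: "N \<lhd> G"
begin

abbreviation R where "R \<equiv> fixed_ring \<rho> N"
abbreviation y where "y \<equiv> norm_param \<rho> N"
abbreviation yG where "yG \<equiv> norm_param \<rho> (carrier G)"
abbreviation \<rho>s where "\<rho>s \<equiv> sharp_action N \<rho>"

lemma N_subgroup: "subgroup N G"
  using normal by (rule normal_imp_subgroup)

lemma N_G: "s \<in> N \<Longrightarrow> s \<in> carrier G"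
  using N_subgroup by (rule subgroup.mem_carrier)

lemma R_I: "(\<And>s. s \<in> N \<Longrightarrow> \<rho> s x = x) \<Longrightarrow> x \<in> R"
  by (simp add: fixed_ring_def)

lemma R_D: "x \<in> R \<Longrightarrow> s \<in> N \<Longrightarrow> \<rho> s x = x"
  by (simp add: fixed_ring_def)

sublocale T: param_action G UNIV \<rho> fps_X
  by unfold_locales (auto simp: rho_add rho_mult rho_const rho_rho rho_one)

lemma T_kappa [simp]: "T.\<kappa> u = u"
  by (simp add: T.\<kappa>_def)

sublocale U: gmodule_normal G "Der UNIV" "Der_act UNIV \<rho>" N
  by (intro gmodule_normal.intro T.gmodule_Der gmodule_normal_axioms.intro normal)

text \<open>k[[t]] as an additive G-module: its N-invariants are the ring k[[t]]^N, so the general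
  facts on coset actions apply to the induced action.\<close>

definition add_fps :: "'k fps monoid" where
  "add_fps = \<lparr>carrier = UNIV, mult = (+), one = 0\<rparr>"

lemma comm_group_add_fps: "comm_group add_fps"
  by (rule comm_groupI) (auto simp: add_fps_def add_ac intro: exI[of _ "- _"] left_minus)

lemma gmodule_add_fps: "gmodule G add_fps \<rho>"
  by (intro gmodule.intro gmodule_axioms.intro comm_group_add_fps is_group)
     (auto simp: add_fps_def rho_add rho_rho rho_one)

sublocale W: gmodule_normal G add_fps \<rho> N
  by (intro gmodule_normal.intro gmodule_add_fps gmodule_normal_axioms.intro normal)

lemma W_MN: "carrier W.MN = R"
  unfolding W.carrier_MN by (auto simp: add_fps_def fixed_ring_def)

lemma sharp_action_eq: "x \<in> R \<Longrightarrow> \<rho>s C x = coset_act \<rho> C x"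
  by (simp add: sharp_action_def coset_act_def)

lemma sharp_rcos: "g \<in> carrier G \<Longrightarrow> x \<in> R \<Longrightarrow> \<rho>s (N #> g) x = \<rho> g x"
  by (simp add: sharp_action_eq W.coset_act_rcos W_MN)

lemma rho_R: "g \<in> carrier G \<Longrightarrow> x \<in> R \<Longrightarrow> \<rho> g x \<in> R"
  using W.act_in_MN by (simp add: W_MN)

lemma coset_rep: "C \<in> carrier (G Mod N) \<Longrightarrow> \<exists>g\<in>carrier G. g \<in> C \<and> C = N #> g"
  by (rule U.coset_nonempty)

lemma y_0: "y $ 0 = 0" "y \<noteq> 0"
  using norm_param_nth_0[OF N_subgroup] by auto

lemma R_range: "R = range (\<lambda>u. u oo y)"
  by (rule fixed_ring_eq[OF N_subgroup])

sublocale S: param_action "G Mod N" R \<rho>s y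
proof (intro param_action.intro ring_action.intro ring_action_axioms.intro param_action_axioms.intro y_0 R_range)
  show "group (G Mod N)"
    using normal by (rule normal.factorgroup_is_group)
  show "x + x' \<in> R" "x * x' \<in> R" if "x \<in> R" "x' \<in> R" for x x'
    using that by (auto simp: fixed_ring_def rho_add rho_mult N_G)
  show "fps_const a \<in> R" for a
    by (auto simp: fixed_ring_def rho_const N_G)
next
  fix C assume C: "C \<in> carrier (G Mod N)"
  then obtain g where g: "g \<in> carrier G" "C = N #> g"
    using coset_rep by blast
  show "\<rho>s C x \<in> R" if "x \<in> R" for x
    using that g by (simp add: sharp_rcos rho_R)
  show "\<rho>s C (x + x') = \<rho>s C x + \<rho>s C x'" "\<rho>s C (x * x') = \<rho>s C x * \<rho>s C x'"
    if "x \<in> R" "x' \<in> R" for x x'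
  proof -
    have "x + x' \<in> R" "x * x' \<in> R"
      using that by (auto simp: fixed_ring_def rho_add rho_mult N_G)
    then show "\<rho>s C (x + x') = \<rho>s C x + \<rho>s C x'" "\<rho>s C (x * x') = \<rho>s C x * \<rho>s C x'"
      using that g by (simp_all add: sharp_rcos rho_add rho_mult)
  qed
  have "fps_const a \<in> R" for a
    by (auto simp: fixed_ring_def rho_const N_G)
  then show "\<rho>s C (fps_const a) = fps_const a" for a
    using g by (simp add: sharp_rcos rho_const)
  fix C' x assume C': "C' \<in> carrier (G Mod N)" and x: "x \<in> R"
  then obtain g' where g': "g' \<in> carrier G" "C' = N #> g'"
    using coset_rep by blast
  have "C \<otimes>\<^bsub>G Mod N\<^esub> C' = N #> (g \<otimes> g')"
    using U.rcos_mult g g' by simp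
  then show "\<rho>s (C \<otimes>\<^bsub>G Mod N\<^esub> C') x = \<rho>s C (\<rho>s C' x)"
    using g g' x by (simp add: sharp_rcos rho_R rho_rho del: mult_FactGroup)
next
  fix x assume x: "x \<in> R"
  have "\<one>\<^bsub>G Mod N\<^esub> = N #> \<one>"
    using U.N_sub by (simp add: FactGroup_def coset_mult_one)
  then show "\<rho>s \<one>\<^bsub>G Mod N\<^esub> x = x"
    using sharp_rcos[OF one_closed x] by (simp add: rho_one)
qed

lemma inv_rcos: "g \<in> carrier G \<Longrightarrow> inv\<^bsub>G Mod N\<^esub> (N #> g) = N #> inv g"
  using normal by (simp add: normal.inv_FactGroup U.rcos_in_Mod normal.rcos_inv)

lemma Der_act_sharp:
  "g \<in> carrier G \<Longrightarrow> x \<in> R \<Longrightarrow> d \<in> carrier (Der R) \<Longrightarrow>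
    Der_act R \<rho>s (N #> g) d x = \<rho> g (d (\<rho> (inv g) x))"
  by (simp add: S.Der_act_apply U.rcos_in_Mod inv_rcos sharp_rcos rho_R S.Der_closed)

subsection \<open>The module $\Theta_1$\<close>

lemma yG_0: "yG $ 0 = 0" "yG \<noteq> 0"
  using norm_param_nth_0[OF subgroup_self] by auto

lemma yG_inv: "g \<in> carrier G \<Longrightarrow> \<rho> g yG = yG"
  by (rule norm_param_invariant[OF rho_hom subgroup_self])

lemma yG_R: "yG \<in> R"
  by (rule R_I) (simp add: yG_inv N_G)

text \<open>The series g with y_G = g(y); the element \<open>dydy\<close> built from it is dy_G/dy =
  g'(y), the generator of the different of k[[t]]^N over k[[t]]^G.\<close>

definition yGy :: "'k fps" where "yGy = S.\<kappa>i yG"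

definition dydy :: "'k fps" where "dydy = S.\<kappa> (fps_deriv yGy)"

lemma kappa_yGy: "S.\<kappa> yGy = yG"
  by (simp add: yGy_def yG_R)

lemma yGy_comp: "yGy oo y = yG"
  using kappa_yGy by (simp add: S.\<kappa>_def)

text \<open>The derivative is nonzero because dy_G/dt is a multiple of g'(y) by the chain rule:
  separability over the invariants of G passes to the intermediate ring.\<close>

lemma yGy_0: "yGy $ 0 = 0" "yGy \<noteq> 0" "fps_deriv yGy \<noteq> 0"
proof -
  have "(yGy oo y) $ 0 = yGy $ 0"
    by simp
  then show "yGy $ 0 = 0"
    using yG_0 by (simp add: yGy_comp)
  show "yGy \<noteq> 0"
    using yGy_comp yG_0 by auto
  have "fps_deriv yG = (fps_deriv yGy oo y) * fps_deriv y"
    using y_0 by (simp add: fps_compose_deriv flip: yGy_comp)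
  then show "fps_deriv yGy \<noteq> 0"
    using fps_deriv_norm_param_nonzero by auto
qed

lemma dydy_nonzero: "dydy \<noteq> 0"
  using yGy_0 y_0 by (simp add: dydy_def S.\<kappa>_def fps_compose_eq_0_iff)

lemma dydy_R: "dydy \<in> R"
  by (simp add: dydy_def)

lemma derivation_yG:
  assumes "\<And>u v. d ((u oo y) + (v oo y)) = d (u oo y) + d (v oo y)"
    and "\<And>u v. d ((u oo y) * (v oo y)) = d (u oo y) * (v oo y) + (u oo y) * d (v oo y)"
    and "\<And>a. d (fps_const a) = 0"
  shows "d (u oo y) = (fps_deriv u oo y) * d y" "d yG = dydy * d y"
proof -
  have lin: "d (fps_const a * (u oo y)) = fps_const a * d (u oo y)" for a u
    using assms(2)[of "fps_const a" u] assms(3)[of a] by simp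
  show 1: "d (u oo y) = (fps_deriv u oo y) * d y" for u
    using derivation_compose[OF y_0(1), of d] assms(1,2) lin by blast
  show "d yG = dydy * d y"
    using 1[of yGy] by (simp add: yGy_comp dydy_def S.\<kappa>_def)
qed

lemma Der_UNIV_yG: "d \<in> carrier (Der UNIV) \<Longrightarrow> d (u oo y) = (fps_deriv u oo y) * d y"
    "d \<in> carrier (Der UNIV) \<Longrightarrow> d yG = dydy * d y"
  using derivation_yG[of d] by (auto simp: T.Der_iff)

lemma Der_R_yG: "d \<in> carrier (Der R) \<Longrightarrow> d yG = dydy * d y"
  using S.Der_chain[of d yGy] by (simp add: kappa_yGy dydy_def)

abbreviation Th1 where "Th1 \<equiv> Theta1 G N \<rho>"

lemma Theta1_different: "fps_different (fixed_ring \<rho> (carrier G)) R = range (\<lambda>u. dydy * S.\<kappa> u)"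
  unfolding fixed_ring_eq[OF subgroup_self] R_range
  using fps_different_eq[OF y_0 yGy_0] by (simp add: yGy_comp dydy_def S.\<kappa>_def)

lemma carrier_Theta1: "carrier Th1 = range (\<lambda>f. dydy * f)"
proof -
  interpret module "(*) :: 'k fps \<Rightarrow> 'k fps \<Rightarrow> 'k fps"
    by unfold_locales (auto simp: algebra_simps)
  have "span (range (\<lambda>u. dydy * S.\<kappa> u)) = range (\<lambda>f. dydy * f)"
  proof (intro equalityI)
    have "subspace (range (\<lambda>f. dydy * f))"
    proof (rule subspaceI)
      show "0 \<in> range (\<lambda>f. dydy * f)"
        by (rule image_eqI[of _ _ 0]) auto
      show "x + x' \<in> range (\<lambda>f. dydy * f)" if "x \<in> range (\<lambda>f. dydy * f)" "x' \<in> range (\<lambda>f. dydy * f)" for x x'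
        using that by (auto simp flip: distrib_left)
      show "c * x \<in> range (\<lambda>f. dydy * f)" if "x \<in> range (\<lambda>f. dydy * f)" for c x
        using that by (auto simp: mult.left_commute)
    qed
    then show "span (range (\<lambda>u. dydy * S.\<kappa> u)) \<subseteq> range (\<lambda>f. dydy * f)"
      by (intro span_minimal) auto
    have "dydy = dydy * S.\<kappa> (fps_const 1)"
      by (simp only: S.kappa_simps) simp
    then have "dydy \<in> span (range (\<lambda>u. dydy * S.\<kappa> u))"
      by (intro span_base) (rule range_eqI)
    then show "range (\<lambda>f. dydy * f) \<subseteq> span (range (\<lambda>u. dydy * S.\<kappa> u))"
      by (auto simp: mult.commute[of dydy] intro: span_scale)
  qed
  then show ?thesis
    by (simp add: Theta1_def Theta1_different)
qed

lemma Theta1_mult [simp]: "x \<otimes>\<^bsub>Th1\<^esub> x' = x + x'" and Theta1_one [simp]: "\<one>\<^bsub>Th1\<^esub> = 0"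
  by (simp_all add: Theta1_def)

lemma Theta1_I: "dydy * f \<in> carrier Th1"
  unfolding carrier_Theta1 by (rule rangeI)

text \<open>The derivation d/dy of k[[y]]. For nontrivial N it does not extend to a derivation of
  k[[t]], since dy/dt is then not a unit; this is what separates \<delta> from an element of
  \<Theta>.\<close>

definition Dy :: "'k fps \<Rightarrow> 'k fps" where "Dy = (\<lambda>x\<in>R. S.\<kappa> (fps_deriv (S.\<kappa>i x)))"

lemma Dy_kappa: "Dy (S.\<kappa> u) = S.\<kappa> (fps_deriv u)"
  by (simp add: Dy_def)

lemma R_kappa_E: assumes "x \<in> R" obtains u where "x = S.\<kappa> u"
  using assms S.kappa_i(2) by metis

lemma Dy_simps: "x \<in> R \<Longrightarrow> x' \<in> R \<Longrightarrow> Dy (x + x') = Dy x + Dy x'"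
  "x \<in> R \<Longrightarrow> x' \<in> R \<Longrightarrow> Dy (x * x') = Dy x * x' + x * Dy x'"
  "Dy (fps_const a) = 0"
proof -
  show "Dy (fps_const a) = 0"
    using Dy_kappa[of "fps_const a"] by simp
  show "Dy (x + x') = Dy x + Dy x'" if "x \<in> R" "x' \<in> R"
    using that by (elim R_kappa_E) (simp add: Dy_kappa flip: S.kappa_simps)
  show "Dy (x * x') = Dy x * x' + x * Dy x'" if xx: "x \<in> R" "x' \<in> R"
  proof -
    obtain u v where uv: "x = S.\<kappa> u" "x' = S.\<kappa> v"
      using xx R_kappa_E by metis
    have "Dy (x * x') = Dy (S.\<kappa> (u * v))"
      by (simp add: uv)
    then show ?thesis
      unfolding Dy_kappa by (simp add: uv Dy_kappa add.commute)
  qed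
qed

lemma Dy_R: "x \<in> R \<Longrightarrow> Dy x \<in> R"
  by (simp add: Dy_def)

lemma Dy_y: "Dy y = 1"
  using Dy_kappa[of fps_X] S.kappa_simps(3)[of 1] y_0 by (simp add: S.\<kappa>_def)

lemma y_R: "y \<in> R"
  by (auto simp: R_range intro!: range_eqI[of _ _ fps_X] simp: y_0)

lemma Der_scale_Dy:
  assumes "f \<in> R"
  shows "(\<lambda>x\<in>R. Dy x * f) \<in> carrier (Der R)"
  using assms unfolding S.Der_iff
  by (auto simp: Dy_simps Dy_R S.R_add S.R_mult S.R_const algebra_simps)

text \<open>Conjugating d/dy by g gives another derivation of k[[y]], whose value at y_G is a
  multiple of \<open>dydy\<close>; as y_G is invariant, that value is also g applied to
  \<open>dydy\<close>. So the ideal \<Theta>_1 is G-stable.\<close>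

lemma rho_dydy:
  assumes g: "g \<in> carrier G"
  shows "\<exists>f. \<rho> g dydy = dydy * f"
proof -
  define D where "D = Der_act R \<rho>s (N #> g) (\<lambda>x\<in>R. Dy x * 1)"
  have d: "(\<lambda>x\<in>R. Dy x * 1) \<in> carrier (Der R)"
    using S.R_const[of 1] by (intro Der_scale_Dy) simp
  then have "D \<in> carrier (Der R)"
    unfolding D_def using g by (intro S.Der_act_closed U.rcos_in_Mod)
  then have "D yG = dydy * D y"
    by (rule Der_R_yG)
  moreover have "D yG = \<rho> g ((\<lambda>x\<in>R. Dy x * 1) (\<rho> (inv g) yG))"
    unfolding D_def using g yG_R d by (rule Der_act_sharp)
  moreover have "(\<lambda>x\<in>R. Dy x * 1) (\<rho> (inv g) yG) = dydy"
    using Der_R_yG[OF d] g by (simp add: yG_inv y_R Dy_y)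
  ultimately show ?thesis
    by auto
qed

lemma comm_group_Theta1: "comm_group Th1"
proof (rule comm_groupI)
  show "\<one>\<^bsub>Th1\<^esub> \<in> carrier Th1"
    using Theta1_I[of 0] by simp
  show "x \<otimes>\<^bsub>Th1\<^esub> x' \<in> carrier Th1" if "x \<in> carrier Th1" "x' \<in> carrier Th1" for x x'
    using that by (auto simp: carrier_Theta1 simp flip: distrib_left)
  show "\<exists>x'\<in>carrier Th1. x' \<otimes>\<^bsub>Th1\<^esub> x = \<one>\<^bsub>Th1\<^esub>" if x: "x \<in> carrier Th1" for x
  proof -
    obtain f where "x = dydy * f"
      using x by (auto simp: carrier_Theta1)
    then show ?thesis
      by (intro bexI[OF _ Theta1_I[of "- f"]]) simp
  qed
qed (auto simp: add_ac)

lemma gmodule_Theta1: "gmodule G Th1 \<rho>"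
proof (intro gmodule.intro gmodule_axioms.intro comm_group_Theta1 is_group)
  fix g x assume g: "g \<in> carrier G" and "x \<in> carrier Th1"
  then obtain f where f: "x = dydy * f"
    by (auto simp: carrier_Theta1)
  obtain f' where "\<rho> g dydy = dydy * f'"
    using rho_dydy[OF g] by blast
  then have "\<rho> g x = dydy * (f' * \<rho> g f)"
    by (simp add: f rho_mult[OF g] mult.assoc)
  then show "\<rho> g x \<in> carrier Th1"
    by (simp only: Theta1_I)
qed (auto simp: rho_add rho_rho rho_one)

sublocale V: gmodule_normal G Th1 \<rho> N
  by (intro gmodule_normal.intro gmodule_Theta1 gmodule_normal_axioms.intro normal)

lemma V_inv:
  assumes x: "x \<in> carrier Th1"
  shows "inv\<^bsub>Th1\<^esub> x = - x"
proof -
  obtain f where "x = dydy * f"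
    using x by (auto simp: carrier_Theta1)
  then have "- x \<in> carrier Th1"
    using Theta1_I[of "- f"] by simp
  then show "inv\<^bsub>Th1\<^esub> x = - x"
    using x by (intro V.M.inv_equality) auto
qed

lemma V_MN: "carrier V.MN = carrier Th1 \<inter> R"
  by (auto simp: V.carrier_MN fixed_ring_def)

lemma Der_R_yG_Theta1: "d \<in> carrier (Der R) \<Longrightarrow> d yG \<in> carrier V.MN"
  unfolding V_MN using S.Der_closed[OF _ yG_R, of d] by (simp add: Der_R_yG Theta1_I)

text \<open>A derivation of k[[y]] is f d/dy with f its value at y, and it sends y_G to f
  \<open>dydy\<close>. An invariant element of \<Theta>_1 has this shape with invariant f, because
  \<open>dydy\<close> is itself invariant and can be cancelled.\<close>

lemma Der_R_bij: "bij_betw (\<lambda>d. d yG) (carrier (Der R)) (carrier V.MN)"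
proof (rule bij_betw_imageI)
  show "inj_on (\<lambda>d. d yG) (carrier (Der R))"
  proof (rule inj_onI)
    fix d e assume d: "d \<in> carrier (Der R)" and e: "e \<in> carrier (Der R)" and "d yG = e yG"
    then have dy: "d y = e y"
      using dydy_nonzero by (simp add: Der_R_yG)
    show "d = e"
    proof (rule S.Der_eqI[OF d e])
      fix x assume "x \<in> R"
      then show "d x = e x"
        by (elim R_kappa_E) (simp add: S.Der_chain[OF d] S.Der_chain[OF e] dy)
    qed
  qed
  show "(\<lambda>d. d yG) ` carrier (Der R) = carrier V.MN"
  proof (intro equalityI subsetI)
    fix x assume "x \<in> carrier V.MN"
    then obtain f where f: "x = dydy * f" and xR: "x \<in> R"
      by (auto simp: V_MN carrier_Theta1)
    have "f \<in> R"
    proof (rule R_I)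
      fix s assume s: "s \<in> N"
      have "dydy * \<rho> s f = dydy * f"
        using R_D[OF xR s] R_D[OF dydy_R s] rho_mult[OF N_G[OF s], of dydy f] f by simp
      then show "\<rho> s f = f"
        using dydy_nonzero by simp
    qed
    then have d: "(\<lambda>x\<in>R. Dy x * f) \<in> carrier (Der R)"
      by (rule Der_scale_Dy)
    have "(\<lambda>x\<in>R. Dy x * f) yG = x"
      unfolding Der_R_yG[OF d] by (simp add: y_R Dy_y f)
    then show "x \<in> (\<lambda>d. d yG) ` carrier (Der R)"
      using d by (intro image_eqI[of _ _ "\<lambda>x\<in>R. Dy x * f"]) auto
  qed (auto simp: Der_R_yG_Theta1)
qed

section \<open>The coefficient maps as module homomorphisms\<close>

sublocale ident: gmodule_hom "G Mod N" "Der R" "Der_act R \<rho>s" V.MN "coset_act \<rho>" "\<lambda>d. d yG"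
proof (intro gmodule_hom.intro gmodule_hom_axioms.intro S.gmodule_Der V.gmodule_MN Der_R_yG_Theta1)
  show "(d \<otimes>\<^bsub>Der R\<^esub> e) yG = d yG \<otimes>\<^bsub>V.MN\<^esub> e yG" for d e
    by (simp add: S.Der_mult_apply yG_R)
  fix C d assume "C \<in> carrier (G Mod N)" and d: "d \<in> carrier (Der R)"
  then obtain g where g: "g \<in> carrier G" "C = N #> g"
    using coset_rep by blast
  then show "Der_act R \<rho>s C d yG = coset_act \<rho> C (d yG)"
    using d by (simp add: Der_act_sharp yG_R yG_inv V.coset_act_rcos Der_R_yG_Theta1)
qed

sublocale j: gmodule_hom G "Der UNIV" "Der_act UNIV \<rho>" Th1 \<rho> "\<lambda>d. d yG"
proof (intro gmodule_hom.intro gmodule_hom_axioms.intro T.gmodule_Der gmodule_Theta1)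
  show "d yG \<in> carrier Th1" if "d \<in> carrier (Der UNIV)" for d
    using that by (simp add: Der_UNIV_yG Theta1_I)
  show "(d \<otimes>\<^bsub>Der UNIV\<^esub> e) yG = d yG \<otimes>\<^bsub>Th1\<^esub> e yG" for d e
    by (simp add: T.Der_mult_apply)
  show "Der_act UNIV \<rho> g d yG = \<rho> g (d yG)" if "g \<in> carrier G" for g d
    using that by (simp add: T.Der_act_apply yG_inv)
qed

lemma U_MN_D:
  assumes "d \<in> carrier U.MN"
  shows "d \<in> carrier (Der UNIV)" "x \<in> R \<Longrightarrow> d x \<in> R"
proof -
  show d: "d \<in> carrier (Der UNIV)"
    using assms by (simp add: U.carrier_MN)
  show "d x \<in> R" if x: "x \<in> R"
  proof (rule R_I)
    fix s assume s: "s \<in> N"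
    have "inv s \<in> N"
      using s N_subgroup by (simp add: subgroup.m_inv_closed)
    then have "\<rho> s (d x) = Der_act UNIV \<rho> s d x"
      using s x by (simp add: T.Der_act_apply N_G R_D)
    then show "\<rho> s (d x) = d x"
      using assms s by (simp add: U.carrier_MN)
  qed
qed

sublocale iota: gmodule_hom "G Mod N" U.MN "coset_act (Der_act UNIV \<rho>)" "Der R" "Der_act R \<rho>s"
  "\<lambda>d. restrict d R"
proof (intro gmodule_hom.intro gmodule_hom_axioms.intro S.gmodule_Der U.gmodule_MN)
  show cl: "restrict d R \<in> carrier (Der R)" if d: "d \<in> carrier U.MN" for d
    using U_MN_D[OF d] unfolding S.Der_iff T.Der_iff by (auto simp: S.R_add S.R_mult S.R_const)
  show "restrict (d \<otimes>\<^bsub>U.MN\<^esub> e) R = restrict d R \<otimes>\<^bsub>Der R\<^esub> restrict e R" for d e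
    by (auto simp: Der_def invariants_def)
  fix C d assume "C \<in> carrier (G Mod N)" and d: "d \<in> carrier U.MN"
  then obtain g where g: "g \<in> carrier G" "C = N #> g"
    using coset_rep by blast
  show "restrict (coset_act (Der_act UNIV \<rho>) C d) R = Der_act R \<rho>s C (restrict d R)"
  proof (rule extensionalityI[of _ R])
    fix x assume "x \<in> R"
    then show "restrict (coset_act (Der_act UNIV \<rho>) C d) R x = Der_act R \<rho>s C (restrict d R) x"
      using g d cl[OF d] by (simp add: U.coset_act_rcos T.Der_act_apply Der_act_sharp rho_R)
  qed (simp_all add: Der_act_def)
qed

section \<open>From cocycles of G to cocycles of G/N\<close>

text \<open>\<open>\<delta>\<close> is a derivation $k[[t]]^N \to k[[t]]$ whose coboundary agrees with \<open>- c\<close> on \<open>N\<close>. Adding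
  the coboundary of \<open>\<delta>\<close> to \<open>c\<close> then yields a cocycle of \<open>G / N\<close> with values in \<open>\<Theta>\<^sup>\<sharp>\<close>, whose class
  depends only on that of \<open>c\<close>.\<close>

definition adapted :: "('g \<Rightarrow> 'k fps \<Rightarrow> 'k fps) \<Rightarrow> ('k fps \<Rightarrow> 'k fps) \<Rightarrow> bool" where
  "adapted c \<delta> \<longleftrightarrow> (\<forall>x\<in>R. \<forall>x'\<in>R. \<delta> (x + x') = \<delta> x + \<delta> x' \<and> \<delta> (x * x') = \<delta> x * x' + x * \<delta> x') \<and>
     (\<forall>a. \<delta> (fps_const a) = 0) \<and> (\<forall>s\<in>N. \<forall>x\<in>R. \<rho> s (\<delta> x) = \<delta> x - c s x)"

definition corrected :: "('g \<Rightarrow> 'k fps \<Rightarrow> 'k fps) \<Rightarrow> ('k fps \<Rightarrow> 'k fps) \<Rightarrow> 'g \<Rightarrow> 'k fps \<Rightarrow> 'k fps" where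
  "corrected c \<delta> g x = c g x + \<rho> g (\<delta> (\<rho> (inv g) x)) - \<delta> x"

text \<open>Any representative may be chosen, since \<open>corrected\<close> is constant on cosets
  when \<delta> is adapted to the cocycle c.\<close>

definition sharp_cocycle :: "('g \<Rightarrow> 'k fps \<Rightarrow> 'k fps) \<Rightarrow> ('k fps \<Rightarrow> 'k fps) \<Rightarrow> 'g set \<Rightarrow> 'k fps \<Rightarrow> 'k fps" where
  "sharp_cocycle c \<delta> = (\<lambda>C\<in>carrier (G Mod N). \<lambda>x\<in>R. corrected c \<delta> (SOME g. g \<in> C) x)"

lemma T_Z_mult:
  assumes "c \<in> T.Z" "g \<in> carrier G" "h \<in> carrier G"
  shows "c (g \<otimes> h) x = c g x + \<rho> g (c h (\<rho> (inv g) x))"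
  using assms by (simp add: T.Der.Z1_iff T.Der_mult_apply T.Der_act_apply)

lemma T_Z_Der: "c \<in> T.Z \<Longrightarrow> g \<in> carrier G \<Longrightarrow> c g \<in> carrier (Der UNIV)"
  by (rule T.Der.Z1_closed)

text \<open>On N-invariant arguments the extra term g c_s g^-1 from the cocycle identity is
  cancelled by the failure of \<delta> to commute with s.\<close>

lemma corrected_right:
  assumes c: "c \<in> T.Z" and a: "adapted c \<delta>" and g: "g \<in> carrier G" and s: "s \<in> N" and x: "x \<in> R"
  shows "corrected c \<delta> (g \<otimes> s) x = corrected c \<delta> g x"
proof -
  define x' where "x' = \<rho> (inv g) x"
  have x': "x' \<in> R"
    using g x by (simp add: x'_def rho_R)
  have sG: "s \<in> carrier G" and "inv s \<in> N"
    using s N_subgroup by (auto simp: N_G subgroup.m_inv_closed)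
  then have "\<rho> (inv (g \<otimes> s)) x = x'"
    using g R_D[OF x'] by (simp add: inv_mult_group rho_rho x'_def)
  moreover have "\<rho> s (\<delta> x') = \<delta> x' - c s x'"
    using a s x' by (simp add: adapted_def)
  ultimately show ?thesis
    using g sG by (simp add: corrected_def T_Z_mult[OF c] rho_rho rho_diff x'_def)
qed

text \<open>The term c_s produced by the cocycle identity is absorbed when s is applied to -
  \<delta> x, again by adaptedness.\<close>

lemma corrected_left:
  assumes c: "c \<in> T.Z" and a: "adapted c \<delta>" and g: "g \<in> carrier G" and s: "s \<in> N" and x: "x \<in> R"
  shows "corrected c \<delta> (s \<otimes> g) x = \<rho> s (corrected c \<delta> g x)"
proof -
  have sG: "s \<in> carrier G" and "inv s \<in> N"
    using s N_subgroup by (auto simp: N_G subgroup.m_inv_closed)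
  then have "\<rho> (inv s) x = x" "\<rho> (inv (s \<otimes> g)) x = \<rho> (inv g) x"
    using g R_D[OF x] by (simp_all add: inv_mult_group rho_rho)
  moreover have "\<rho> s (\<delta> x) = \<delta> x - c s x"
    using a s x by (simp add: adapted_def)
  ultimately show ?thesis
    using g sG by (simp add: corrected_def T_Z_mult[OF c] rho_rho rho_diff rho_add)
qed

lemma corrected_coset:
  assumes c: "c \<in> T.Z" and a: "adapted c \<delta>" and C: "C \<in> carrier (G Mod N)" "g \<in> C" "h \<in> C"
    and x: "x \<in> R"
  shows "corrected c \<delta> g x = corrected c \<delta> h x"
proof -
  obtain k where k: "k \<in> carrier G" "C = N #> k"
    using coset_rep[OF C(1)] by blast
  have "corrected c \<delta> l x = corrected c \<delta> k x" if "l \<in> C" for l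
  proof -
    have "l \<in> k <# N"
      using that k normal by (simp add: normal.coset_eq)
    then obtain s where "s \<in> N" "l = k \<otimes> s"
      by (auto simp: l_coset_def)
    then show ?thesis
      using corrected_right[OF c a k(1) _ x] by simp
  qed
  then show ?thesis
    using C by simp
qed

text \<open>By normality s g and g lie in the same coset, so the value at s g is the value at g; but
  it is also the image of that value under s.\<close>

lemma corrected_R:
  assumes c: "c \<in> T.Z" and a: "adapted c \<delta>" and g: "g \<in> carrier G" and x: "x \<in> R"
  shows "corrected c \<delta> g x \<in> R"
proof (rule R_I)
  fix s assume s: "s \<in> N"
  have "g \<in> N #> g"
    using g N_subgroup by (rule rcos_self)
  moreover have "s \<otimes> g \<in> N #> g"
    using s by (auto simp: r_coset_def)
  ultimately have "corrected c \<delta> (s \<otimes> g) x = corrected c \<delta> g x"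
    using corrected_coset[OF c a U.rcos_in_Mod[OF g] _ _ x] by blast
  then show "\<rho> s (corrected c \<delta> g x) = corrected c \<delta> g x"
    using corrected_left[OF c a g s x] by simp
qed

lemma sharp_cocycle_apply:
  assumes c: "c \<in> T.Z" and a: "adapted c \<delta>" and g: "g \<in> carrier G" and x: "x \<in> R"
  shows "sharp_cocycle c \<delta> (N #> g) x = corrected c \<delta> g x"
proof -
  have gC: "g \<in> N #> g"
    using g N_subgroup by (rule rcos_self)
  then have "(SOME g'. g' \<in> N #> g) \<in> N #> g"
    by (rule someI)
  then have "corrected c \<delta> (SOME g'. g' \<in> N #> g) x = corrected c \<delta> g x"
    using corrected_coset[OF c a U.rcos_in_Mod[OF g] _ gC x] by blast
  then show ?thesis
    using x U.rcos_in_Mod[OF g] by (simp add: sharp_cocycle_def)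
qed

text \<open>A coboundary has been added to c, so the Leibniz rule and the cocycle identity hold for
  \<open>corrected\<close> already on elements of G; representatives carry them to the
  quotient.\<close>

lemma sharp_cocycle_Z1:
  assumes c: "c \<in> T.Z" and a: "adapted c \<delta>"
  shows "sharp_cocycle c \<delta> \<in> S.Z"
proof -
  have d: "\<delta> (x + x') = \<delta> x + \<delta> x'" "\<delta> (x * x') = \<delta> x * x' + x * \<delta> x'" if "x \<in> R" "x' \<in> R" for x x'
    using a that by (auto simp: adapted_def)
  have d0: "\<delta> (fps_const b) = 0" for b
    using a by (simp add: adapted_def)
  have Der: "sharp_cocycle c \<delta> C \<in> carrier (Der R)" if C: "C \<in> carrier (G Mod N)" for C
  proof -
    obtain g where g: "g \<in> carrier G" "C = N #> g"
      using coset_rep[OF C] by blast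
    have ig: "inv g \<in> carrier G"
      using g by simp
    note app = sharp_cocycle_apply[OF c a g(1)]
    have cg: "c g (x + x') = c g x + c g x'" "c g (x * x') = c g x * x' + x * c g x'"
       "c g (fps_const b) = 0" for x x' b
      using T_Z_Der[OF c g(1)] by (simp_all add: T.Der_iff)
    have "sharp_cocycle c \<delta> C \<in> extensional R"
      using C by (simp add: sharp_cocycle_def)
    moreover have "sharp_cocycle c \<delta> C x \<in> R" if "x \<in> R" for x
      using that g by (simp add: app corrected_R[OF c a])
    moreover have "sharp_cocycle c \<delta> C (x + x') = sharp_cocycle c \<delta> C x + sharp_cocycle c \<delta> C x'"
      if x: "x \<in> R" "x' \<in> R" for x x'
      using x g ig
      by (simp add: app S.R_add corrected_def cg d rho_add[OF ig] rho_R rho_add[OF g(1)])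
    moreover have "sharp_cocycle c \<delta> C (x * x') = sharp_cocycle c \<delta> C x * x' + x * sharp_cocycle c \<delta> C x'"
      if x: "x \<in> R" "x' \<in> R" for x x'
      using x g ig
      by (simp add: app S.R_mult corrected_def cg d rho_mult[OF ig] rho_R rho_add[OF g(1)]
            rho_mult[OF g(1)] rho_inv algebra_simps)
    moreover have "sharp_cocycle c \<delta> C (fps_const b) = 0" for b
      using g ig by (simp add: app S.R_const corrected_def cg d0 rho_const rho_0)
    ultimately show ?thesis
      by (simp add: S.Der_iff)
  qed
  have "sharp_cocycle c \<delta> (C \<otimes>\<^bsub>G Mod N\<^esub> C') =
      sharp_cocycle c \<delta> C \<otimes>\<^bsub>Der R\<^esub> Der_act R \<rho>s C (sharp_cocycle c \<delta> C')"
    if C: "C \<in> carrier (G Mod N)" and C': "C' \<in> carrier (G Mod N)" for C C'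
  proof (rule S.Der_eqI)
    show "sharp_cocycle c \<delta> (C \<otimes>\<^bsub>G Mod N\<^esub> C') \<in> carrier (Der R)"
      using C C' by (intro Der U.MN.G.m_closed)
    show "sharp_cocycle c \<delta> C \<otimes>\<^bsub>Der R\<^esub> Der_act R \<rho>s C (sharp_cocycle c \<delta> C') \<in> carrier (Der R)"
      using C C' by (intro S.Der_add S.Der_act_closed Der)
    obtain g where g: "g \<in> carrier G" "C = N #> g"
      using coset_rep[OF C] by blast
    obtain h where h: "h \<in> carrier G" "C' = N #> h"
      using coset_rep[OF C'] by blast
    fix x assume x: "x \<in> R"
    have x': "\<rho> (inv g) x \<in> R"
      using g x by (simp add: rho_R)
    have "(sharp_cocycle c \<delta> C \<otimes>\<^bsub>Der R\<^esub> Der_act R \<rho>s C (sharp_cocycle c \<delta> C')) x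
      = corrected c \<delta> g x + \<rho> g (corrected c \<delta> h (\<rho> (inv g) x))"
      using g h x x' Der[OF C'] by (simp add: S.Der_mult_apply Der_act_sharp sharp_cocycle_apply[OF c a])
    also have "\<dots> = corrected c \<delta> (g \<otimes> h) x"
      using g(1) h(1)
      by (simp add: corrected_def T_Z_mult[OF c] inv_mult_group rho_rho rho_add[OF g(1)] rho_diff[OF g(1)])
    also have "\<dots> = sharp_cocycle c \<delta> (C \<otimes>\<^bsub>G Mod N\<^esub> C') x"
      using g h x U.rcos_mult[OF g(1) h(1)] by (simp add: sharp_cocycle_apply[OF c a] del: mult_FactGroup)
    finally show "sharp_cocycle c \<delta> (C \<otimes>\<^bsub>G Mod N\<^esub> C') x =
      (sharp_cocycle c \<delta> C \<otimes>\<^bsub>Der R\<^esub> Der_act R \<rho>s C (sharp_cocycle c \<delta> C')) x" ..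
  qed
  then show ?thesis
    using Der unfolding S.Der.Z1_iff by (simp add: sharp_cocycle_def del: mult_FactGroup)
qed

text \<open>If c' - c is the coboundary of D, the induced cocycles differ by the coboundary of D +
  \<delta>' - \<delta>. This maps k[[t]]^N to itself because the defects of the three terms under N
  cancel. The case c = c' gives independence of \<delta>.\<close>

lemma sharp_cocycle_cohomologous:
  assumes c: "c \<in> T.Z" "c' \<in> T.Z" and a: "adapted c \<delta>" "adapted c' \<delta>'"
    and coh: "T.Der.cohomologous c c'"
  shows "S.Der.cohomologous (sharp_cocycle c \<delta>) (sharp_cocycle c' \<delta>')"
proof -
  obtain D where D: "D \<in> carrier (Der UNIV)" and "\<And>g. g \<in> carrier G \<Longrightarrow>
      c' g = Der_act UNIV \<rho> g D \<otimes>\<^bsub>Der UNIV\<^esub> inv\<^bsub>Der UNIV\<^esub> D \<otimes>\<^bsub>Der UNIV\<^esub> c g"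
    using coh unfolding T.Der.cohomologous_def by blast
  then have c': "c' g x = \<rho> g (D (\<rho> (inv g) x)) - D x + c g x" if "g \<in> carrier G" for g x
    using that by (simp add: T.Der_mult_apply T.Der_act_apply T.Der_inv)
  define E where "E = (\<lambda>x\<in>R. D x + \<delta>' x - \<delta> x)"
  have E_R: "D x + \<delta>' x - \<delta> x \<in> R" if x: "x \<in> R" for x
  proof (rule R_I)
    fix s assume s: "s \<in> N"
    have "inv s \<in> N" "s \<in> carrier G"
      using s N_subgroup by (auto simp: N_G subgroup.m_inv_closed)
    then have "c' s x = \<rho> s (D x) - D x + c s x"
      using c' R_D[OF x] by simp
    moreover have "\<rho> s (\<delta> x) = \<delta> x - c s x" "\<rho> s (\<delta>' x) = \<delta>' x - c' s x"
      using a s x by (auto simp: adapted_def)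
    ultimately show "\<rho> s (D x + \<delta>' x - \<delta> x) = D x + \<delta>' x - \<delta> x"
      using \<open>s \<in> carrier G\<close> by (simp add: rho_add rho_diff)
  qed
  then have "E \<in> carrier (Der R)"
    using a D unfolding S.Der_iff T.Der_iff adapted_def
    by (auto simp: E_def S.R_add S.R_mult S.R_const algebra_simps)
  moreover have "sharp_cocycle c' \<delta>' C =
     Der_act R \<rho>s C E \<otimes>\<^bsub>Der R\<^esub> inv\<^bsub>Der R\<^esub> E \<otimes>\<^bsub>Der R\<^esub> sharp_cocycle c \<delta> C"
    if C: "C \<in> carrier (G Mod N)" for C
  proof (rule S.Der_eqI)
    obtain g where g: "g \<in> carrier G" "C = N #> g"
      using coset_rep[OF C] by blast
    fix x assume x: "x \<in> R"
    have x': "\<rho> (inv g) x \<in> R"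
      using g x by (simp add: rho_R)
    show "sharp_cocycle c' \<delta>' C x =
        (Der_act R \<rho>s C E \<otimes>\<^bsub>Der R\<^esub> inv\<^bsub>Der R\<^esub> E \<otimes>\<^bsub>Der R\<^esub> sharp_cocycle c \<delta> C) x"
      using g x x' \<open>E \<in> carrier (Der R)\<close> c'[OF g(1), of x]
      by (simp add: S.Der_mult_apply Der_act_sharp S.Der_inv sharp_cocycle_apply[OF c(1) a(1)]
          sharp_cocycle_apply[OF c(2) a(2)] corrected_def E_def rho_add rho_diff)
  next
    show "sharp_cocycle c' \<delta>' C \<in> carrier (Der R)"
      using S.Der.Z1_closed[OF sharp_cocycle_Z1[OF c(2) a(2)] C] .
    show "Der_act R \<rho>s C E \<otimes>\<^bsub>Der R\<^esub> inv\<^bsub>Der R\<^esub> E \<otimes>\<^bsub>Der R\<^esub> sharp_cocycle c \<delta> C \<in> carrier (Der R)"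
      using S.Der.Z1_closed[OF sharp_cocycle_Z1[OF c(1) a(1)] C] \<open>E \<in> carrier (Der R)\<close> C
      by (intro S.Der_add S.Der_act_closed) auto
  qed
  ultimately show ?thesis
    unfolding S.Der.cohomologous_def by blast
qed

section \<open>The induced lift of a cocycle lift\<close>

text \<open>Writing $y_A = y + \varepsilon z$ for the norm parameter of the lift attached to \<open>c\<close>, the
  isomorphism $y \mapsto y_A$ is \<open>1 + \<epsilon>\<delta>\<close> with \<open>\<delta> = z d/dy\<close>.\<close>

definition norm_eps :: "('g \<Rightarrow> 'k fps \<Rightarrow> 'k fps) \<Rightarrow> 'k fps" where
  "norm_eps c = ep (norm_param (cocycle_lift fps_X \<rho> c) N)"

definition delta :: "('g \<Rightarrow> 'k fps \<Rightarrow> 'k fps) \<Rightarrow> 'k fps \<Rightarrow> 'k fps" where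
  "delta c x = Dy x * norm_eps c"

lemma lift_parts:
  assumes "c \<in> T.Z" "g \<in> carrier G"
  shows "re (cocycle_lift fps_X \<rho> c g f) = \<rho> g (re f)"
    and "ep (cocycle_lift fps_X \<rho> c g f) = \<rho> g (ep f) + c g (\<rho> g (re f))"
  using T.twist_parts[OF assms(2) T_Z_Der[OF assms], of f]
  by (simp_all add: T.cocycle_lift_eq_twist)

lemma re_norm_param:
  assumes c: "c \<in> T.Z"
  shows "re (norm_param (cocycle_lift fps_X \<rho> c) N) = y"
  by (auto simp: norm_param_def re_prod lift_parts[OF c] N_G intro!: prod.cong)

text \<open>The norm parameter y + \<epsilon> z is fixed by the lifted action of s in N; its
  \<epsilon>-part says that s z + c_s(y) = z, which is the required condition at y.\<close>

lemma delta_adapted: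
  assumes c: "c \<in> T.Z"
  shows "adapted c (delta c)"
proof -
  let ?\<rho>A = "cocycle_lift fps_X \<rho> c"
  have z: "\<rho> s (norm_eps c) = norm_eps c - c s y" if s: "s \<in> N" for s
  proof -
    have "?\<rho>A \<in> hom G Gam"
      using T.cocycle_lift_lifts[OF c] by (simp add: lifts_def)
    then have "?\<rho>A s (norm_param ?\<rho>A N) = norm_param ?\<rho>A N"
      using N_subgroup s by (rule norm_param_invariant)
    from arg_cong[OF this, of ep] have "\<rho> s (norm_eps c) + c s (\<rho> s y) = norm_eps c"
      by (simp add: lift_parts[OF c N_G[OF s]] re_norm_param[OF c] norm_eps_def)
    then show ?thesis
      using R_D[OF y_R s] by (simp add: eq_diff_eq)
  qed
  \<comment> \<open>By the chain rule both \<delta> and c_s act on k[[y]] as d/dy times their value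
    at y, so the relation at y spreads to all x.\<close>
  have "\<rho> s (delta c x) = delta c x - c s x" if s: "s \<in> N" and x: "x \<in> R" for s x
  proof -
    obtain u where u: "x = u oo y"
      using x by (auto simp: R_range)
    have "c s x = Dy x * c s y"
      using Der_UNIV_yG(1)[OF T_Z_Der[OF c N_G[OF s]], of u] Dy_kappa[of u] by (simp add: u S.\<kappa>_def)
    then show ?thesis
      using s x by (simp add: delta_def rho_mult N_G z R_D[OF Dy_R] algebra_simps)
  qed
  then show ?thesis
    by (auto simp: adapted_def delta_def Dy_simps algebra_simps)
qed

text \<open>By the Taylor formula \<open>\<phi>\<close> is substitution of y followed by 1 +
  \<epsilon>\<delta>. The candidate is checked to satisfy
  \<open>\<phi> (?\<sigma> f) = ?\<rho>A g (\<phi> f)\<close>, and injectivity of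
  \<open>\<phi>\<close> then evaluates \<open>inv_into\<close>.\<close>

lemma sharp_lift_cocycle_lift:
  assumes c: "c \<in> T.Z" and C: "C \<in> carrier (G Mod N)"
  shows "sharp_lift N (cocycle_lift fps_X \<rho> c) C = cocycle_lift y \<rho>s (sharp_cocycle c (delta c)) C"
proof -
  let ?\<rho>A = "cocycle_lift fps_X \<rho> c" and ?\<sigma> = "cocycle_lift y \<rho>s (sharp_cocycle c (delta c)) C"
  define \<phi> where "\<phi> = (\<lambda>f. fps_subst f (norm_param ?\<rho>A N))"
  note a = delta_adapted[OF c]
  have \<phi>: "re (\<phi> f) = S.\<kappa> (re f)" "ep (\<phi> f) = S.\<kappa> (ep f) + delta c (S.\<kappa> (re f))" for f
    using fps_subst_dual[of "norm_param ?\<rho>A N" f] y_0 Dy_kappa[of "re f"]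
    by (simp_all add: \<phi>_def re_norm_param[OF c] delta_def S.\<kappa>_def norm_eps_def)
  have inj: "inj \<phi>"
  proof (rule injI)
    fix f f' assume eq: "\<phi> f = \<phi> f'"
    have "re f = re f'"
      using arg_cong[OF eq, of re] by (simp add: \<phi> S.kappa_eq_iff)
    moreover from this have "ep f = ep f'"
      using arg_cong[OF eq, of ep] by (simp add: \<phi> S.kappa_eq_iff)
    ultimately show "f = f'"
      by (rule dual_fps_eqI)
  qed
  have "inv_into UNIV \<phi> \<circ> ?\<rho>A g \<circ> \<phi> = ?\<sigma>" if gC: "g \<in> C" for g
  proof
    fix f
    obtain k where "k \<in> carrier G" "C = N #> k"
      using coset_rep[OF C] by blast
    then have g: "g \<in> carrier G" and Cg: "C = N #> g"
      using gC r_coset_subset_G[of N k] U.N_sub repr_independence[of g N k] N_subgroup by auto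
    have D: "sharp_cocycle c (delta c) C \<in> carrier (Der R)"
      using S.Der.Z1_closed[OF sharp_cocycle_Z1[OF c a] C] .
    have gR: "\<rho> g (S.\<kappa> u) \<in> R" for u
      using g by (simp add: rho_R)
    have \<sigma>: "S.\<kappa> (re (?\<sigma> f)) = \<rho> g (S.\<kappa> (re f))"
       "S.\<kappa> (ep (?\<sigma> f)) = \<rho> g (S.\<kappa> (ep f)) + corrected c (delta c) g (\<rho> g (S.\<kappa> (re f)))"
      using S.twist_parts[OF C D, of f] g gR
      by (simp_all add: S.cocycle_lift_eq_twist Cg sharp_rcos sharp_cocycle_apply[OF c a])
    have "\<phi> (?\<sigma> f) = ?\<rho>A g (\<phi> f)"
    proof (rule dual_fps_eqI)
      show "re (\<phi> (?\<sigma> f)) = re (?\<rho>A g (\<phi> f))"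
        by (simp add: \<phi> \<sigma> lift_parts[OF c g])
      show "ep (\<phi> (?\<sigma> f)) = ep (?\<rho>A g (\<phi> f))"
        using g by (simp add: \<phi> \<sigma> lift_parts[OF c g] corrected_def rho_inv rho_add)
    qed
    then show "(inv_into UNIV \<phi> \<circ> ?\<rho>A g \<circ> \<phi>) f = ?\<sigma> f"
      using inv_f_f[OF inj, of "?\<sigma> f"] by simp
  qed
  then have "(\<lambda>g. inv_into UNIV \<phi> \<circ> ?\<rho>A g \<circ> \<phi>) ` C = (\<lambda>g. ?\<sigma>) ` C"
    by (rule image_cong[OF refl])
  also have "\<dots> = {?\<sigma>}"
    using coset_rep[OF C] by auto
  finally show ?thesis
    by (simp add: sharp_lift_def Let_def flip: \<phi>_def)
qed

text \<open>Equivalent lifts are matched with cocycle lifts only on the carrier, so the induced lift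
  must depend only on the values there.\<close>

lemma sharp_lift_cong:
  assumes "\<And>g. g \<in> carrier G \<Longrightarrow> \<rho>1 g = \<rho>2 g" and C: "C \<in> carrier (G Mod N)"
  shows "sharp_lift N \<rho>1 C = sharp_lift N \<rho>2 C"
proof -
  have "C \<subseteq> carrier G"
    using coset_rep[OF C] r_coset_subset_G U.N_sub by blast
  moreover have "norm_param \<rho>1 N = norm_param \<rho>2 N"
    using assms by (auto simp: norm_param_def N_G intro!: prod.cong)
  ultimately show ?thesis
    using assms unfolding sharp_lift_def Let_def
    by (intro arg_cong[of _ _ the_elem] image_cong) auto
qed

text \<open>Each lift in the class agrees on G with the lift of some cocycle cohomologous to c, so
  its induced lift is equivalent to the one obtained from c and \<open>the_elem\<close> is
  determined.\<close>

lemma ind_cocycle: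
  assumes c: "c \<in> T.Z"
  shows "ind std_part G N \<rho> (lift_equiv std_part G fps_X \<rho> `` {cocycle_lift fps_X \<rho> c})
    = lift_equiv std_part (G Mod N) y \<rho>s `` {cocycle_lift y \<rho>s (sharp_cocycle c (delta c))}"
proof -
  let ?E = "lift_equiv std_part (G Mod N) y \<rho>s" and ?X = "lift_equiv std_part G fps_X \<rho> `` {cocycle_lift fps_X \<rho> c}"
  have "?E `` {sharp_lift N \<rho>A} = ?E `` {cocycle_lift y \<rho>s (sharp_cocycle c (delta c))}"
    if \<rho>A: "\<rho>A \<in> ?X" for \<rho>A
  proof -
    have "\<rho>A \<in> lifts std_part G fps_X \<rho>"
      using \<rho>A by (auto simp: lift_equiv_iff)
    then obtain c' where c': "c' \<in> T.Z" "\<And>g. g \<in> carrier G \<Longrightarrow> \<rho>A g = cocycle_lift fps_X \<rho> c' g"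
      using T.lifts_cocycle by blast
    have "(cocycle_lift fps_X \<rho> c, cocycle_lift fps_X \<rho> c') \<in> lift_equiv std_part G fps_X \<rho>"
      using \<rho>A c' T.cocycle_lift_lifts[OF c'(1)] by (auto simp: lift_equiv_iff)
    then have "T.Der.cohomologous c c'"
      using c c' by (simp add: T.cocycle_lift_equiv_iff)
    then have coh: "S.Der.cohomologous (sharp_cocycle c (delta c)) (sharp_cocycle c' (delta c'))"
      using c c' by (intro sharp_cocycle_cohomologous delta_adapted)
    have Z: "sharp_cocycle c (delta c) \<in> S.Z" "sharp_cocycle c' (delta c') \<in> S.Z"
      using c c' by (auto intro: sharp_cocycle_Z1 delta_adapted)
    have "?E `` {cocycle_lift y \<rho>s (sharp_cocycle c (delta c))} = ?E `` {cocycle_lift y \<rho>s (sharp_cocycle c' (delta c'))}"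
      using Z coh by (intro lift_equiv_class_eqI) (simp add: S.cocycle_lift_equiv_iff)
    also have "\<dots> = ?E `` {sharp_lift N \<rho>A}"
    proof (intro lift_equiv_class_eqI lifts_cong(2))
      fix C assume C: "C \<in> carrier (G Mod N)"
      show "sharp_lift N \<rho>A C = cocycle_lift y \<rho>s (sharp_cocycle c' (delta c')) C"
        using sharp_lift_cong[OF c'(2) C] sharp_lift_cocycle_lift[OF c'(1) C] by simp
    qed (use Z S.cocycle_lift_lifts U.MN.G.is_group in auto)
    finally show ?thesis ..
  qed
  moreover have "cocycle_lift fps_X \<rho> c \<in> ?X"
    using c by (simp add: T.cocycle_lift_equiv_iff T.Der.cohomologous_refl)
  ultimately have "(\<lambda>\<rho>A. ?E `` {sharp_lift N \<rho>A}) ` ?X = {?E `` {cocycle_lift y \<rho>s (sharp_cocycle c (delta c))}}"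
    by blast
  then show ?thesis
    by (simp add: ind_def)
qed

abbreviation clG where "clG \<equiv> H1_class G (Der UNIV) (Der_act UNIV \<rho>)"
abbreviation clS where "clS \<equiv> H1_class (G Mod N) (Der R) (Der_act R \<rho>s)"

text \<open>Only \<open>delta c\<close> is linked to the norm parameter, but the class of the
  induced cocycle does not depend on \<delta>; so the most convenient adapted \<delta> may be
  used.\<close>

lemma ind_tangent_class:
  assumes c: "c \<in> T.Z" and a: "adapted c \<delta>"
  shows "ind_tangent G N \<rho> (clG c) = clS (sharp_cocycle c \<delta>)"
proof -
  have Z: "sharp_cocycle c (delta c) \<in> S.Z"
    using c by (intro sharp_cocycle_Z1 delta_adapted)
  have "ind_tangent G N \<rho> (clG c) = clS (sharp_cocycle c (delta c))"
    unfolding ind_tangent_def T.tangent_class_eq[OF c] ind_cocycle[OF c] H1_Theta_sharp_def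
      S.tangent_class_eq[OF Z, symmetric]
    by (intro inv_into_f_f S.tangent_class_inj S.Der.H1_class_in_H1 Z)
  also have "\<dots> = clS (sharp_cocycle c \<delta>)"
    using c a
    by (intro S.Der.H1_class_eqI sharp_cocycle_Z1 sharp_cocycle_cohomologous delta_adapted
        T.Der.cohomologous_refl)
  finally show ?thesis .
qed

lemma H1_Theta_E:
  assumes "X \<in> carrier (H1_Theta G \<rho>)" obtains c where "c \<in> T.Z" "X = clG c"
  using assms by (auto simp: H1_Theta_def T.Der.carrier_H1)

lemma ind_tangent_funcset: "ind_tangent G N \<rho> \<in> carrier (H1_Theta G \<rho>) \<rightarrow> carrier (H1_Theta_sharp G N \<rho>)"
proof
  fix X assume "X \<in> carrier (H1_Theta G \<rho>)"
  then obtain c where "c \<in> T.Z" "X = clG c"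
    by (rule H1_Theta_E)
  then show "ind_tangent G N \<rho> X \<in> carrier (H1_Theta_sharp G N \<rho>)"
    by (simp add: ind_tangent_class[OF _ delta_adapted] H1_Theta_sharp_def S.Der.H1_class_in_H1
        sharp_cocycle_Z1 delta_adapted)
qed

section \<open>Commutativity of the two triangles\<close>

lemma ind_inf:
  assumes "X \<in> carrier (H1_Theta_N G N \<rho>)"
  shows "ind_tangent G N \<rho> (inf_Theta G N \<rho> X) = iota_map G N \<rho> X"
proof -
  obtain c where c: "c \<in> carrier (Z1 (G Mod N) U.MN (coset_act (Der_act UNIV \<rho>)))"
      "X = H1_class (G Mod N) U.MN (coset_act (Der_act UNIV \<rho>)) c"
    using assms by (auto simp: H1_Theta_N_def U.MN.carrier_H1)
  have infl: "U.inflate c \<in> T.Z"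
    using c by (intro U.inflate_Z1)
  \<comment> \<open>An inflated cocycle vanishes on N, because N is the neutral coset and a cocycle
    is trivial there. This is all that adaptedness of the zero map asks for.\<close>
  have "N #> s = \<one>\<^bsub>G Mod N\<^esub>" if "s \<in> N" for s
    using that N_subgroup by (simp add: FactGroup_def subgroup.rcos_const)
  then have "U.inflate c s x = 0" if "s \<in> N" for s x
    using that U.MN.Z1_one[OF c(1)] by (simp add: N_G T.Der_one del: one_FactGroup)
  then have a: "adapted (U.inflate c) (\<lambda>x. 0)"
    by (simp add: adapted_def rho_0 N_G)
  have "sharp_cocycle (U.inflate c) (\<lambda>x. 0) = iota.push c"
  proof (rule extensionalityI[of _ "carrier (G Mod N)"])
    fix C assume "C \<in> carrier (G Mod N)"
    then obtain g where g: "g \<in> carrier G" "C = N #> g" "C \<in> carrier (G Mod N)"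
      using coset_rep by blast
    show "sharp_cocycle (U.inflate c) (\<lambda>x. 0) C = iota.push c C"
    proof (rule extensionalityI[of _ R])
      fix x assume "x \<in> R"
      then show "sharp_cocycle (U.inflate c) (\<lambda>x. 0) C x = iota.push c C x"
        using g sharp_cocycle_apply[OF infl a g(1)] by (simp add: corrected_def rho_0)
    qed (use g in \<open>auto simp: sharp_cocycle_def\<close>)
  qed (auto simp: sharp_cocycle_def)
  then have "ind_tangent G N \<rho> (clG (U.inflate c)) = clS (iota.push c)"
    using ind_tangent_class[OF infl a] by simp
  moreover have "inf_Theta G N \<rho> X = clG (U.inflate c)"
    using c by (simp add: inf_Theta_def U.inflation_class)
  moreover have "iota_map G N \<rho> X = clS (iota.push c)"
    using c by (simp add: iota_map_def iota.H1_map_push)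
  ultimately show ?thesis
    by simp
qed

lemma inf_ind:
  assumes "X \<in> carrier (H1_Theta G \<rho>)"
  shows "inf_sharp G N \<rho> (ind_tangent G N \<rho> X) = j_map G N \<rho> X"
proof -
  obtain c where c: "c \<in> T.Z" "X = clG c"
    using assms by (rule H1_Theta_E)
  note a = delta_adapted[OF c(1)]
  define e where "e = sharp_cocycle c (delta c)"
  have e: "e \<in> S.Z"
    using c a by (simp add: e_def sharp_cocycle_Z1)
  have "inf_sharp G N \<rho> (ind_tangent G N \<rho> X) = H1_class G Th1 \<rho> (V.inflate (ident.push e))"
    using ident.push_Z1[OF e]
    by (simp add: c(2) ind_tangent_class[OF c(1) a] inf_sharp_def sharp_ident_def ident.H1_map_push[OF e]
        V.inflation_class flip: e_def)
  also have "\<dots> = H1_class G Th1 \<rho> (j.push c)"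
  proof (rule sym, rule V.H1_class_eqI)
    show "j.push c \<in> carrier (Z1 G Th1 \<rho>)"
      using c by (intro j.push_Z1)
    show "V.inflate (ident.push e) \<in> carrier (Z1 G Th1 \<rho>)"
      using e by (intro V.inflate_Z1 ident.push_Z1)
    have dT: "delta c yG \<in> carrier Th1"
    proof -
      have "delta c yG = dydy * norm_eps c"
        using Dy_kappa[of yGy] by (simp add: delta_def kappa_yGy dydy_def)
      then show ?thesis
        by (simp add: Theta1_I)
    qed
    \<comment> \<open>At x = y_G the inner \<rho>(g^-1) drops out by invariance, so g \<delta> g^-1
      - \<delta> becomes the coboundary of the single element \<delta>(y_G).\<close>
    have "V.inflate (ident.push e) g =
        \<rho> g (delta c yG) \<otimes>\<^bsub>Th1\<^esub> inv\<^bsub>Th1\<^esub> (delta c yG) \<otimes>\<^bsub>Th1\<^esub> j.push c g" if g: "g \<in> carrier G" for g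
      using g dT U.rcos_in_Mod[OF g]
      by (simp add: e_def sharp_cocycle_apply[OF c(1) a g yG_R] corrected_def yG_inv V_inv)
    then show "V.cohomologous (j.push c) (V.inflate (ident.push e))"
      using dT unfolding V.cohomologous_def by blast
  qed
  also have "\<dots> = j_map G N \<rho> X"
    using c by (simp add: j_map_def j.H1_map_push)
  finally show ?thesis .
qed

section \<open>The remaining maps: domains, injectivity and the identification with
  \<Theta>_1^N\<close>

lemma diagram:
  "iota_map G N \<rho> \<in> carrier (H1_Theta_N G N \<rho>) \<rightarrow> carrier (H1_Theta_sharp G N \<rho>)"
  "j_map G N \<rho> \<in> carrier (H1_Theta G \<rho>) \<rightarrow> carrier (H1_Theta1 G N \<rho>)"
  "inf_Theta G N \<rho> \<in> carrier (H1_Theta_N G N \<rho>) \<rightarrow> carrier (H1_Theta G \<rho>)"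
  "inj_on (inf_Theta G N \<rho>) (carrier (H1_Theta_N G N \<rho>))"
  "bij_betw (sharp_ident G N \<rho>) (carrier (H1_Theta_sharp G N \<rho>)) (carrier (H1_Theta1_N G N \<rho>))"
  "inf_sharp G N \<rho> \<in> carrier (H1_Theta_sharp G N \<rho>) \<rightarrow> carrier (H1_Theta1 G N \<rho>)"
  "inj_on (inf_sharp G N \<rho>) (carrier (H1_Theta_sharp G N \<rho>))"
proof -
  show "iota_map G N \<rho> \<in> carrier (H1_Theta_N G N \<rho>) \<rightarrow> carrier (H1_Theta_sharp G N \<rho>)"
    unfolding iota_map_def H1_Theta_N_def H1_Theta_sharp_def by (rule iota.H1_map_push_funcset)
  show "j_map G N \<rho> \<in> carrier (H1_Theta G \<rho>) \<rightarrow> carrier (H1_Theta1 G N \<rho>)"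
    unfolding j_map_def H1_Theta_def H1_Theta1_def by (rule j.H1_map_push_funcset)
  show "inf_Theta G N \<rho> \<in> carrier (H1_Theta_N G N \<rho>) \<rightarrow> carrier (H1_Theta G \<rho>)"
    unfolding inf_Theta_def H1_Theta_def H1_Theta_N_def by (rule U.inflation_funcset)
  show "inj_on (inf_Theta G N \<rho>) (carrier (H1_Theta_N G N \<rho>))"
    unfolding inf_Theta_def H1_Theta_N_def by (rule U.inflation_inj)
  show bij: "bij_betw (sharp_ident G N \<rho>) (carrier (H1_Theta_sharp G N \<rho>)) (carrier (H1_Theta1_N G N \<rho>))"
    unfolding sharp_ident_def H1_Theta_sharp_def H1_Theta1_N_def
    by (rule ident.H1_map_push_bij[OF Der_R_bij])
  have img: "sharp_ident G N \<rho> ` carrier (H1_Theta_sharp G N \<rho>) = carrier (H1_Theta1_N G N \<rho>)"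
    using bij by (rule bij_betw_imp_surj_on)
  show "inf_sharp G N \<rho> \<in> carrier (H1_Theta_sharp G N \<rho>) \<rightarrow> carrier (H1_Theta1 G N \<rho>)"
  proof
    fix X assume "X \<in> carrier (H1_Theta_sharp G N \<rho>)"
    then have "sharp_ident G N \<rho> X \<in> carrier (H1_Theta1_N G N \<rho>)"
      using img by blast
    then show "inf_sharp G N \<rho> X \<in> carrier (H1_Theta1 G N \<rho>)"
      using funcset_mem[OF V.inflation_funcset] by (simp add: inf_sharp_def H1_Theta1_def H1_Theta1_N_def)
  qed
  show "inj_on (inf_sharp G N \<rho>) (carrier (H1_Theta_sharp G N \<rho>))"
    unfolding inf_sharp_def
    by (rule comp_inj_on[OF bij_betw_imp_inj_on[OF bij]])
       (simp only: img H1_Theta1_N_def V.inflation_inj)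
qed

end

theorem theorem3p4:
  fixes G :: "('g, 'b) monoid_scheme"
    and \<rho> :: "'g \<Rightarrow> 'k::field fps \<Rightarrow> 'k fps"
    and N :: "'g set"
    and p :: nat
  assumes char_p: "CHAR('k) = p" "p > 0"
    and perfect: "surj (\<lambda>a::'k. a ^ p)"
    and "group G" "finite (carrier G)"
    and "local_action G \<rho>"
    and "N \<lhd> G"
  shows "iota_map G N \<rho> \<in> carrier (H1_Theta_N G N \<rho>) \<rightarrow> carrier (H1_Theta_sharp G N \<rho>)
    \<and> j_map G N \<rho> \<in> carrier (H1_Theta G \<rho>) \<rightarrow> carrier (H1_Theta1 G N \<rho>)
    \<and> inf_Theta G N \<rho> \<in> carrier (H1_Theta_N G N \<rho>) \<rightarrow> carrier (H1_Theta G \<rho>)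
    \<and> inj_on (inf_Theta G N \<rho>) (carrier (H1_Theta_N G N \<rho>))
    \<and> bij_betw (sharp_ident G N \<rho>) (carrier (H1_Theta_sharp G N \<rho>)) (carrier (H1_Theta1_N G N \<rho>))
    \<and> inf_sharp G N \<rho> \<in> carrier (H1_Theta_sharp G N \<rho>) \<rightarrow> carrier (H1_Theta1 G N \<rho>)
    \<and> inj_on (inf_sharp G N \<rho>) (carrier (H1_Theta_sharp G N \<rho>))
    \<and> ind_tangent G N \<rho> \<in> carrier (H1_Theta G \<rho>) \<rightarrow> carrier (H1_Theta_sharp G N \<rho>)
    \<and> (\<forall>X\<in>carrier (H1_Theta_N G N \<rho>).
         ind_tangent G N \<rho> (inf_Theta G N \<rho> X) = iota_map G N \<rho> X)
    \<and> (\<forall>X\<in>carrier (H1_Theta G \<rho>).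
         inf_sharp G N \<rho> (ind_tangent G N \<rho> X) = j_map G N \<rho> X)
    \<and> (\<forall>X\<in>carrier (H1_Theta_N G N \<rho>).
         inf_sharp G N \<rho> (iota_map G N \<rho> X) = j_map G N \<rho> (inf_Theta G N \<rho> X))"
proof -
  interpret fps_action_normal G \<rho> N
    using assms by (intro fps_action_normal.intro fps_action.intro fps_action_axioms.intro
        fps_action_normal_axioms.intro)
  \<comment> \<open>The square is obtained by pasting the two triangles along
    \<open>ind_tangent\<close>.\<close>
  have "inf_sharp G N \<rho> (iota_map G N \<rho> X) = j_map G N \<rho> (inf_Theta G N \<rho> X)"
    if X: "X \<in> carrier (H1_Theta_N G N \<rho>)" for X
    using inf_ind[OF funcset_mem[OF diagram(3) X]] ind_inf[OF X] by simp
  then show ?thesis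
    by (intro conjI ballI diagram ind_tangent_funcset ind_inf inf_ind)
qed

end
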